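(* Let $\mu=(\mu_1,\dots,\mu_l)$ and $\nu=(\nu_1,\dots,\nu_r)$ be compositions of $n$ (with $l=l(\mu)$ and $r=l(\nu)$ positive parts respectively). Then $$\mathrm{sbtr}(\mu,\nu)=(q-1)^{-l(\mu)-l(\nu)}\sum_{A}\ \prod_{i,j}\alpha_{a_{ij}}(q),$$ where the sum runs over all $l\times r$ matrices $A=(a_{ij})$ of nonnegative integers with row sums $\mu_1,\dots,\mu_l$ and column sums $\nu_1,\dots,\nu_r$.
   Context: The Hecke-Clifford algebra $\mathcal H^c_n$ is the associative (super)algebra over $\mathbb C(q^{1/2})$ with even generators $T_1,\dots,T_{n-1}$ and odd generators $c_1,\dots,c_n$ subject to: $(T_i-q)(T_i+1)=0$; $T_iT_j=T_jT_i$ for $|i-j|>1$; $T_iT_{i+1}T_i=T_{i+1}T_iT_{i+1}$; $c_i^2=1$, $c_ic_j=-c_jc_i$ ($i\ne j$); $T_ic_j=c_jT_i$ for $j\ne i,i+1$; $T_ic_i=c_{i+1}T_i$. For $\sigma\in S_n$, $T_\sigma$ is the product of the $T_i$ along a reduced expression of $\sigma$, and for $I=\{i_1<\dots<i_k\}\subset[n]$, $C_I=c_{i_1}\cdots c_{i_k}$, $C_\emptyset=1$. The elements $T_\sigma C_I$ form a basis of $\mathcal H^c_n$. Spin bitrace: for $x,y\in S_n$ and $I,J\subset[n]$, $\mathrm{sbtr}(T_xC_I,T_yC_J)=\sum_{z\in S_n,\,K\subset[n]}\big(T_xC_IT_zC_KT_yC_J\big)\big|_{T_zC_K}$, where $|_{T_zC_K}$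 denotes the coefficient of $T_zC_K$ in the basis expansion; i.e. it is the trace of the operator $h\mapsto T_xC_I\,h\,T_yC_J$ on $\mathcal H^c_n$. For a composition $\mu=(\mu_1,\dots,\mu_l)$ of $n$, $\gamma_\mu=\gamma_{\mu_1}\times\cdots\times\gamma_{\mu_l}\in S_{\mu_1}\times\cdots\times S_{\mu_l}\subset S_n$, where $\gamma_k=s_1s_2\cdots s_{k-1}$ is the standard Coxeter element of $S_k$ (a $k$-cycle). Put $\mathrm{sbtr}(\mu,\nu)=\mathrm{sbtr}(T_{\gamma_\mu},T_{\gamma_\nu})$. Polynomials: $\alpha_0(t)=1$ and for $n\ge1$, $\alpha_n(t)=\sum_{\rho}\frac{2^{l(\rho)}\prod_i(t^{\rho_i}-1)^2}{z_\rho}$, summed over partitions $\rho$ of $n$ with all parts odd, where $l(\rho)$ is the number of parts and $z_\rho=\prod_ii^{m_i}m_i!$ with $m_i$ the multiplicity of $i$ in $\rho$. *)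

theory Defs
  imports
    Complex_Main
    "HOL-Library.Multiset"
    "HOL-Library.Poly_Mapping"
    "HOL-Computational_Algebra.Polynomial"
    "HOL-Computational_Algebra.Fraction_Field"
    "HOL-Combinatorics.Permutations"
    "HOL-Algebra.QuotRing"
begin

section \<open>The ground field\<close>

text \<open>
  The field of rational functions over the complex numbers in one indeterminate \<open>v\<close>, where \<open>v\<close>
  plays the role of the square root of \<open>q\<close>.
\<close>

type_synonym hc_field = "complex poly fract"

definition q_half :: hc_field where
  "q_half = Fract [:0, 1:] 1"

definition q :: hc_field where
  "q = q_half\<^sup>2"


section \<open>The Hecke-Clifford algebra\<close>

datatype hc_gen = T_gen nat | C_gen nat

text \<open>
  Words, i.e. elements of the free monoid. The wrapper makes concatenation available as addition,
  which is what the convolution product of \<^typ>\<open>'a \<Rightarrow>\<^sub>0 'b\<close> expects; thus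
  \<open>hc_word \<Rightarrow>\<^sub>0 hc_field\<close> is the free associative unital algebra on \<^typ>\<open>hc_gen\<close>.
\<close>

datatype hc_word = Word (letters: "hc_gen list")

instantiation hc_word :: monoid_add
begin

definition zero_hc_word :: hc_word where
  "0 = Word []"

definition plus_hc_word :: "hc_word \<Rightarrow> hc_word \<Rightarrow> hc_word" where
  "u + w = Word (letters u @ letters w)"

instance
  by standard (simp_all add: zero_hc_word_def plus_hc_word_def)

end

type_synonym hc_free = "hc_word \<Rightarrow>\<^sub>0 hc_field"

definition gens :: "nat \<Rightarrow> hc_gen set" where
  "gens n = T_gen ` {1..<n} \<union> C_gen ` {1..n}"

definition free_alg :: "nat \<Rightarrow> hc_free ring" where
  "free_alg n =
     \<lparr> carrier = {p. \<forall>w \<in> Poly_Mapping.keys p. set (letters w) \<subseteq> gens n},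
       mult = (*), one = 1, zero = 0, add = (+) \<rparr>"

definition free_gen :: "hc_gen \<Rightarrow> hc_free" where
  "free_gen g = Poly_Mapping.single (Word [g]) 1"

definition free_scalar :: "hc_field \<Rightarrow> hc_free" where
  "free_scalar a = Poly_Mapping.single 0 a"

abbreviation free_T :: "nat \<Rightarrow> hc_free" where "free_T i \<equiv> free_gen (T_gen i)"
abbreviation free_C :: "nat \<Rightarrow> hc_free" where "free_C i \<equiv> free_gen (C_gen i)"

text \<open>A relation \<open>a = b\<close> of the presentation is recorded as the element \<open>a - b\<close>.\<close>

definition relators :: "nat \<Rightarrow> hc_free set" where
  "relators n =
     {(free_T i - free_scalar q) * (free_T i + 1) | i. i \<in> {1..<n}}
   \<union> {free_T i * free_T j - free_T j * free_T i | i j.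
        i \<in> {1..<n} \<and> j \<in> {1..<n} \<and> \<bar>int i - int j\<bar> > 1}
   \<union> {free_T i * free_T (i + 1) * free_T i - free_T (i + 1) * free_T i * free_T (i + 1) | i.
        i \<in> {1..<n} \<and> i + 1 \<in> {1..<n}}
   \<union> {free_C i * free_C i - 1 | i. i \<in> {1..n}}
   \<union> {free_C i * free_C j + free_C j * free_C i | i j. i \<in> {1..n} \<and> j \<in> {1..n} \<and> i \<noteq> j}
   \<union> {free_T i * free_C j - free_C j * free_T i | i j.
        i \<in> {1..<n} \<and> j \<in> {1..n} \<and> j \<noteq> i \<and> j \<noteq> i + 1}
   \<union> {free_T i * free_C i - free_C (i + 1) * free_T i | i. i \<in> {1..<n}}"

definition hc_ideal :: "nat \<Rightarrow> hc_free set" where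
  "hc_ideal n = genideal (free_alg n) (relators n)"

definition hecke_clifford :: "nat \<Rightarrow> hc_free set ring" where
  "hecke_clifford n = free_alg n Quot hc_ideal n"

definition hc_class :: "nat \<Rightarrow> hc_free \<Rightarrow> hc_free set" where
  "hc_class n p = hc_ideal n +>\<^bsub>free_alg n\<^esub> p"

definition hc_T :: "nat \<Rightarrow> nat \<Rightarrow> hc_free set" where
  "hc_T n i = hc_class n (free_T i)"

definition hc_C :: "nat \<Rightarrow> nat \<Rightarrow> hc_free set" where
  "hc_C n i = hc_class n (free_C i)"

text \<open>
  The structure map from the ground field to the algebra; scalar multiplication by \<open>a\<close> is
  multiplication by \<open>hc_scalar n a\<close>.
\<close>

definition hc_scalar :: "nat \<Rightarrow> hc_field \<Rightarrow> hc_free set" where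
  "hc_scalar n a = hc_class n (free_scalar a)"


section \<open>The basis \<open>T\<^sub>\<sigma> C\<^sub>I\<close> and coefficients\<close>

text \<open>Permutations compose as functions; the letter \<open>i\<close> stands for \<open>s\<^sub>i = (i, i + 1)\<close>.\<close>

definition word_perm :: "nat list \<Rightarrow> nat \<Rightarrow> nat" where
  "word_perm w = foldr (\<lambda>i \<sigma>. transpose i (i + 1) \<circ> \<sigma>) w id"

definition reduced_expression :: "nat \<Rightarrow> (nat \<Rightarrow> nat) \<Rightarrow> nat list \<Rightarrow> bool" where
  "reduced_expression n \<sigma> w \<longleftrightarrow>
     set w \<subseteq> {1..<n} \<and> word_perm w = \<sigma> \<and>
     (\<forall>u. set u \<subseteq> {1..<n} \<and> word_perm u = \<sigma> \<longrightarrow> length w \<le> length u)"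

definition hc_T_word :: "nat \<Rightarrow> nat list \<Rightarrow> hc_free set" where
  "hc_T_word n w =
     foldr (\<lambda>i h. hc_T n i \<otimes>\<^bsub>hecke_clifford n\<^esub> h) w \<one>\<^bsub>hecke_clifford n\<^esub>"

text \<open>By Matsumoto's theorem the product does not depend on the chosen reduced expression.\<close>

definition hc_T_perm :: "nat \<Rightarrow> (nat \<Rightarrow> nat) \<Rightarrow> hc_free set" where
  "hc_T_perm n \<sigma> = hc_T_word n (SOME w. reduced_expression n \<sigma> w)"

definition hc_C_set :: "nat \<Rightarrow> nat set \<Rightarrow> hc_free set" where
  "hc_C_set n I =
     foldr (\<lambda>i h. hc_C n i \<otimes>\<^bsub>hecke_clifford n\<^esub> h) (sorted_list_of_set I) \<one>\<^bsub>hecke_clifford n\<^esub>"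

definition hc_basis :: "nat \<Rightarrow> (nat \<Rightarrow> nat) \<times> nat set \<Rightarrow> hc_free set" where
  "hc_basis n = (\<lambda>(\<sigma>, I). hc_T_perm n \<sigma> \<otimes>\<^bsub>hecke_clifford n\<^esub> hc_C_set n I)"

definition basis_index :: "nat \<Rightarrow> ((nat \<Rightarrow> nat) \<times> nat set) set" where
  "basis_index n = {\<sigma>. \<sigma> permutes {1..n}} \<times> Pow {1..n}"

text \<open>
  The coordinate function of \<open>h\<close>, normalised to vanish off the index set so that it is unique.
\<close>

definition hc_coeffs :: "nat \<Rightarrow> hc_free set \<Rightarrow> (nat \<Rightarrow> nat) \<times> nat set \<Rightarrow> hc_field" where
  "hc_coeffs n h = (THE f.
     (\<forall>b. b \<notin> basis_index n \<longrightarrow> f b = 0) \<and>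
     h = (\<Oplus>\<^bsub>hecke_clifford n\<^esub>b \<in> basis_index n.
            hc_scalar n (f b) \<otimes>\<^bsub>hecke_clifford n\<^esub> hc_basis n b))"


section \<open>The spin bitrace\<close>

definition sbtr ::
  "nat \<Rightarrow> (nat \<Rightarrow> nat) \<times> nat set \<Rightarrow> (nat \<Rightarrow> nat) \<times> nat set \<Rightarrow> hc_field" where
  "sbtr n a b =
     (\<Sum>c \<in> basis_index n.
        hc_coeffs n
          (hc_basis n a \<otimes>\<^bsub>hecke_clifford n\<^esub> hc_basis n c \<otimes>\<^bsub>hecke_clifford n\<^esub> hc_basis n b) c)"

definition composition_of :: "nat list \<Rightarrow> nat \<Rightarrow> bool" where
  "composition_of \<mu> n \<longleftrightarrow> (\<forall>m \<in> set \<mu>. m > 0) \<and> sum_list \<mu> = n"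

text \<open>
  \<open>coxeter_from d \<mu>\<close> is \<open>\<gamma>\<^sub>\<mu>\<close> acting on the consecutive blocks that start after \<open>d\<close>;
  the block \<open>{d + 1..d + m}\<close> carries \<open>s\<^bsub>d+1\<^esub> s\<^bsub>d+2\<^esub> \<dots> s\<^bsub>d+m-1\<^esub>\<close>.
\<close>

fun coxeter_from :: "nat \<Rightarrow> nat list \<Rightarrow> nat \<Rightarrow> nat" where
  "coxeter_from d [] = id"
| "coxeter_from d (m # \<mu>) = word_perm [d + 1..<d + m] \<circ> coxeter_from (d + m) \<mu>"

definition coxeter_perm :: "nat list \<Rightarrow> nat \<Rightarrow> nat" where
  "coxeter_perm \<mu> = coxeter_from 0 \<mu>"

text \<open>Here \<open>T\<^sub>\<sigma> = T\<^sub>\<sigma> C\<^bsub>{}\<^esub>\<close>.\<close>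

definition sbtr_comp :: "nat \<Rightarrow> nat list \<Rightarrow> nat list \<Rightarrow> hc_field" where
  "sbtr_comp n \<mu> \<nu> = sbtr n (coxeter_perm \<mu>, {}) (coxeter_perm \<nu>, {})"


section \<open>The polynomials \<open>\<alpha>\<^sub>n\<close>\<close>

text \<open>Partitions are multisets of parts; oddness of the parts forces them to be positive.\<close>

definition odd_partitions :: "nat \<Rightarrow> nat multiset set" where
  "odd_partitions n = {\<rho>. sum_mset \<rho> = n \<and> (\<forall>k \<in># \<rho>. odd k)}"

definition z_part :: "nat multiset \<Rightarrow> nat" where
  "z_part \<rho> = (\<Prod>i \<in> set_mset \<rho>. i ^ count \<rho> i * fact (count \<rho> i))"

definition alpha :: "nat \<Rightarrow> 'a::field poly" where
  "alpha n =
     (if n = 0 then 1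
      else \<Sum>\<rho> \<in> odd_partitions n.
        smult (2 ^ size \<rho> / of_nat (z_part \<rho>)) (\<Prod>k \<in># \<rho>. (monom 1 k - 1)\<^sup>2))"


section \<open>Matrices with given margins\<close>

text \<open>
  An \<open>l \<times> r\<close> matrix is a function of two indices \<open>i < l\<close>, \<open>j < r\<close>, required to vanish outside this
  range so that each matrix is represented exactly once.
\<close>

definition margin_matrices :: "nat list \<Rightarrow> nat list \<Rightarrow> (nat \<Rightarrow> nat \<Rightarrow> nat) set" where
  "margin_matrices \<mu> \<nu> =
     {A. (\<forall>i j. \<not> (i < length \<mu> \<and> j < length \<nu>) \<longrightarrow> A i j = 0) \<and>
         (\<forall>i < length \<mu>. (\<Sum>j < length \<nu>. A i j) = \<mu> ! i) \<and>
         (\<forall>j < length \<nu>. (\<Sum>i < length \<mu>. A i j) = \<nu> ! j)}"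

end

theory Submission
  imports Defs "HOL-Computational_Algebra.Formal_Power_Series"
begin

text \<open>
  Right multiplication on the basis \<open>T\<^sub>\<sigma> C\<^sub>I\<close> is an explicit action by operators that are local in the site
  contents \<open>(\<sigma> j, j \<in> I)\<close>; checking the relations for them, together with a spanning argument, makes
  the Hecke-Clifford algebra a faithful cyclic module, so the bitrace becomes the trace of a product of a
  left and a right operator.

  Let \<open>\<tau>(\<mu>, y)\<close> be the trace of \<open>h \<mapsto> T\<^bsub>\<gamma>\<mu>\<^esub> h y\<close>. If \<open>y = y\<^sub>1 y\<^sub>2\<close> lies in a parabolic subalgebra, then only
  the diagonal part of \<open>T\<^bsub>\<gamma>\<mu>\<^esub>\<close> with respect to cosets counts, and \<open>(q - 1)\<^bsup>l(\<mu>)\<^esup> \<tau>(\<mu>, y\<^sub>1 y\<^sub>2)\<close> is the sum of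
  \<open>(q - 1)\<^bsup>l(\<kappa>)\<^esup> \<tau>(\<kappa>, y\<^sub>1) (q - 1)\<^bsup>l(\<kappa>')\<^esup> \<tau>(\<kappa>', y\<^sub>2)\<close> over all splittings \<open>\<mu> = \<kappa> + \<kappa>'\<close>, where \<open>l\<close> counts nonzero
  parts. This reduces everything to \<open>\<tau>(\<kappa>, T\<^bsub>\<gamma>n\<^esub>)\<close>. In the cocenter the symmetrizing idempotents satisfy
  Newton's identity \<open>[n] h\<^sub>n = \<Sum>\<^sub>b h\<^bsub>n-b\<^esub> T\<^bsub>\<gamma>b\<^esub>\<close>, so it suffices to know \<open>\<tau>(\<kappa>, h\<^sub>n)\<close>. An anti-automorphism turns
  this into a trace on the Clifford algebra, where again only diagonal terms count; the answer is a product
  over the parts of \<open>\<kappa>\<close> with generating function \<open>V(z) = (1 + q z) (1 - z) / ((1 - q z) (1 + z))\<close>. Newton's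
  identity then reads \<open>V(q z) = V(z) \<alpha>(z)\<close>, which identifies the coefficients of \<open>\<alpha>\<close>.
\<close>

section \<open>Linear operators and the right regular representation\<close>

text \<open>Left multiplication by \<open>T_i\<close> changes only the permutation in
  \<open>T_\<sigma> C_I\<close>, while right multiplication also mixes the Clifford bits. This
  asymmetry decides the construction: \<open>T_{\<gamma>_\<mu>}\<close> stays on the left, the
  second factor is cut into parabolic pieces on the right, and the symmetrizer, which Newton's
  identity produces on the right, has to be carried to the left, where its image is spanned by one
  vector for each subset \<open>I\<close>. One factor \<open>q - 1\<close> per nonzero part makes
  splittings multiplicative: a part that is cut into two nonzero parts contributes exactly one
  further \<open>q - 1\<close>. For a single part Newton's identity becomes
  \<open>(q^n - 1) V_n = \<Sum> V_a \<alpha>_{n-a}\<close> over \<open>a < n\<close>. The odd parts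
  and the squares in \<open>\<alpha>\<close> come from
  \<open>log V(z) = 2 \<Sum> (q^k - 1) z^k / k\<close> over odd \<open>k\<close>: replacing
  \<open>z\<close> by \<open>q z\<close> multiplies the \<open>k\<close>-th coefficient by
  \<open>q^k\<close>, and the difference is \<open>2 \<Sum> (q^k - 1)^2 z^k / k\<close>.\<close>

typedef 'b linop = "{F :: ('b \<Rightarrow> hc_field) \<Rightarrow> 'b \<Rightarrow> hc_field.
    (\<forall>f g. F (\<lambda>x. f x + g x) = (\<lambda>x. F f x + F g x)) \<and> (\<forall>a f. F (\<lambda>x. a * f x) = (\<lambda>x. a * F f x))}"
  morphisms app Linop
  by (rule exI[of _ "\<lambda>f. f"]) auto

setup_lifting type_definition_linop

text \<open>Products are in application order, \<open>F * G\<close> applying \<open>F\<close> first: right multiplications compose this way.\<close>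

instantiation linop :: (type) ring_1
begin

lift_definition zero_linop :: "'a linop" is "\<lambda>f x. 0" by simp
lift_definition one_linop :: "'a linop" is "\<lambda>f. f" by simp
lift_definition plus_linop :: "'a linop \<Rightarrow> 'a linop \<Rightarrow> 'a linop" is "\<lambda>F G f x. F f x + G f x"
  by (simp add: algebra_simps)
lift_definition minus_linop :: "'a linop \<Rightarrow> 'a linop \<Rightarrow> 'a linop" is "\<lambda>F G f x. F f x - G f x"
  by (simp add: algebra_simps)
lift_definition uminus_linop :: "'a linop \<Rightarrow> 'a linop" is "\<lambda>F f x. - F f x"
  by (simp add: algebra_simps)
lift_definition times_linop :: "'a linop \<Rightarrow> 'a linop \<Rightarrow> 'a linop" is "\<lambda>F G f. G (F f)"
  by simp

instance
proof
  show "(0::'a linop) \<noteq> 1"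
  proof
    assume "(0::'a linop) = 1"
    then have "app (0::'a linop) (\<lambda>_. 1) undefined = app 1 (\<lambda>_. 1) undefined" by simp
    then show False by (simp add: zero_linop.rep_eq one_linop.rep_eq)
  qed
qed (transfer; simp add: fun_eq_iff algebra_simps)+

end

lemma app_add [simp]: "app F (\<lambda>x. f x + g x) = (\<lambda>x. app F f x + app F g x)"
  by transfer simp

lemma app_scale [simp]: "app F (\<lambda>x. a * f x) = (\<lambda>x. a * app F f x)"
  by transfer simp

lemma app_zero [simp]: "app F (\<lambda>x. 0) = (\<lambda>x. 0)"
  using app_scale[of F 0] by simp

lemma app_diff [simp]: "app F (\<lambda>x. f x - g x) = (\<lambda>x. app F f x - app F g x)"
  using app_add[of F f "\<lambda>x. - 1 * g x"] unfolding app_scale by simp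

lemma app_sum: "app F (\<lambda>x. \<Sum>i\<in>S. f i x) = (\<lambda>x. \<Sum>i\<in>S. app F (f i) x)"
  by (induction S rule: infinite_finite_induct) simp_all

lemma app_times [simp]: "app (F * G) f = app G (app F f)"
  by transfer simp

lemma app_one [simp]: "app 1 f = f" by transfer simp
lemma app_0 [simp]: "app 0 f = (\<lambda>x. 0)" by transfer simp
lemma app_plus [simp]: "app (F + G) f = (\<lambda>x. app F f x + app G f x)" by transfer simp
lemma app_minus [simp]: "app (F - G) f = (\<lambda>x. app F f x - app G f x)" by transfer simp
lemma app_uminus [simp]: "app (- F) f = (\<lambda>x. - app F f x)" by transfer simp

lemma app_sum_op: "app (sum F S) f = (\<lambda>x. \<Sum>i\<in>S. app (F i) f x)"
  by (induction S rule: infinite_finite_induct) simp_all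

lemma linop_eqI: "(\<And>f x. app F f x = app G f x) \<Longrightarrow> F = G"
  by (simp add: app_inject[symmetric] fun_eq_iff)

definition scal :: "hc_field \<Rightarrow> 'b linop" where
  "scal a = Linop (\<lambda>f x. a * f x)"

lemma app_scal [simp]: "app (scal a) f = (\<lambda>x. a * f x)"
  unfolding scal_def by (subst Linop_inverse) (simp_all add: algebra_simps)

lemma scal_add: "scal (a + b) = scal a + scal b" by (rule linop_eqI) (simp add: algebra_simps)
lemma scal_diff: "scal (a - b) = scal a - scal b" by (rule linop_eqI) (simp add: algebra_simps)
lemma scal_mult: "scal (a * b) = scal a * scal b" by (rule linop_eqI) (simp add: algebra_simps)
lemma scal_0 [simp]: "scal 0 = 0" by (rule linop_eqI) simp
lemma scal_1 [simp]: "scal 1 = 1" by (rule linop_eqI) simp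
lemma scal_commute: "scal a * F = F * scal a" by (rule linop_eqI) simp

text \<open>\<open>g s a b\<close> is the coordinate of a vector at the state with Clifford bits \<open>a\<close>, \<open>b\<close> at the sites \<open>j\<close>, \<open>j + 1\<close> and
  with the values of \<open>\<sigma>\<close> there exchanged iff \<open>s\<close>; the formulas come from moving \<open>T\<^sub>j\<close> to the left through
  \<open>C\<^sub>I\<close>.\<close>

definition local_T :: "bool \<Rightarrow> bool \<Rightarrow> bool \<Rightarrow> (bool \<Rightarrow> bool \<Rightarrow> bool \<Rightarrow> hc_field) \<Rightarrow> hc_field" where
  "local_T asc a b g =
     (let t = (\<lambda>a b. if asc then q * g True a b else g True a b + (q - 1) * g False a b) in
      if a then if b then (q - 1) * g False True True - t True True
                else t False True + (q - 1) * g False True False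
      else if b then t True False - (q - 1) * g False True False
      else t False False + (q - 1) * g False True True)"

type_synonym site = "nat \<times> bool"

definition set_sites :: "nat \<Rightarrow> (nat \<Rightarrow> site) \<Rightarrow> bool \<Rightarrow> bool \<Rightarrow> bool \<Rightarrow> nat \<Rightarrow> site" where
  "set_sites j u s a b = u(j := (fst (u (if s then Suc j else j)), a), Suc j := (fst (u (if s then j else Suc j)), b))"

text \<open>A state may be any function from sites to contents, even with repeated values, so the
  relations among these operators can be checked without assuming that a permutation is present. The
  restriction to basis states enters later through supports.\<close>

lift_definition right_T :: "nat \<Rightarrow> (nat \<Rightarrow> site) linop" is
  "\<lambda>j f u. local_T (fst (u j) < fst (u (Suc j))) (snd (u j)) (snd (u (Suc j))) (\<lambda>s a b. f (set_sites j u s a b))"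
  by (simp add: fun_eq_iff local_T_def algebra_simps)

text \<open>The sign of carrying \<open>c_j\<close>, multiplied on from the right, past the factors
  \<open>c_k\<close> with \<open>k > j\<close> to its place in the increasing product.\<close>

definition tail_sign :: "nat \<Rightarrow> nat \<Rightarrow> (nat \<Rightarrow> site) \<Rightarrow> hc_field" where
  "tail_sign n j u = (\<Prod>k\<in>{j<..n}. if snd (u k) then - 1 else 1)"

definition flip :: "nat \<Rightarrow> (nat \<Rightarrow> site) \<Rightarrow> nat \<Rightarrow> site" where
  "flip j u = u(j := (fst (u j), \<not> snd (u j)))"

lift_definition right_C :: "nat \<Rightarrow> nat \<Rightarrow> (nat \<Rightarrow> site) linop" is
  "\<lambda>n j f u. tail_sign n j u * f (flip j u)"
  by (simp add: fun_eq_iff algebra_simps)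

definition swap_values :: "nat \<Rightarrow> (nat \<Rightarrow> site) \<Rightarrow> nat \<Rightarrow> site" where
  "swap_values i u = (\<lambda>k. (transpose i (Suc i) (fst (u k)), snd (u k)))"

abbreviation inv_fun :: "('a \<Rightarrow> 'b) \<Rightarrow> 'b \<Rightarrow> 'a" where
  "inv_fun \<equiv> inv_into UNIV"

definition left_ascent :: "nat \<Rightarrow> (nat \<Rightarrow> site) \<Rightarrow> bool" where
  "left_ascent i u \<longleftrightarrow> inv_fun (\<lambda>k. fst (u k)) i < inv_fun (\<lambda>k. fst (u k)) (Suc i)"

text \<open>Cut off to 0 outside bijections, since \<open>left_ascent\<close> compares positions
  through an inverse. Exchanging values or sites keeps bijectivity, so the cut is compatible with
  the right operators.\<close>

lift_definition left_T :: "nat \<Rightarrow> (nat \<Rightarrow> site) linop" is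
  "\<lambda>i f u. if bij (\<lambda>k. fst (u k)) then
       if left_ascent i u then q * f (swap_values i u) else f (swap_values i u) + (q - 1) * f u else 0"
  by (simp add: fun_eq_iff algebra_simps)

section \<open>The defining relations for the right operators, and their commutation with left
  multiplication\<close>

lemma tail_sign_upd: "tail_sign n j (u(i := p)) =
   (if j < i \<and> i \<le> n \<and> snd p \<noteq> snd (u i) then - tail_sign n j u else tail_sign n j u)"
proof (cases "i \<in> {j<..n}")
  case True
  have "tail_sign n j (u(i := p)) = (if snd p then - 1 else 1) * (\<Prod>k\<in>{j<..n} - {i}. if snd (u k) then - 1 else 1)"
    unfolding tail_sign_def by (subst prod.remove[of _ i]) (use True in auto)
  moreover have "tail_sign n j u = (if snd (u i) then - 1 else 1) * (\<Prod>k\<in>{j<..n} - {i}. if snd (u k) then - 1 else 1)"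
    unfolding tail_sign_def by (subst prod.remove[of _ i]) (use True in auto)
  ultimately show ?thesis using True by auto
next
  case False
  then show ?thesis unfolding tail_sign_def by (auto intro!: prod.cong)
qed

lemma tail_sign_square: "tail_sign n j u * tail_sign n j u = 1"
  unfolding tail_sign_def by (simp add: prod.distrib[symmetric] if_distrib cong: if_cong)

lemma right_C_square: "right_C n i * right_C n i = 1"
proof (rule linop_eqI)
  fix f and u :: "nat \<Rightarrow> site"
  have "app (right_C n i * right_C n i) f u = (tail_sign n i u * tail_sign n i u) * f u"
    by (simp add: right_C.rep_eq flip_def tail_sign_upd)
  then show "app (right_C n i * right_C n i) f u = app 1 f u" by (simp add: tail_sign_square)
qed

lemma right_C_anticomm:
  assumes "i \<noteq> j" "i \<le> n" "j \<le> n"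
  shows "right_C n i * right_C n j = - (right_C n j * right_C n i)"
proof (rule linop_eqI)
  fix f and u :: "nat \<Rightarrow> site"
  have "flip j (flip i u) = flip i (flip j u)" using assms by (auto simp: flip_def fun_eq_iff)
  then show "app (right_C n i * right_C n j) f u = app (- (right_C n j * right_C n i)) f u" using assms
    by (cases "i < j") (simp_all add: right_C.rep_eq flip_def tail_sign_upd)
qed

lemma right_T_quadratic: "right_T j * right_T j = scal (q - 1) * right_T j + scal q"
proof (rule linop_eqI)
  fix f and u :: "nat \<Rightarrow> site"
  obtain x a y b where u: "u j = (x, a)" "u (Suc j) = (y, b)" by fastforce
  have e: "u(j := (x, a), Suc j := (y, b)) = u" using u by (auto simp: fun_eq_iff)
  have e': "x = y \<Longrightarrow> u(j := (y, a), Suc j := (y, b)) = u" using u by (auto simp: fun_eq_iff)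
  show "app (right_T j * right_T j) f u = app (scal (q - 1) * right_T j + scal q) f u"
    by (cases a; cases b; rule linorder_cases[of x y])
      (use e e' u in \<open>simp_all add: right_T.rep_eq set_sites_def local_T_def Let_def algebra_simps\<close>)
qed

lemma right_T_commute:
  assumes "Suc i < j \<or> Suc j < i"
  shows "right_T i * right_T j = right_T j * right_T i"
proof (rule linop_eqI)
  fix f and u :: "nat \<Rightarrow> site"
  have e: "set_sites i (set_sites j u s a b) s' a' b' = set_sites j (set_sites i u s' a' b') s a b" for s a b s' a' b'
    using assms by (auto simp: set_sites_def fun_eq_iff)
  have e1: "set_sites i u s a b j = u j" "set_sites i u s a b (Suc j) = u (Suc j)"
    "set_sites j u s a b i = u i" "set_sites j u s a b (Suc i) = u (Suc i)" for s a b
    using assms by (auto simp: set_sites_def)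
  show "app (right_T i * right_T j) f u = app (right_T j * right_T i) f u"
    by (simp add: right_T.rep_eq e e1) (simp add: local_T_def Let_def algebra_simps)
qed

type_synonym triple_fun = "nat \<Rightarrow> nat \<Rightarrow> nat \<Rightarrow> bool \<Rightarrow> bool \<Rightarrow> bool \<Rightarrow> hc_field"

text \<open>\<open>locA\<close> and \<open>locB\<close> are the right operators at the two
  overlapping pairs among three adjacent sites, with the contents as separate arguments. This turns
  the braid relation into a finite check over order types and bits.\<close>

definition locA :: "triple_fun \<Rightarrow> triple_fun" where
  "locA G x y z a b c = local_T (x < y) a b (\<lambda>s a b. if s then G y x z a b c else G x y z a b c)"

definition locB :: "triple_fun \<Rightarrow> triple_fun" where
  "locB G x y z a b c = local_T (y < z) b c (\<lambda>s b c. if s then G x z y a b c else G x y z a b c)"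

lemma local_T_braid: "locA (locB (locA G)) x y z a b c = locB (locA (locB G)) x y z a b c"
  by (cases a; cases b; cases c; rule linorder_cases[of x y]; rule linorder_cases[of y z]; rule linorder_cases[of x z])
    (simp_all add: locA_def locB_def local_T_def algebra_simps)

lemma right_T_braid: "right_T j * right_T (Suc j) * right_T j = right_T (Suc j) * right_T j * right_T (Suc j)"
proof (rule linop_eqI)
  fix f and u :: "nat \<Rightarrow> site"
  \<comment> \<open>With \<open>u\<close> frozen outside the three sites, \<open>R\<close>
    translates the two operators into \<open>locA\<close> and \<open>locB\<close>.\<close>
  define w where "w x y z a b c = u(j := (x, a), Suc j := (y, b), Suc (Suc j) := (z, c))" for x y z :: nat and a b c :: bool
  define R where "R g x y z a b c = g (w x y z a b c)" for g :: "(nat \<Rightarrow> site) \<Rightarrow> hc_field" and x y z a b c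
  have A: "R (app (right_T j) g) = locA (R g)" for g
    by (auto simp: fun_eq_iff R_def locA_def right_T.rep_eq w_def set_sites_def local_T_def Let_def fun_upd_twist)
  have B: "R (app (right_T (Suc j)) g) = locB (R g)" for g
    by (auto simp: fun_eq_iff R_def locB_def right_T.rep_eq w_def set_sites_def local_T_def Let_def fun_upd_twist)
  have "R (app (right_T j * right_T (Suc j) * right_T j) f) = R (app (right_T (Suc j) * right_T j * right_T (Suc j)) f)"
    by (simp add: A B fun_eq_iff local_T_braid)
  moreover have "g u = R g (fst (u j)) (fst (u (Suc j))) (fst (u (Suc (Suc j)))) (snd (u j)) (snd (u (Suc j))) (snd (u (Suc (Suc j))))" for g
    by (auto simp: R_def w_def intro!: arg_cong[of _ _ g])
  ultimately show "app (right_T j * right_T (Suc j) * right_T j) f u = app (right_T (Suc j) * right_T j * right_T (Suc j)) f u"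
    by metis
qed

lemma right_T_rC_far:
  assumes "j \<noteq> i" "j \<noteq> Suc i" "i < n"
  shows "right_T i * right_C n j = right_C n j * right_T i"
proof (rule linop_eqI)
  fix f and u :: "nat \<Rightarrow> site"
  have e: "flip j (set_sites i u s a b) = set_sites i (flip j u) s a b" for s a b
    using assms by (auto simp: flip_def set_sites_def fun_eq_iff)
  have e1: "flip j u i = u i" "flip j u (Suc i) = u (Suc i)" using assms by (auto simp: flip_def)
  have c: "tail_sign n j (set_sites i u s a b) = (if j < i \<and> (a = b) \<noteq> (snd (u i) = snd (u (Suc i))) then - tail_sign n j u else tail_sign n j u)" for s a b
    using assms unfolding set_sites_def by (auto simp: tail_sign_upd)
  show "app (right_T i * right_C n j) f u = app (right_C n j * right_T i) f u"
    by (simp add: right_T.rep_eq right_C.rep_eq e e1 c) (simp add: local_T_def Let_def algebra_simps)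
qed

lemma right_T_rC:
  assumes "i < n"
  shows "right_T i * right_C n i = right_C n (Suc i) * right_T i"
proof (rule linop_eqI)
  fix f and u :: "nat \<Rightarrow> site"
  obtain x a y b where u: "u i = (x, a)" "u (Suc i) = (y, b)" by fastforce
  have s: "tail_sign n i u = (if b then - tail_sign n (Suc i) u else tail_sign n (Suc i) u)"
  proof -
    have "{i<..n} = insert (Suc i) {Suc i<..n}" using assms by auto
    then show ?thesis using u by (simp add: tail_sign_def)
  qed
  have c: "tail_sign n (Suc i) (set_sites i u s a b) = tail_sign n (Suc i) u" for s a b
    unfolding set_sites_def by (auto simp: tail_sign_upd)
  have e: "u(Suc i := p, i := p') = u(i := p', Suc i := p)" for p p' by (auto simp: fun_eq_iff)
  show "app (right_T i * right_C n i) f u = app (right_C n (Suc i) * right_T i) f u"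
    by (cases a; cases b) (use u in \<open>simp_all add: right_T.rep_eq right_C.rep_eq s c\<close>, simp_all add: local_T_def Let_def flip_def set_sites_def e algebra_simps u)
qed

lemma inv_transpose:
  assumes "bij \<sigma>"
  shows "inv_fun (\<sigma> \<circ> transpose j k) = transpose j k \<circ> inv_fun (\<sigma> :: 'a \<Rightarrow> 'a)"
  by (simp add: assms o_inv_distrib)

text \<open>Exchanging the values \<open>i\<close>, \<open>i + 1\<close> and exchanging the sites
  \<open>j\<close>, \<open>j + 1\<close> interact only if these sites carry these values. Then
  \<open>s_i \<sigma> = \<sigma> s_j\<close>, and both operators mix the same two
  permutations.\<close>

lemma left_T_rT_commute: "left_T i * right_T j = right_T j * left_T i"
proof (rule linop_eqI)
  fix f :: "(nat \<Rightarrow> site) \<Rightarrow> hc_field" and u :: "nat \<Rightarrow> site"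
  define \<sigma> where "\<sigma> = (\<lambda>k. fst (u k))"
  define g where "g s a b = f (set_sites j u s a b)" for s a b
  define h where "h s a b = f (swap_values i (set_sites j u s a b))" for s a b
  have fu: "(\<lambda>k. fst (set_sites j u s a b k)) = (if s then \<sigma> \<circ> transpose j (Suc j) else \<sigma>)" for s a b
    by (auto simp: \<sigma>_def set_sites_def fun_eq_iff transpose_def)
  have mv: "swap_values i (set_sites j u s a b) = set_sites j (swap_values i u) s a b" for s a b
    by (auto simp: swap_values_def set_sites_def fun_eq_iff)
  have bj: "bij (if s then \<sigma> \<circ> transpose j (Suc j) else \<sigma>) \<longleftrightarrow> bij \<sigma>" for s
    by simp (metis bij_comp bij_swap_iff o_assoc comp_id transpose_comp_involutory bij_transpose)
  show "app (left_T i * right_T j) f u = app (right_T j * left_T i) f u"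
  proof (cases "bij \<sigma>")
    case False
    then show ?thesis by (simp add: left_T.rep_eq right_T.rep_eq fu bj \<sigma>_def[symmetric]) (simp add: local_T_def swap_values_def comp_def)
  next
    case True
    have ne: "\<sigma> j \<noteq> \<sigma> (Suc j)" using True by (metis bij_pointE n_not_Suc_n)
    let ?asc = "\<sigma> j < \<sigma> (Suc j)"
    let ?asc' = "transpose i (Suc i) (\<sigma> j) < transpose i (Suc i) (\<sigma> (Suc j))"
    let ?P = "\<lambda>s. inv_fun (if s then \<sigma> \<circ> transpose j (Suc j) else \<sigma>) i < inv_fun (if s then \<sigma> \<circ> transpose j (Suc j) else \<sigma>) (Suc i)"
    let ?x = "snd (u j)" let ?y = "snd (u (Suc j))"
    have L: "app (left_T i * right_T j) f u = local_T ?asc ?x ?y (\<lambda>s a b. if ?P s then q * h s a b else h s a b + (q - 1) * g s a b)"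
      using True bj by (simp add: left_T.rep_eq right_T.rep_eq fu left_ascent_def g_def h_def \<sigma>_def cong: if_cong)
    have R: "app (right_T j * left_T i) f u = (if ?P False then q * local_T ?asc' ?x ?y h else local_T ?asc' ?x ?y h + (q - 1) * local_T ?asc ?x ?y g)"
      using True by (simp add: left_T.rep_eq right_T.rep_eq left_ascent_def g_def h_def[abs_def] mv cong: if_cong) (simp add: \<sigma>_def swap_values_def g_def[abs_def])
    have iT: "?P True \<longleftrightarrow> transpose j (Suc j) (inv_fun \<sigma> i) < transpose j (Suc j) (inv_fun \<sigma> (Suc i))"
      using True by (simp add: inv_transpose)
    show ?thesis
    proof (cases "{\<sigma> j, \<sigma> (Suc j)} = {i, Suc i}")
      case special: True
      have hg: "h s a b = g (\<not> s) a b" for s a b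
      proof -
        have "swap_values i (set_sites j u s a b) = set_sites j u (\<not> s) a b"
        proof
          fix k
          have "transpose i (Suc i) (fst (u k)) = fst (u k)" if "k \<noteq> j" "k \<noteq> Suc j"
          proof -
            have "\<sigma> k \<noteq> \<sigma> j" "\<sigma> k \<noteq> \<sigma> (Suc j)" using that True by (metis bij_pointE)+
            then have "\<sigma> k \<noteq> i" "\<sigma> k \<noteq> Suc i" using special by auto
            then show ?thesis by (simp add: \<sigma>_def)
          qed
          moreover have "transpose i (Suc i) (\<sigma> j) = \<sigma> (Suc j)" "transpose i (Suc i) (\<sigma> (Suc j)) = \<sigma> j"
            using special by (auto simp: doubleton_eq_iff)
          ultimately show "swap_values i (set_sites j u s a b) k = set_sites j u (\<not> s) a b k"
            unfolding \<sigma>_def by (auto simp: swap_values_def set_sites_def)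
        qed
        then show ?thesis by (simp add: h_def g_def)
      qed
      have a: "?asc' = (\<not> ?asc)" using special ne by (auto simp: doubleton_eq_iff)
      have iv: "inv_fun \<sigma> (\<sigma> k) = k" for k using True by (simp add: bij_is_inj)
      have P: "?P False = ?asc" "?P True = (\<not> ?asc)"
        using special iv[of j] iv[of "Suc j"] unfolding iT by (auto simp: doubleton_eq_iff)
      show ?thesis unfolding L R a hg local_T_def Let_def using P ne by (cases ?asc) (simp_all add: algebra_simps)
    next
      case False
      \<comment> \<open>In the remaining case neither exchange alters the comparison that the other
        operator makes.\<close>
      have a: "?asc' = ?asc" using False ne by (auto simp: transpose_def doubleton_eq_iff)
      have "{inv_fun \<sigma> i, inv_fun \<sigma> (Suc i)} \<noteq> {j, Suc j}"
      proof
        assume "{inv_fun \<sigma> i, inv_fun \<sigma> (Suc i)} = {j, Suc j}"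
        then have "\<sigma> ` {inv_fun \<sigma> i, inv_fun \<sigma> (Suc i)} = \<sigma> ` {j, Suc j}" by simp
        then show False using False True by (simp add: bij_is_surj surj_f_inv_f insert_commute)
      qed
      moreover have "inv_fun \<sigma> i \<noteq> inv_fun \<sigma> (Suc i)" using True by (metis bij_inv_eq_iff n_not_Suc_n)
      ultimately have P: "?P True = ?P False" unfolding iT by (auto simp: transpose_def doubleton_eq_iff)
      show ?thesis unfolding L R a local_T_def Let_def using P by (simp add: algebra_simps)
    qed
  qed
qed

section \<open>Linear extension of maps from words to the free algebra\<close>

locale scalar_hom =
  fixes sc :: "hc_field \<Rightarrow> 'r::ring_1"
  assumes sc_add: "sc (a + b) = sc a + sc b"
    and sc_mult: "sc (a * b) = sc a * sc b"
    and sc_one: "sc 1 = 1"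
    and sc_commute: "sc a * x = x * sc a"
begin

lemma sc_zero: "sc 0 = 0"
  using sc_add[of 0 0] by simp

text \<open>There are two targets: operators, with a multiplicative \<open>W\<close>, give the
  representation \<open>Phi\<close>; the free algebra itself, with a \<open>W\<close> that reverses
  products, gives \<open>theta\<close>. Both work because scalars are central in the target.\<close>

definition ext :: "(hc_word \<Rightarrow> 'r) \<Rightarrow> hc_free \<Rightarrow> 'r" where
  "ext W p = (\<Sum>w\<in>Poly_Mapping.keys p. sc (Poly_Mapping.lookup p w) * W w)"

lemma ext_superset:
  assumes "finite S" "Poly_Mapping.keys p \<subseteq> S"
  shows "ext W p = (\<Sum>w\<in>S. sc (Poly_Mapping.lookup p w) * W w)"
  unfolding ext_def by (rule sum.mono_neutral_left) (use assms in \<open>auto simp: in_keys_iff sc_zero\<close>)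

lemma ext_zero [simp]: "ext W 0 = 0"
  by (simp add: ext_def)

lemma ext_add: "ext W (p + r) = ext W p + ext W r"
proof -
  let ?S = "Poly_Mapping.keys p \<union> Poly_Mapping.keys r"
  have "ext W (p + r) = (\<Sum>w\<in>?S. sc (Poly_Mapping.lookup (p + r) w) * W w)"
    by (rule ext_superset) (simp_all add: Poly_Mapping.keys_add)
  also have "\<dots> = ext W p + ext W r"
    by (simp add: ext_superset[of ?S] lookup_add sc_add distrib_right sum.distrib)
  finally show ?thesis .
qed

lemma ext_uminus: "ext W (- p) = - ext W p"
  using ext_add[of W p "- p"] by (simp add: add_eq_0_iff)

lemma ext_diff: "ext W (p - r) = ext W p - ext W r"
  using ext_add[of W p "- r"] by (simp add: ext_uminus)

lemma ext_sum: "ext W (\<Sum>i\<in>S. f i) = (\<Sum>i\<in>S. ext W (f i))"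
  by (induction S rule: infinite_finite_induct) (simp_all add: ext_add)

lemma ext_single: "ext W (Poly_Mapping.single w a) = sc a * W w"
  by (simp add: ext_def sc_zero)

end

lemma poly_mapping_eq_sum_single:
  "p = (\<Sum>w\<in>Poly_Mapping.keys p. Poly_Mapping.single w (Poly_Mapping.lookup p w))"
  by (rule poly_mapping_eqI)
    (simp add: lookup_sum lookup_single when_def in_keys_iff)

context scalar_hom begin

lemma ext_mult:
  "ext W (p * r) = (\<Sum>u\<in>Poly_Mapping.keys p. \<Sum>v\<in>Poly_Mapping.keys r.
     sc (Poly_Mapping.lookup p u * Poly_Mapping.lookup r v) * W (u + v))"
proof -
  have "p * r = (\<Sum>u\<in>Poly_Mapping.keys p. \<Sum>v\<in>Poly_Mapping.keys r.
      Poly_Mapping.single (u + v) (Poly_Mapping.lookup p u * Poly_Mapping.lookup r v))"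
    using arg_cong2[of _ _ _ _ "(*)", OF poly_mapping_eq_sum_single[of p] poly_mapping_eq_sum_single[of r]]
    unfolding sum_product mult_single .
  then show ?thesis by (simp add: ext_sum ext_single)
qed

lemma ext_hom:
  assumes "\<And>u v. W (u + v) = W u * W v"
  shows "ext W (p * r) = ext W p * ext W r"
proof -
  have "sc (a * b) * W (u + v) = (sc a * W u) * (sc b * W v)" for a b u v
  proof -
    have "sc (a * b) * W (u + v) = sc a * (sc b * W u) * W v"
      by (simp add: assms sc_mult mult.assoc)
    then show ?thesis by (simp add: sc_commute[of b "W u"] mult.assoc)
  qed
  then show ?thesis unfolding ext_mult by (simp add: ext_def sum_product)
qed

lemma ext_antihom:
  assumes "\<And>u v. W (u + v) = W v * W u"
  shows "ext W (p * r) = ext W r * ext W p"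
proof -
  have "sc (a * b) * W (u + v) = (sc b * W v) * (sc a * W u)" for a b u v
  proof -
    have "sc (a * b) * W (u + v) = sc b * (sc a * W v) * W u"
      by (simp add: assms mult.commute[of a b] sc_mult mult.assoc)
    then show ?thesis by (simp add: sc_commute[of a "W v"] mult.assoc)
  qed
  then show ?thesis unfolding ext_mult by (subst sum.swap) (simp add: ext_def sum_product)
qed

end

interpretation op_scalar: scalar_hom "scal :: hc_field \<Rightarrow> 'b linop"
  by standard (simp_all add: scal_add scal_mult, rule scal_commute)

definition mon :: "hc_gen list \<Rightarrow> hc_free" where
  "mon l = Poly_Mapping.single (Word l) 1"

lemma mon_append: "mon (l @ l') = mon l * mon l'"
  by (simp add: mon_def mult_single plus_hc_word_def)

lemma mon_Nil [simp]: "mon [] = 1"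
  by (simp add: mon_def zero_hc_word_def[symmetric])

lemma mon_Cons: "mon (g # l) = free_gen g * mon l"
  using mon_append[of "[g]" l] by (simp add: mon_def free_gen_def)

lemma single_eq_mon: "Poly_Mapping.single w a = free_scalar a * mon (letters w)"
  by (simp add: free_scalar_def mon_def mult_single)

lemma free_scalar_add: "free_scalar (a + b) = free_scalar a + free_scalar b"
  by (simp add: free_scalar_def single_add)

lemma free_scalar_mult: "free_scalar (a * b) = free_scalar a * free_scalar b"
  by (simp add: free_scalar_def mult_single)

lemma free_scalar_1 [simp]: "free_scalar 1 = 1"
  by (simp add: free_scalar_def)

lemma free_scalar_0 [simp]: "free_scalar 0 = 0"
  by (simp add: free_scalar_def)

lemma free_scalar_commute: "free_scalar a * x = x * free_scalar a"
proof -
  let ?x = "\<Sum>w\<in>Poly_Mapping.keys x. Poly_Mapping.single w (Poly_Mapping.lookup x w)"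
  have "free_scalar a * ?x = ?x * free_scalar a"
    unfolding free_scalar_def sum_distrib_left sum_distrib_right mult_single by (simp add: mult.commute)
  then show ?thesis unfolding poly_mapping_eq_sum_single[symmetric] .
qed

interpretation free_scalar: scalar_hom free_scalar
  by standard (simp_all add: free_scalar_add free_scalar_mult, rule free_scalar_commute)

lemma free_scalar_diff: "free_scalar (a - b) = free_scalar a - free_scalar b"
  using free_scalar_add[of "a - b" b] by simp

lemma free_scalar_uminus: "free_scalar (- a) = - free_scalar a"
  using free_scalar_diff[of 0 a] by simp

section \<open>The free algebra, the ideal of the relations and the quotient\<close>

abbreviation "free_carrier n \<equiv> carrier (free_alg n)"

lemma free_carrier_iff: "p \<in> free_carrier n \<longleftrightarrow> (\<forall>w\<in>Poly_Mapping.keys p. set (letters w) \<subseteq> gens n)"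
  by (simp add: free_alg_def)

lemma free_carrier_zero [simp, intro]: "0 \<in> free_carrier n" and free_carrier_one [simp, intro]: "1 \<in> free_carrier n"
  by (simp_all add: free_carrier_iff zero_hc_word_def)

lemma free_carrier_add [simp, intro]: "p \<in> free_carrier n \<Longrightarrow> r \<in> free_carrier n \<Longrightarrow> p + r \<in> free_carrier n"
  using Poly_Mapping.keys_add[of p r] by (auto simp: free_carrier_iff)

lemma free_carrier_uminus [simp, intro]: "p \<in> free_carrier n \<Longrightarrow> - p \<in> free_carrier n"
  by (simp add: free_carrier_iff)

lemma free_carrier_diff [simp, intro]: "p \<in> free_carrier n \<Longrightarrow> r \<in> free_carrier n \<Longrightarrow> p - r \<in> free_carrier n"
  using free_carrier_add[of p n "- r"] by simp

lemma free_carrier_mult [simp, intro]: "p \<in> free_carrier n \<Longrightarrow> r \<in> free_carrier n \<Longrightarrow> p * r \<in> free_carrier n"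
  using keys_mult[of p r] by (fastforce simp: free_carrier_iff plus_hc_word_def)

lemma free_carrier_scalar [simp, intro]: "free_scalar a \<in> free_carrier n"
  by (simp add: free_carrier_iff free_scalar_def zero_hc_word_def)

lemma free_carrier_sum [intro]: "(\<And>i. i \<in> S \<Longrightarrow> f i \<in> free_carrier n) \<Longrightarrow> sum f S \<in> free_carrier n"
  by (induction S rule: infinite_finite_induct) simp_all

lemma free_carrier_mon [intro]: "set l \<subseteq> gens n \<Longrightarrow> mon l \<in> free_carrier n"
  by (auto simp: free_carrier_iff mon_def)

lemma free_carrier_gen [intro]: "g \<in> gens n \<Longrightarrow> free_gen g \<in> free_carrier n"
  by (auto simp: free_carrier_iff free_gen_def)

lemma free_carrier_T [simp]: "i \<in> {1..<n} \<Longrightarrow> free_T i \<in> free_carrier n" and free_carrier_C [simp]: "i \<in> {1..n} \<Longrightarrow> free_C i \<in> free_carrier n"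
  by (auto intro!: free_carrier_gen simp: gens_def)

lemma free_alg_ops:
  "x \<oplus>\<^bsub>free_alg n\<^esub> y = x + y" "x \<otimes>\<^bsub>free_alg n\<^esub> y = x * y" "\<zero>\<^bsub>free_alg n\<^esub> = 0" "\<one>\<^bsub>free_alg n\<^esub> = 1"
  by (simp_all add: free_alg_def)

lemma ring_free_alg: "ring (free_alg n)"
proof (rule ringI)
  show "abelian_group (free_alg n)"
  proof (rule abelian_groupI)
    fix x assume "x \<in> free_carrier n"
    then show "\<exists>y\<in>free_carrier n. y \<oplus>\<^bsub>free_alg n\<^esub> x = \<zero>\<^bsub>free_alg n\<^esub>"
      by (intro bexI[of _ "- x"]) (auto simp: free_alg_def)
  qed (simp_all add: free_alg_ops add.assoc add.commute)
  show "monoid (free_alg n)"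
    by (rule monoidI) (simp_all add: free_alg_ops mult.assoc)
qed (simp_all add: free_alg_ops algebra_simps)

lemma free_alg_uminus: "x \<in> free_carrier n \<Longrightarrow> \<ominus>\<^bsub>free_alg n\<^esub> x = - x"
  using ring_free_alg[of n] abelian_group.minus_equality[of "free_alg n" "- x" x]
  by (simp add: free_alg_ops ring.is_abelian_group)

lemma relators_subset: "relators n \<subseteq> free_carrier n"
  unfolding relators_def by (auto intro!: free_carrier_mult free_carrier_add free_carrier_diff)

lemma ideal_hc: "ideal (hc_ideal n) (free_alg n)"
  unfolding hc_ideal_def by (rule ring.genideal_ideal[OF ring_free_alg relators_subset])

text \<open>This is how a map descends to the quotient: the set of elements that it treats correctly
  is closed under the plain ring operations, so only the relators have to be inspected. It serves
  \<open>Phi_ideal\<close> and \<open>theta_ideal\<close>.\<close>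

lemma hc_ideal_minimal:
  assumes "N \<subseteq> free_carrier n" "0 \<in> N" "\<And>x y. x \<in> N \<Longrightarrow> y \<in> N \<Longrightarrow> x + y \<in> N" "\<And>x. x \<in> N \<Longrightarrow> - x \<in> N"
    "\<And>x a. x \<in> N \<Longrightarrow> a \<in> free_carrier n \<Longrightarrow> a * x \<in> N" "\<And>x a. x \<in> N \<Longrightarrow> a \<in> free_carrier n \<Longrightarrow> x * a \<in> N"
    "relators n \<subseteq> N"
  shows "hc_ideal n \<subseteq> N"
  unfolding hc_ideal_def
proof (rule ring.genideal_minimal[OF ring_free_alg _ assms(7)])
  show "ideal N (free_alg n)"
  proof (rule idealI[OF ring_free_alg])
    show "subgroup N (add_monoid (free_alg n))"
    proof (rule group.subgroupI)
      show "group (add_monoid (free_alg n))"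
        using ring.is_abelian_group[OF ring_free_alg] abelian_group.a_group by blast
      show "inv\<^bsub>add_monoid (free_alg n)\<^esub> a \<in> N" if "a \<in> N" for a
        using that assms free_alg_uminus[of a n] by (auto simp: a_inv_def)
    qed (use assms in \<open>auto simp: free_alg_ops\<close>)
  qed (use assms in \<open>auto simp: free_alg_ops\<close>)
qed

lemma hc_ideal_0 [simp]: "0 \<in> hc_ideal n"
  using additive_subgroup.zero_closed[OF ideal.axioms(1)[OF ideal_hc[of n]]] by (simp add: free_alg_ops)

lemma hc_ideal_add: "x \<in> hc_ideal n \<Longrightarrow> y \<in> hc_ideal n \<Longrightarrow> x + y \<in> hc_ideal n"
  using additive_subgroup.a_closed[OF ideal.axioms(1)[OF ideal_hc[of n]]] by (simp add: free_alg_ops)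

lemma hc_ideal_left: "x \<in> hc_ideal n \<Longrightarrow> a \<in> free_carrier n \<Longrightarrow> a * x \<in> hc_ideal n"
  using ideal.I_l_closed[OF ideal_hc[of n]] by (simp add: free_alg_ops)

lemma hc_ideal_right: "x \<in> hc_ideal n \<Longrightarrow> a \<in> free_carrier n \<Longrightarrow> x * a \<in> hc_ideal n"
  using ideal.I_r_closed[OF ideal_hc[of n]] by (simp add: free_alg_ops)

lemma hc_ideal_uminus: "x \<in> hc_ideal n \<Longrightarrow> - x \<in> hc_ideal n"
  using hc_ideal_left[of x n "- 1"] by simp

lemma hc_ideal_diff: "x \<in> hc_ideal n \<Longrightarrow> y \<in> hc_ideal n \<Longrightarrow> x - y \<in> hc_ideal n"
  using hc_ideal_add[of x n "- y"] hc_ideal_uminus[of y n] by simp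

lemma hc_ideal_relators: "x \<in> relators n \<Longrightarrow> x \<in> hc_ideal n"
  unfolding hc_ideal_def using ring.genideal_self[OF ring_free_alg relators_subset] by blast

lemma hc_class_eq_iff:
  assumes "p \<in> free_carrier n" "r \<in> free_carrier n"
  shows "hc_class n p = hc_class n r \<longleftrightarrow> p - r \<in> hc_ideal n"
proof -
  interpret ideal "hc_ideal n" "free_alg n" by (rule ideal_hc)
  have "p \<ominus>\<^bsub>free_alg n\<^esub> r = p - r"
    using assms by (simp add: a_minus_def free_alg_uminus free_alg_ops)
  then show ?thesis
    unfolding hc_class_def using a_rcos_module_minus[OF ring_free_alg assms(2,1)] assms
      a_repr_independence'[of p r] a_rcos_self[of p] by auto
qed

lemma hecke_clifford_ring: "ring (hecke_clifford n)"
  unfolding hecke_clifford_def by (rule ideal.quotient_is_ring[OF ideal_hc])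

lemma hc_class_hom: "hc_class n \<in> ring_hom (free_alg n) (hecke_clifford n)"
  using ideal.rcos_ring_hom[OF ideal_hc[of n]] unfolding hecke_clifford_def hc_class_def .

lemma hc_class_mult:
  "p \<in> free_carrier n \<Longrightarrow> r \<in> free_carrier n \<Longrightarrow> hc_class n p \<otimes>\<^bsub>hecke_clifford n\<^esub> hc_class n r = hc_class n (p * r)"
  using ring_hom_mult[OF hc_class_hom] by (simp add: free_alg_ops)

lemma hc_class_add:
  "p \<in> free_carrier n \<Longrightarrow> r \<in> free_carrier n \<Longrightarrow> hc_class n p \<oplus>\<^bsub>hecke_clifford n\<^esub> hc_class n r = hc_class n (p + r)"
  using ring_hom_add[OF hc_class_hom] by (simp add: free_alg_ops)

lemma hc_class_one: "\<one>\<^bsub>hecke_clifford n\<^esub> = hc_class n 1"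
  using ring_hom_one[OF hc_class_hom] by (simp add: free_alg_ops)

lemma hc_class_closed: "p \<in> free_carrier n \<Longrightarrow> hc_class n p \<in> carrier (hecke_clifford n)"
  using ring_hom_closed[OF hc_class_hom] by simp

lemma hc_class_zero: "\<zero>\<^bsub>hecke_clifford n\<^esub> = hc_class n 0"
  using ring_hom_zero[OF hc_class_hom ring_free_alg hecke_clifford_ring] by (simp add: free_alg_ops)

lemma hc_class_finsum:
  assumes "finite S" "\<And>i. i \<in> S \<Longrightarrow> f i \<in> free_carrier n"
  shows "(\<Oplus>\<^bsub>hecke_clifford n\<^esub>i\<in>S. hc_class n (f i)) = hc_class n (\<Sum>i\<in>S. f i)"
  using assms
proof (induction S rule: finite_induct)
  case empty
  interpret ring "hecke_clifford n" by (rule hecke_clifford_ring)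
  show ?case by (simp add: hc_class_zero)
next
  case (insert x S)
  interpret ring "hecke_clifford n" by (rule hecke_clifford_ring)
  have "sum f S \<in> free_carrier n" using insert by (intro free_carrier_sum) auto
  with insert show ?case
    by (subst finsum_insert) (auto simp: hc_class_closed hc_class_add)
qed

section \<open>The free algebra acting by right multiplication\<close>

definition gen_action :: "nat \<Rightarrow> hc_gen \<Rightarrow> (nat \<Rightarrow> site) linop" where
  "gen_action n g = (case g of T_gen j \<Rightarrow> right_T j | C_gen j \<Rightarrow> right_C n j)"

definition word_action :: "nat \<Rightarrow> hc_word \<Rightarrow> (nat \<Rightarrow> site) linop" where
  "word_action n w = prod_list (map (gen_action n) (letters w))"

text \<open>Right multiplication on coordinates. It preserves the order of products because
  operators multiply in application order.\<close>

definition Phi :: "nat \<Rightarrow> hc_free \<Rightarrow> (nat \<Rightarrow> site) linop" where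
  "Phi n = op_scalar.ext (word_action n)"

lemma Phi_mult: "Phi n (p * r) = Phi n p * Phi n r"
  unfolding Phi_def by (rule op_scalar.ext_hom) (simp add: word_action_def plus_hc_word_def)

lemma Phi_add: "Phi n (p + r) = Phi n p + Phi n r"
  and Phi_diff: "Phi n (p - r) = Phi n p - Phi n r"
  and Phi_uminus: "Phi n (- p) = - Phi n p"
  and Phi_sum: "Phi n (sum f S) = (\<Sum>i\<in>S. Phi n (f i))"
  by (simp_all add: Phi_def op_scalar.ext_add op_scalar.ext_diff op_scalar.ext_uminus op_scalar.ext_sum)

lemma Phi_gen: "Phi n (free_gen g) = gen_action n g"
  by (simp add: Phi_def free_gen_def op_scalar.ext_single word_action_def)

lemma Phi_T: "Phi n (free_T i) = right_T i" and Phi_C: "Phi n (free_C i) = right_C n i"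
  by (simp_all add: Phi_gen gen_action_def)

lemma Phi_scalar: "Phi n (free_scalar a) = scal a"
  by (simp add: Phi_def free_scalar_def op_scalar.ext_single word_action_def zero_hc_word_def)

lemma Phi_one: "Phi n 1 = 1"
  using Phi_scalar[of n 1] by simp

lemma Phi_zero: "Phi n 0 = 0"
  by (simp add: Phi_def)

lemma Phi_relators:
  assumes "x \<in> relators n"
  shows "Phi n x = 0"
proof -
  have 1: "(right_T i - scal q) * (right_T i + 1) = 0" for i
    using right_T_quadratic[of i] unfolding ring_distribs scal_diff by (simp add: left_diff_distrib)
  have 2: "right_T i * right_T j - right_T j * right_T i = 0" if "1 < \<bar>int i - int j\<bar>" for i j
    using right_T_commute[of i j] that by (cases "i < j") simp_all
  have 3: "right_T i * right_T (i + 1) * right_T i - right_T (i + 1) * right_T i * right_T (i + 1) = 0" for i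
    using right_T_braid[of i] by simp
  have 4: "right_C n i * right_C n i - 1 = 0" for i
    using right_C_square[of n i] by simp
  have 5: "right_C n i * right_C n j + right_C n j * right_C n i = 0" if "i \<in> {1..n}" "j \<in> {1..n}" "i \<noteq> j" for i j
    using right_C_anticomm[of i j n] that by simp
  have 6: "right_T i * right_C n j - right_C n j * right_T i = 0" if "i \<in> {1..<n}" "j \<noteq> i" "j \<noteq> i + 1" for i j
    using right_T_rC_far[of j i n] that by simp
  have 7: "right_T i * right_C n i - right_C n (i + 1) * right_T i = 0" if "i \<in> {1..<n}" for i
    using right_T_rC[of i n] that by simp
  show ?thesis
    using assms unfolding relators_def
    by (elim UnE CollectE exE conjE; hypsubst)
      (simp_all only: Phi_mult Phi_add Phi_diff Phi_T Phi_C Phi_scalar Phi_one 1 2 3 4 7,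
        (rule 5 6; assumption)+)
qed

lemma Phi_ideal:
  assumes "x \<in> hc_ideal n"
  shows "Phi n x = 0"
proof -
  have "hc_ideal n \<subseteq> {p \<in> free_carrier n. Phi n p = 0}"
    using relators_subset[of n]
    by (intro hc_ideal_minimal) (auto simp: Phi_zero Phi_add Phi_uminus Phi_mult Phi_relators)
  then show ?thesis using assms by blast
qed

section \<open>Spanning by canonical words\<close>

declare One_nat_def [simp del] upt_Suc [simp del]

definition hc_cong :: "nat \<Rightarrow> hc_free \<Rightarrow> hc_free \<Rightarrow> bool" where
  "hc_cong n p r \<longleftrightarrow> p - r \<in> hc_ideal n"

lemma hc_cong_refl [simp, intro]: "hc_cong n p p"
  by (simp add: hc_cong_def)

lemma hc_cong_sym: "hc_cong n p r \<Longrightarrow> hc_cong n r p"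
  using hc_ideal_uminus[of "p - r" n] by (simp add: hc_cong_def)

lemma hc_cong_trans [trans]: "hc_cong n p r \<Longrightarrow> hc_cong n r s \<Longrightarrow> hc_cong n p s"
  using hc_ideal_add[of "p - r" n "r - s"] by (simp add: hc_cong_def)

lemma hc_cong_add: "hc_cong n p p' \<Longrightarrow> hc_cong n r r' \<Longrightarrow> hc_cong n (p + r) (p' + r')"
  using hc_ideal_add[of "p - p'" n "r - r'"] by (simp add: hc_cong_def algebra_simps)

lemma hc_cong_left: "hc_cong n p p' \<Longrightarrow> a \<in> free_carrier n \<Longrightarrow> hc_cong n (a * p) (a * p')"
  using hc_ideal_left[of "p - p'" n a] by (simp add: hc_cong_def algebra_simps)

lemma hc_cong_right: "hc_cong n p p' \<Longrightarrow> a \<in> free_carrier n \<Longrightarrow> hc_cong n (p * a) (p' * a)"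
  using hc_ideal_right[of "p - p'" n a] by (simp add: hc_cong_def algebra_simps)

lemma hc_cong_uminus: "hc_cong n p p' \<Longrightarrow> hc_cong n (- p) (- p')"
  using hc_cong_left[of n p p' "- 1"] by simp

lemma hc_cong_quad:
  assumes "i \<in> {1..<n}"
  shows "hc_cong n (free_T i * free_T i) (free_scalar (q - 1) * free_T i + free_scalar q)"
proof -
  have "(free_T i - free_scalar q) * (free_T i + 1) \<in> hc_ideal n"
    by (rule hc_ideal_relators) (use assms in \<open>auto simp: relators_def\<close>)
  moreover have "(free_T i - free_scalar q) * (free_T i + 1)
      = free_T i * free_T i - (free_scalar (q - 1) * free_T i + free_scalar q)"
    by (simp add: algebra_simps free_scalar_diff)
  ultimately show ?thesis by (simp add: hc_cong_def)
qed

lemma hc_cong_far: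
  assumes "i \<in> {1..<n}" "j \<in> {1..<n}" "Suc i < j \<or> Suc j < i"
  shows "hc_cong n (free_T i * free_T j) (free_T j * free_T i)"
proof -
  have "\<bar>int i - int j\<bar> > 1" using assms by auto
  then show ?thesis unfolding hc_cong_def using assms
    by (intro hc_ideal_relators) (unfold relators_def, blast)
qed

lemma hc_cong_braid:
  assumes "i \<in> {1..<n}" "Suc i \<in> {1..<n}"
  shows "hc_cong n (free_T i * free_T (Suc i) * free_T i) (free_T (Suc i) * free_T i * free_T (Suc i))"
  unfolding hc_cong_def using assms
  by (intro hc_ideal_relators) (simp only: relators_def Suc_eq_plus1, blast)

lemma hc_cong_CC:
  assumes "i \<in> {1..n}"
  shows "hc_cong n (free_C i * free_C i) 1"
  unfolding hc_cong_def using assms by (intro hc_ideal_relators) (unfold relators_def, blast)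

lemma hc_cong_anti:
  assumes "i \<in> {1..n}" "j \<in> {1..n}" "i \<noteq> j"
  shows "hc_cong n (free_C i * free_C j) (- (free_C j * free_C i))"
proof -
  have "free_C i * free_C j + free_C j * free_C i \<in> hc_ideal n"
    using assms by (intro hc_ideal_relators) (unfold relators_def, blast)
  then show ?thesis by (simp add: hc_cong_def)
qed

lemma hc_cong_TC_far:
  assumes "i \<in> {1..<n}" "j \<in> {1..n}" "j \<noteq> i" "j \<noteq> Suc i"
  shows "hc_cong n (free_T i * free_C j) (free_C j * free_T i)"
  unfolding hc_cong_def using assms
  by (intro hc_ideal_relators) (simp only: relators_def Suc_eq_plus1, blast)

lemma hc_cong_TC:
  assumes "i \<in> {1..<n}"
  shows "hc_cong n (free_T i * free_C i) (free_C (Suc i) * free_T i)"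
  unfolding hc_cong_def using assms
  by (intro hc_ideal_relators) (simp only: relators_def Suc_eq_plus1, blast)

lemma q_half_ne_0: "q_half \<noteq> 0"
  by (simp add: q_half_def Zero_fract_def eq_fract)

lemma q_ne_0 [simp]: "q \<noteq> 0"
  by (simp add: q_def q_half_ne_0)

text \<open>Multiplying \<open>T c - c' T\<close> by \<open>T\<close> on both sides and applying the quadratic relation
  yields \<open>q\<close> times the claim.\<close>

lemma hc_cong_CT:
  assumes i: "i \<in> {1..<n}"
  shows "hc_cong n (free_C i * free_T i)
    (free_T i * free_C (Suc i) + free_scalar (q - 1) * free_C i - free_scalar (q - 1) * free_C (Suc i))"
proof -
  define T c c' Q R where d: "T = free_T i" "c = free_C i" "c' = free_C (Suc i)" "Q = free_scalar q" "R = free_scalar (q - 1)"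
  define A B where AB: "A = T * c - c' * T" "B = T * T - (R * T + Q)"
  have free_carrier: "T \<in> free_carrier n" "c \<in> free_carrier n" "c' \<in> free_carrier n" "Q \<in> free_carrier n" "R \<in> free_carrier n" using i by (simp_all add: d)
  have A: "A \<in> hc_ideal n" using hc_cong_TC[OF i] by (simp add: hc_cong_def AB d)
  have B: "B \<in> hc_ideal n" using hc_cong_quad[OF i] by (simp add: hc_cong_def AB d)
  have cQ: "x * Q = Q * x" and cR: "x * R = R * x" for x
    unfolding d by (rule free_scalar_commute[symmetric])+
  have cQ': "x * (Q * y) = Q * (x * y)" and cR': "x * (R * y) = R * (x * y)" for x y
    by (simp_all only: cQ[of x] cR[of x] flip: mult.assoc)
  note comm = cQ[of T] cQ[of c] cQ[of c'] cQ[of R] cR[of T] cR[of c] cR[of c']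
    cQ'[of T] cQ'[of c] cQ'[of c'] cQ'[of R] cR'[of T] cR'[of c] cR'[of c']
  \<comment> \<open>An identity in the free algebra that uses only that \<open>Q\<close> and
    \<open>R\<close> are central. Every term on the right contains one of the relators
    \<open>A\<close>, \<open>B\<close>.\<close>
  have "Q * (c * T - T * c' - R * (c - c')) =
      T * A * T - B * c * T + T * c' * B - R * (A * T + c' * B - B * c - R * A + T * A)"
    unfolding AB by (simp add: algebra_simps comm)
  also have "\<dots> \<in> hc_ideal n"
    by (intro hc_ideal_diff hc_ideal_add hc_ideal_left hc_ideal_right A B free_carrier free_carrier_mult free_carrier_add free_carrier_diff)
  finally have "free_scalar (1 / q) * (Q * (c * T - T * c' - R * (c - c'))) \<in> hc_ideal n"
    by (rule hc_ideal_left) simp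
  moreover have "free_scalar (1 / q) * Q = 1"
    by (simp add: d flip: free_scalar_mult)
  ultimately have "c * T - T * c' - R * (c - c') \<in> hc_ideal n"
    by (simp flip: mult.assoc)
  then show ?thesis by (simp add: hc_cong_def d algebra_simps)
qed

definition in_span :: "nat \<Rightarrow> 'i set \<Rightarrow> ('i \<Rightarrow> hc_free) \<Rightarrow> hc_free \<Rightarrow> bool" where
  "in_span n X \<beta> p \<longleftrightarrow> (\<exists>a. hc_cong n p (\<Sum>x\<in>X. free_scalar (a x) * \<beta> x))"

lemma in_span_base:
  assumes "finite X" "x \<in> X"
  shows "in_span n X \<beta> (\<beta> x)"
  unfolding in_span_def
proof (rule exI[of _ "\<lambda>y. if y = x then 1 else 0"])
  have "(\<Sum>y\<in>X. free_scalar (if y = x then 1 else 0) * \<beta> y) = (\<Sum>y\<in>X. if y = x then \<beta> y else 0)"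
    by (rule sum.cong) auto
  then show "hc_cong n (\<beta> x) (\<Sum>y\<in>X. free_scalar (if y = x then 1 else 0) * \<beta> y)"
    using assms by simp
qed

lemma in_span_zero: "in_span n X \<beta> 0"
  unfolding in_span_def by (rule exI[of _ "\<lambda>_. 0"]) simp

lemma in_span_add: "in_span n X \<beta> p \<Longrightarrow> in_span n X \<beta> r \<Longrightarrow> in_span n X \<beta> (p + r)"
  unfolding in_span_def
proof (elim exE)
  fix a b assume "hc_cong n p (\<Sum>x\<in>X. free_scalar (a x) * \<beta> x)" "hc_cong n r (\<Sum>x\<in>X. free_scalar (b x) * \<beta> x)"
  then show "\<exists>a. hc_cong n (p + r) (\<Sum>x\<in>X. free_scalar (a x) * \<beta> x)"
    by (intro exI[of _ "\<lambda>x. a x + b x"])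
      (simp add: free_scalar_add distrib_right sum.distrib hc_cong_add)
qed

lemma in_span_scalar: "in_span n X \<beta> p \<Longrightarrow> in_span n X \<beta> (free_scalar c * p)"
  unfolding in_span_def
proof (elim exE)
  fix a assume "hc_cong n p (\<Sum>x\<in>X. free_scalar (a x) * \<beta> x)"
  then show "\<exists>a. hc_cong n (free_scalar c * p) (\<Sum>x\<in>X. free_scalar (a x) * \<beta> x)"
    using hc_cong_left[of n p "\<Sum>x\<in>X. free_scalar (a x) * \<beta> x" "free_scalar c"]
    by (intro exI[of _ "\<lambda>x. c * a x"]) (simp add: free_scalar_mult sum_distrib_left mult.assoc)
qed

lemma in_span_diff: "in_span n X \<beta> p \<Longrightarrow> in_span n X \<beta> r \<Longrightarrow> in_span n X \<beta> (p - r)"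
  using in_span_add[of n X \<beta> p "free_scalar (- 1) * r"] in_span_scalar[of n X \<beta> r "- 1"]
  by (simp add: free_scalar_uminus)

lemma in_span_sum: "(\<And>i. i \<in> S \<Longrightarrow> in_span n X \<beta> (f i)) \<Longrightarrow> in_span n X \<beta> (sum f S)"
  by (induction S rule: infinite_finite_induct) (simp_all add: in_span_zero in_span_add)

lemma in_span_cong: "hc_cong n p r \<Longrightarrow> in_span n X \<beta> r \<Longrightarrow> in_span n X \<beta> p"
  unfolding in_span_def using hc_cong_trans by blast

lemma in_span_mult:
  assumes "in_span n X \<beta> p" "g \<in> free_carrier n" "g' \<in> free_carrier n" "\<And>x. x \<in> X \<Longrightarrow> in_span n Y \<beta>' (g * \<beta> x * g')"
  shows "in_span n Y \<beta>' (g * p * g')"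
proof -
  obtain a where "hc_cong n p (\<Sum>x\<in>X. free_scalar (a x) * \<beta> x)" using assms(1) by (auto simp: in_span_def)
  then have "hc_cong n (g * p * g') (g * (\<Sum>x\<in>X. free_scalar (a x) * \<beta> x) * g')"
    by (intro hc_cong_left hc_cong_right assms)
  moreover have "g * (\<Sum>x\<in>X. free_scalar (a x) * \<beta> x) * g' = (\<Sum>x\<in>X. free_scalar (a x) * (g * \<beta> x * g'))"
  proof -
    have "g * (free_scalar (a x) * \<beta> x) * g' = free_scalar (a x) * (g * \<beta> x * g')" for x
      by (simp only: mult.assoc[symmetric] free_scalar_commute[of "a x" g])
    then show ?thesis by (simp add: sum_distrib_left sum_distrib_right)
  qed
  ultimately have "hc_cong n (g * p * g') (\<Sum>x\<in>X. free_scalar (a x) * (g * \<beta> x * g'))" by simp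
  then show ?thesis by (rule in_span_cong) (intro in_span_sum in_span_scalar assms(4))
qed

definition T_word :: "nat list \<Rightarrow> hc_free" where "T_word w = mon (map T_gen w)"
definition C_word :: "nat list \<Rightarrow> hc_free" where "C_word w = mon (map C_gen w)"

lemma T_word_simps [simp]: "T_word [] = 1" "T_word (i # w) = free_T i * T_word w" "T_word (u @ w) = T_word u * T_word w"
  by (simp_all add: T_word_def mon_append mon_Cons)

lemma C_word_simps [simp]: "C_word [] = 1" "C_word (i # w) = free_C i * C_word w" "C_word (u @ w) = C_word u * C_word w"
  by (simp_all add: C_word_def mon_append mon_Cons)

lemma T_word_FA: "set w \<subseteq> {1..<n} \<Longrightarrow> T_word w \<in> free_carrier n"
  unfolding T_word_def by (rule free_carrier_mon) (auto simp: gens_def)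

lemma C_word_FA: "set w \<subseteq> {1..n} \<Longrightarrow> C_word w \<in> free_carrier n"
  unfolding C_word_def by (rule free_carrier_mon) (auto simp: gens_def)

text \<open>Normal forms along the chain of symmetric groups: the run \<open>s_k ... s_m\<close>
  carries \<open>m + 1\<close> to \<open>k\<close>, and the rest fixes \<open>m + 1\<close>. The
  choice \<open>k = m + 1\<close> gives the empty run.\<close>

fun canon_words :: "nat \<Rightarrow> nat list set" where
  "canon_words 0 = {[]}"
| "canon_words (Suc m) = (\<lambda>(k, u). [k..<Suc m] @ u) ` ({1..Suc m} \<times> canon_words m)"

lemma canon_words_I: "k \<in> {1..Suc m} \<Longrightarrow> u \<in> canon_words m \<Longrightarrow> [k..<Suc m] @ u \<in> canon_words (Suc m)"
  unfolding canon_words.simps by (rule image_eqI[of _ _ "(k, u)"]) simp_all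

lemma finite_canon_words [simp]: "finite (canon_words m)"
  by (induction m) auto

lemma Nil_canon_words [simp]: "[] \<in> canon_words m"
proof (induction m)
  case (Suc m)
  then show ?case using canon_words_I[of "Suc m" m "[]"] by simp
qed simp

lemma canon_words_letters: "w \<in> canon_words m \<Longrightarrow> set w \<subseteq> {1..<m}"
  by (induction m arbitrary: w) fastforce+

lemma T_word_far:
  assumes "i \<in> {1..<n}" "set w \<subseteq> {1..<n}" "\<forall>j\<in>set w. Suc i < j \<or> Suc j < i"
  shows "hc_cong n (free_T i * T_word w) (T_word w * free_T i)"
  using assms
proof (induction w)
  case (Cons j w)
  have "hc_cong n (free_T i * free_T j * T_word w) (free_T j * free_T i * T_word w)"
    using Cons.prems by (intro hc_cong_right hc_cong_far T_word_FA) auto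
  also have "free_T j * free_T i * T_word w = free_T j * (free_T i * T_word w)" by (simp add: mult.assoc)
  also have "hc_cong n \<dots> (free_T j * (T_word w * free_T i))"
    using Cons by (intro hc_cong_left) auto
  finally show ?case by (simp add: mult.assoc)
qed simp

text \<open>\<open>T_i\<close> commutes with the run until it meets the letters
  \<open>i - 1\<close>, \<open>i\<close>; the braid relation there produces a \<open>T_{i-1}\<close>
  on the right, which commutes with the remaining letters.\<close>

lemma T_word_shift:
  assumes "k < i" "i \<le> m" "1 \<le> k" "m < n"
  shows "hc_cong n (free_T i * T_word [k..<Suc m]) (T_word [k..<Suc m] * free_T (i - 1))"
proof -
  obtain j where j: "i = Suc j" using assms by (cases i) auto
  have split: "[k..<Suc m] = [k..<j] @ j # Suc j # [Suc (Suc j)..<Suc m]"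
  proof -
    have "[k..<Suc m] = [k..<j] @ [j..<Suc m]" using assms j
      using upt_add_eq_append[of k j "Suc m - j"] by simp
    moreover have "[j..<Suc m] = j # Suc j # [Suc (Suc j)..<Suc m]"
      using assms j by (simp add: upt_rec)
    ultimately show ?thesis by simp
  qed
  let ?A = "T_word [k..<j]" and ?B = "T_word [Suc (Suc j)..<Suc m]" and ?t = "free_T j" and ?s = "free_T (Suc j)"
  have free_carrier: "?A \<in> free_carrier n" "?B \<in> free_carrier n" "?t \<in> free_carrier n" "?s \<in> free_carrier n" using assms j by (auto intro!: T_word_FA)
  have "free_T i * T_word [k..<Suc m] = (?s * ?A) * (?t * ?s * ?B)"
    unfolding split by (simp add: j mult.assoc)
  also have "hc_cong n \<dots> ((?A * ?s) * (?t * ?s * ?B))"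
    using assms j free_carrier by (intro hc_cong_right T_word_far free_carrier_mult) auto
  also have "(?A * ?s) * (?t * ?s * ?B) = ?A * ((?s * ?t * ?s) * ?B)" by (simp add: mult.assoc)
  also have "hc_cong n \<dots> (?A * ((?t * ?s * ?t) * ?B))"
    using assms j free_carrier by (intro hc_cong_left hc_cong_right hc_cong_sym[OF hc_cong_braid]) auto
  also have "?A * ((?t * ?s * ?t) * ?B) = (?A * ?t * ?s) * (?t * ?B)" by (simp add: mult.assoc)
  also have "hc_cong n \<dots> ((?A * ?t * ?s) * (?B * ?t))"
    using assms j free_carrier by (intro hc_cong_left T_word_far free_carrier_mult) auto
  also have "(?A * ?t * ?s) * (?B * ?t) = T_word [k..<Suc m] * free_T (i - 1)"
    unfolding split by (simp add: j mult.assoc)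
  finally show ?thesis .
qed

text \<open>\<open>T_i\<close> meets the leading run \<open>k, ..., m\<close>. It passes unchanged
  if \<open>i + 1 < k\<close>, lengthens the run if \<open>i + 1 = k\<close>, is squared if
  \<open>i = k\<close>, and passes as \<open>T_{i-1}\<close> if \<open>k < i\<close>. After passing,
  its index lies below \<open>m\<close>, so the induction hypothesis applies to the rest.\<close>

lemma in_span_T_CW:
  assumes "m \<le> n" "i \<in> {1..<m}" "w \<in> canon_words m"
  shows "in_span n (canon_words m) T_word (free_T i * T_word w)"
  using assms
proof (induction m arbitrary: i w)
  case (Suc m)
  obtain k u where w: "w = [k..<Suc m] @ u" "k \<in> {1..Suc m}" "u \<in> canon_words m" using Suc.prems by auto
  let ?D = "T_word [k..<Suc m]"
  have u: "T_word u \<in> free_carrier n" using canon_words_letters[OF w(3)] Suc.prems by (intro T_word_FA) auto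
  have D: "?D \<in> free_carrier n" using w Suc.prems by (intro T_word_FA) auto
  have Di: "i < n" "1 \<le> i" "i \<le> m" using Suc.prems by auto
  have lift: "in_span n (canon_words (Suc m)) T_word (?D * p)" if "in_span n (canon_words m) T_word p" for p
  proof -
    have "in_span n (canon_words (Suc m)) T_word (?D * p * 1)"
    proof (rule in_span_mult[OF that D])
      fix x assume "x \<in> canon_words m"
      then have "in_span n (canon_words (Suc m)) T_word (T_word ([k..<Suc m] @ x))"
        using w by (intro in_span_base canon_words_I) auto
      then show "in_span n (canon_words (Suc m)) T_word (?D * T_word x * 1)" by simp
    qed simp
    then show ?thesis by simp
  qed
  consider "Suc i < k" | "Suc i = k" | "i = k" | "k < i" by linarith
  then show ?case
  proof cases
    case 1
    have "hc_cong n (free_T i * T_word w) (?D * (free_T i * T_word u))"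
      using 1 w Suc.prems Di hc_cong_right[OF T_word_far[of i n "[k..<Suc m]"] u] by (simp add: mult.assoc) 
    then show ?thesis using 1 w Suc Di by (elim in_span_cong) (intro lift Suc.IH, auto)
  next
    case 2
    have "[i..<Suc m] = i # [k..<Suc m]" using 2 Di by (simp add: upt_rec)
    then have "free_T i * T_word w = T_word ([i..<Suc m] @ u)" using w by (simp add: mult.assoc)
    then show ?thesis using w Di by (metis in_span_base finite_canon_words canon_words_I atLeastAtMost_iff le_SucI)
  next
    case 3
    have e: "[k..<Suc m] = i # [Suc k..<Suc m]" using 3 Di by (simp add: upt_rec)
    let ?E = "T_word [Suc k..<Suc m]"
    have E: "?E * T_word u \<in> free_carrier n" using w Suc.prems by (intro free_carrier_mult u T_word_FA) auto
    have "hc_cong n (free_T i * T_word w) ((free_scalar (q - 1) * free_T i + free_scalar q) * (?E * T_word u))"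
      unfolding w(1) e using hc_cong_right[OF hc_cong_quad[of i n] E] Di by (simp add: mult.assoc)
    moreover have "(free_scalar (q - 1) * free_T i + free_scalar q) * (?E * T_word u)
       = free_scalar (q - 1) * T_word w + free_scalar q * T_word ([Suc k..<Suc m] @ u)"
      unfolding w(1) e by (simp add: algebra_simps)
    moreover have "in_span n (canon_words (Suc m)) T_word \<dots>"
      using w Di 3 Suc.prems by (intro in_span_add in_span_scalar in_span_base canon_words_I) auto
    ultimately show ?thesis using in_span_cong by metis
  next
    case 4
    have "hc_cong n (free_T i * T_word w) (?D * (free_T (i - 1) * T_word u))"
      using 4 w Suc.prems Di hc_cong_right[OF T_word_shift[of k i m n] u] by (simp add: mult.assoc)
    then show ?thesis using 4 w Suc Di by (elim in_span_cong) (intro lift Suc.IH, auto)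
  qed
qed simp

text \<open>Insertion into an increasing product: \<open>c_i\<close> moves right with a change of
  sign at every step until it reaches its place or cancels against another
  \<open>c_i\<close>.\<close>

lemma C_C_word:
  assumes "i \<in> {1..n}" "sorted_wrt (<) xs" "set xs \<subseteq> {1..n}"
  shows "\<exists>s ys. sorted_wrt (<) ys \<and> set ys \<subseteq> insert i (set xs) \<and> hc_cong n (free_C i * C_word xs) (free_scalar s * C_word ys)"
  using assms
proof (induction xs)
  case Nil
  show ?case by (rule exI[of _ 1], rule exI[of _ "[i]"]) simp
next
  case (Cons x xs)
  have free_carrier: "C_word xs \<in> free_carrier n" using Cons.prems by (intro C_word_FA) auto
  consider "i < x" | "i = x" | "x < i" by linarith
  then show ?case
  proof cases
    case 1
    then have "sorted_wrt (<) (i # x # xs)" using Cons.prems by auto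
    then show ?thesis by (intro exI[of _ 1] exI[of _ "i # x # xs"]) auto
  next
    case 2
    have "hc_cong n (free_C i * free_C i * C_word xs) (1 * C_word xs)"
      using Cons.prems free_carrier by (intro hc_cong_right hc_cong_CC)
    then show ?thesis using 2 Cons.prems
      by (intro exI[of _ 1] exI[of _ xs]) (auto simp: mult.assoc)
  next
    case 3
    obtain s ys where ys: "sorted_wrt (<) ys" "set ys \<subseteq> insert i (set xs)"
      "hc_cong n (free_C i * C_word xs) (free_scalar s * C_word ys)" using Cons by auto
    have x: "x \<in> {1..n}" using Cons.prems by simp
    have "hc_cong n (free_C i * free_C x * C_word xs) (- (free_C x * free_C i) * C_word xs)"
      using Cons.prems 3 free_carrier by (intro hc_cong_right hc_cong_anti) auto
    also have "- (free_C x * free_C i) * C_word xs = - (free_C x * (free_C i * C_word xs))" by (simp add: mult.assoc)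
    also have "hc_cong n \<dots> (- (free_C x * (free_scalar s * C_word ys)))"
      using x ys by (intro hc_cong_uminus hc_cong_left) auto
    also have "- (free_C x * (free_scalar s * C_word ys)) = free_scalar (- s) * C_word (x # ys)"
      by (simp add: free_scalar_uminus free_scalar_commute[of s "free_C x"] flip: mult.assoc)
    finally have "hc_cong n (free_C i * C_word (x # xs)) (free_scalar (- s) * C_word (x # ys))" by (simp add: mult.assoc)
    moreover have "sorted_wrt (<) (x # ys)" using ys Cons.prems 3 by auto
    ultimately show ?thesis using ys by (intro exI[of _ "- s"] exI[of _ "x # ys"]) auto
  qed
qed

definition canon_elem :: "nat list \<times> nat set \<Rightarrow> hc_free" where
  "canon_elem = (\<lambda>(w, I). T_word w * C_word (sorted_list_of_set I))"

abbreviation "canon_index n \<equiv> canon_words n \<times> Pow {1..n}"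

lemma finite_canon_index [simp]: "finite (canon_index n)"
  by simp

lemma sorted_list_of_set_free_carrier: "I \<subseteq> {1..n} \<Longrightarrow> C_word (sorted_list_of_set I) \<in> free_carrier n"
  by (intro C_word_FA) (use finite_subset in \<open>fastforce\<close>)

lemma in_span_T:
  assumes "i \<in> {1..<n}" "in_span n (canon_index n) canon_elem p"
  shows "in_span n (canon_index n) canon_elem (free_T i * p)"
proof -
  have "in_span n (canon_index n) canon_elem (free_T i * p * 1)"
  proof (rule in_span_mult[OF assms(2)])
    fix b assume b: "b \<in> canon_index n"
    then obtain w I where wI: "b = (w, I)" "w \<in> canon_words n" "I \<subseteq> {1..n}" by auto
    have "in_span n (canon_index n) canon_elem (1 * (free_T i * T_word w) * C_word (sorted_list_of_set I))"
    proof (rule in_span_mult[OF in_span_T_CW[OF order_refl assms(1) wI(2)]])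
      fix x assume "x \<in> canon_words n"
      then have "in_span n (canon_index n) canon_elem (canon_elem (x, I))" using wI by (intro in_span_base) auto
      then show "in_span n (canon_index n) canon_elem (1 * T_word x * C_word (sorted_list_of_set I))" by (simp add: canon_elem_def)
    qed (use wI sorted_list_of_set_free_carrier in auto)
    then show "in_span n (canon_index n) canon_elem (free_T i * canon_elem b * 1)" by (simp add: wI canon_elem_def mult.assoc)
  qed (use assms in auto)
  then show ?thesis by simp
qed

lemma in_span_Cw:
  assumes "sorted_wrt (<) ys" "set ys \<subseteq> {1..n}"
  shows "in_span n (canon_index n) canon_elem (C_word ys)"
proof -
  have "sorted_list_of_set (set ys) = ys"
    using assms by (simp add: sorted_list_of_set.idem_if_sorted_distinct strict_sorted_iff)
  then have "canon_elem ([], set ys) = C_word ys" by (simp add: canon_elem_def)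
  then show ?thesis using in_span_base[of "canon_index n" "([], set ys)" n canon_elem] assms by simp
qed

text \<open>\<open>c_i\<close> is pushed to the right through the letters \<open>T_j\<close>. In the
  worst case, \<open>hc_cong_CT\<close>, it splits into terms that keep \<open>T_j\<close> in front
  or lose it; in each of them a Clifford generator meets a shorter word.\<close>

lemma in_span_C_word:
  assumes "set w \<subseteq> {1..<n}" "i \<in> {1..n}" "I \<subseteq> {1..n}"
  shows "in_span n (canon_index n) canon_elem (free_C i * T_word w * C_word (sorted_list_of_set I))"
  using assms(1,2)
proof (induction w arbitrary: i)
  case Nil
  obtain s ys where "sorted_wrt (<) ys" "set ys \<subseteq> insert i (set (sorted_list_of_set I))"
    "hc_cong n (free_C i * C_word (sorted_list_of_set I)) (free_scalar s * C_word ys)"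
    using C_C_word[OF Nil(2), of "sorted_list_of_set I"] assms(3) finite_subset[OF assms(3)] by auto
  then show ?case using Nil assms(3) finite_subset[OF assms(3)]
    by (auto elim!: in_span_cong intro!: in_span_scalar in_span_Cw)
next
  case (Cons j w)
  let ?r = "T_word w * C_word (sorted_list_of_set I)"
  have j: "j \<in> {1..<n}" using Cons.prems by simp
  have r: "?r \<in> free_carrier n" using Cons.prems assms sorted_list_of_set_free_carrier by (intro free_carrier_mult T_word_FA) auto
  have IH: "in_span n (canon_index n) canon_elem (free_C i * ?r)" if "i \<in> {1..n}" for i
    using Cons.IH[OF _ that] Cons.prems by (simp add: mult.assoc)
  consider "i \<noteq> j" "i \<noteq> Suc j" | "i = Suc j" | "i = j" by blast
  then have "\<exists>p. hc_cong n (free_C i * free_T j) p \<and> in_span n (canon_index n) canon_elem (p * ?r)"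
  proof cases
    case 1
    then show ?thesis using hc_cong_sym[OF hc_cong_TC_far[OF j Cons.prems(2)]] in_span_T[OF j IH[OF Cons.prems(2)]]
      by (auto simp: mult.assoc)
  next
    case 2
    then show ?thesis using hc_cong_sym[OF hc_cong_TC[OF j]] in_span_T[OF j IH[of j]] j
      by (auto simp: mult.assoc)
  next
    case 3
    have "in_span n (canon_index n) canon_elem (free_T j * (free_C (Suc j) * ?r) + free_scalar (q - 1) * (free_C j * ?r) - free_scalar (q - 1) * (free_C (Suc j) * ?r))"
      using j by (intro in_span_diff in_span_add in_span_T in_span_scalar IH) auto
    moreover have "free_T j * (free_C (Suc j) * ?r) + free_scalar (q - 1) * (free_C j * ?r) - free_scalar (q - 1) * (free_C (Suc j) * ?r)
      = (free_T j * free_C (Suc j) + free_scalar (q - 1) * free_C j - free_scalar (q - 1) * free_C (Suc j)) * ?r"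
      by (simp only: left_diff_distrib distrib_right mult.assoc)
    ultimately show ?thesis using hc_cong_CT[OF j] 3 by metis
  qed
  then obtain p where p: "hc_cong n (free_C i * free_T j) p" "in_span n (canon_index n) canon_elem (p * ?r)" by blast
  have "free_C i * T_word (j # w) * C_word (sorted_list_of_set I) = free_C i * free_T j * ?r" by (simp add: mult.assoc)
  then show ?case using in_span_cong[OF hc_cong_right[OF p(1) r] p(2)] by simp
qed

lemma in_span_C:
  assumes "i \<in> {1..n}" "in_span n (canon_index n) canon_elem p"
  shows "in_span n (canon_index n) canon_elem (free_C i * p)"
proof -
  have "in_span n (canon_index n) canon_elem (free_C i * p * 1)"
  proof (rule in_span_mult[OF assms(2)])
    fix b assume "b \<in> canon_index n"
    then show "in_span n (canon_index n) canon_elem (free_C i * canon_elem b * 1)"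
      using in_span_C_word[of _ n i] assms(1) canon_words_letters by (auto simp: canon_elem_def mult.assoc)
  qed (use assms in auto)
  then show ?thesis by simp
qed

lemma in_span_mon: "set l \<subseteq> gens n \<Longrightarrow> in_span n (canon_index n) canon_elem (mon l)"
proof (induction l)
  case Nil
  show ?case using in_span_Cw[of "[]" n] by simp
next
  case (Cons g l)
  then show ?case by (auto simp: mon_Cons gens_def intro!: in_span_T in_span_C)
qed

lemma in_span_FA:
  assumes "p \<in> free_carrier n"
  shows "in_span n (canon_index n) canon_elem p"
proof -
  have "in_span n (canon_index n) canon_elem (\<Sum>w\<in>Poly_Mapping.keys p. free_scalar (Poly_Mapping.lookup p w) * mon (letters w))"
    using assms by (intro in_span_sum in_span_scalar in_span_mon) (auto simp: free_carrier_iff)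
  then show ?thesis by (simp flip: single_eq_mon poly_mapping_eq_sum_single)
qed

section \<open>Coordinates and the trace formula\<close>

definition delta :: "'b \<Rightarrow> 'b \<Rightarrow> hc_field" where
  "delta b x = (if x = b then 1 else 0)"

definition state_of :: "(nat \<Rightarrow> nat) \<times> nat set \<Rightarrow> nat \<Rightarrow> site" where
  "state_of = (\<lambda>(\<sigma>, I) k. (\<sigma> k, k \<in> I))"

lemma state_of_inj [simp]: "state_of b = state_of c \<longleftrightarrow> b = c"
  by (cases b; cases c) (auto simp: state_of_def fun_eq_iff)

lemma right_T_dl:
  assumes "\<sigma> j < \<sigma> (Suc j)"
  shows "app (right_T j) (delta (state_of (\<sigma>, {}))) = delta (state_of (\<sigma> \<circ> transpose j (Suc j), {}))"
proof
  fix u :: "nat \<Rightarrow> site"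
  define N where "N \<longleftrightarrow> (\<forall>k. k \<noteq> j \<longrightarrow> k \<noteq> Suc j \<longrightarrow> u k = (\<sigma> k, False))"
  have e: "set_sites j u s a b = state_of (\<sigma>, {}) \<longleftrightarrow> N \<and> \<not> a \<and> \<not> b \<and>
      fst (u (if s then Suc j else j)) = \<sigma> j \<and> fst (u (if s then j else Suc j)) = \<sigma> (Suc j)" for s a b
  proof -
    have split: "(\<forall>k. P k) \<longleftrightarrow> (\<forall>k. k \<noteq> j \<longrightarrow> k \<noteq> Suc j \<longrightarrow> P k) \<and> P j \<and> P (Suc j)" for P by metis
    show ?thesis unfolding fun_eq_iff N_def by (subst split) (auto simp: set_sites_def state_of_def)
  qed
  have t: "u = state_of (\<sigma> \<circ> transpose j (Suc j), {}) \<longleftrightarrow> N \<and> u j = (\<sigma> (Suc j), False) \<and> u (Suc j) = (\<sigma> j, False)"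
  proof -
    have split: "(\<forall>k. P k) \<longleftrightarrow> (\<forall>k. k \<noteq> j \<longrightarrow> k \<noteq> Suc j \<longrightarrow> P k) \<and> P j \<and> P (Suc j)" for P by metis
    show ?thesis unfolding fun_eq_iff N_def by (subst split) (auto simp: state_of_def transpose_def)
  qed
  show "app (right_T j) (delta (state_of (\<sigma>, {}))) u = delta (state_of (\<sigma> \<circ> transpose j (Suc j), {})) u"
    using assms unfolding delta_def t right_T.rep_eq e
    by (cases "u j"; cases "u (Suc j)") (auto simp: local_T_def)
qed

lemma right_C_dl:
  assumes "\<And>i. i \<in> I \<Longrightarrow> i < j"
  shows "app (right_C n j) (delta (state_of (\<sigma>, I))) = delta (state_of (\<sigma>, insert j I))"
proof
  fix u :: "nat \<Rightarrow> site"
  have j: "j \<notin> I" using assms by blast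
  have e: "flip j u = state_of (\<sigma>, I) \<longleftrightarrow> u = state_of (\<sigma>, insert j I)"
  proof
    assume a: "flip j u = state_of (\<sigma>, I)"
    show "u = state_of (\<sigma>, insert j I)"
    proof
      fix k show "u k = state_of (\<sigma>, insert j I) k"
        using fun_cong[OF a, of k] j by (cases "u k") (auto simp: flip_def state_of_def split: if_splits)
    qed
  qed (use j in \<open>auto simp: flip_def state_of_def fun_eq_iff\<close>)
  have "tail_sign n j u = 1" if "u = state_of (\<sigma>, insert j I)"
    unfolding tail_sign_def by (rule prod.neutral) (use assms that in \<open>force simp: state_of_def\<close>)
  then show "app (right_C n j) (delta (state_of (\<sigma>, I))) u = delta (state_of (\<sigma>, insert j I)) u"
    by (simp add: right_C.rep_eq delta_def e)
qed

text \<open>Each letter multiplies on the right at an ascent and so raises the length by one. For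
  \<open>\<sigma> = id\<close> this is the local form of being reduced.\<close>

fun ascending :: "(nat \<Rightarrow> nat) \<Rightarrow> nat list \<Rightarrow> bool" where
  "ascending \<sigma> [] \<longleftrightarrow> True"
| "ascending \<sigma> (j # w) \<longleftrightarrow> \<sigma> j < \<sigma> (Suc j) \<and> ascending (\<sigma> \<circ> transpose j (Suc j)) w"

lemma word_perm_simps [simp]: "word_perm [] = id" "word_perm (j # w) = transpose j (Suc j) \<circ> word_perm w"
  by (simp_all add: word_perm_def Suc_eq_plus1)

lemma word_perm_append [simp]: "word_perm (u @ w) = word_perm u \<circ> word_perm w"
  by (induction u) (simp_all add: o_assoc)

lemma ascending_append: "ascending \<sigma> (u @ w) \<longleftrightarrow> ascending \<sigma> u \<and> ascending (\<sigma> \<circ> word_perm u) w"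
  by (induction u arbitrary: \<sigma>) (simp_all add: o_assoc)

text \<open>The comparison at a letter refers only to the prefix before it. In this form the
  property can be derived both from minimal length and from sortedness.\<close>

lemma ascending_iff:
  "ascending \<sigma> w \<longleftrightarrow> (\<forall>u j r. w = u @ j # r \<longrightarrow> \<sigma> (word_perm u j) < \<sigma> (word_perm u (Suc j)))"
proof (induction w rule: rev_induct)
  case (snoc j w)
  show ?case
  proof
    assume l: "ascending \<sigma> (w @ [j])"
    show "\<forall>u i r. w @ [j] = u @ i # r \<longrightarrow> \<sigma> (word_perm u i) < \<sigma> (word_perm u (Suc i))"
    proof (intro allI impI)
      fix u i r assume "w @ [j] = u @ i # r"
      then show "\<sigma> (word_perm u i) < \<sigma> (word_perm u (Suc i))"
        using l snoc by (cases r rule: rev_cases) (auto simp: ascending_append)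
    qed
  next
    assume r: "\<forall>u i r. w @ [j] = u @ i # r \<longrightarrow> \<sigma> (word_perm u i) < \<sigma> (word_perm u (Suc i))"
    then have "ascending \<sigma> w" unfolding snoc by fastforce
    then show "ascending \<sigma> (w @ [j])" using r by (auto simp: ascending_append)
  qed
qed simp

definition right_word :: "nat list \<Rightarrow> (nat \<Rightarrow> site) linop" where
  "right_word w = prod_list (map right_T w)"

lemma right_word_simps [simp]: "right_word [] = 1" "right_word (j # w) = right_T j * right_word w" "right_word (u @ w) = right_word u * right_word w"
  by (simp_all add: right_word_def)

lemma Phi_T_word: "Phi n (T_word w) = right_word w"
  by (induction w) (simp_all add: Phi_one Phi_mult Phi_T)

lemma right_word_dl: "ascending \<sigma> w \<Longrightarrow> app (right_word w) (delta (state_of (\<sigma>, {}))) = delta (state_of (\<sigma> \<circ> word_perm w, {}))"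
  by (induction w arbitrary: \<sigma>) (simp_all add: right_T_dl o_assoc)

lemma C_word_dl:
  assumes "sorted_wrt (<) xs" "\<And>i j. i \<in> I \<Longrightarrow> j \<in> set xs \<Longrightarrow> i < j"
  shows "app (Phi n (C_word xs)) (delta (state_of (\<sigma>, I))) = delta (state_of (\<sigma>, I \<union> set xs))"
  using assms
proof (induction xs arbitrary: I)
  case (Cons x xs)
  have "app (Phi n (C_word xs)) (delta (state_of (\<sigma>, insert x I))) = delta (state_of (\<sigma>, insert x I \<union> set xs))"
    using Cons.prems by (intro Cons.IH) auto
  then show ?case using Cons.prems by (simp add: Phi_mult Phi_C right_C_dl)
qed (simp add: Phi_one)

text \<open>The coordinates of \<open>p\<close>: the starting vector
  \<open>delta (state_of (id, {}))\<close> represents the unit, and \<open>p\<close> acts on it from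
  the right.\<close>

definition eval_free :: "nat \<Rightarrow> hc_free \<Rightarrow> (nat \<Rightarrow> site) \<Rightarrow> hc_field" where
  "eval_free n p = app (Phi n p) (delta (state_of (id, {})))"

lemma eval_free_TC:
  assumes "ascending id w" "finite I"
  shows "eval_free n (T_word w * C_word (sorted_list_of_set I)) = delta (state_of (word_perm w, I))"
  using assms C_word_dl[of "sorted_list_of_set I" "{}" n "word_perm w"]
  by (simp add: eval_free_def Phi_mult Phi_T_word right_word_dl)

section \<open>Canonical words, reduced words and their permutations\<close>

lemma word_perm_permutes: "set w \<subseteq> {1..<n} \<Longrightarrow> word_perm w permutes {1..n}"
proof (induction w)
  case (Cons j w)
  then show ?case
    unfolding word_perm_simps by (intro permutes_compose permutes_swap_id) auto
qed (simp only: word_perm_simps permutes_id)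

lemma bij_word_perm [simp]: "bij (word_perm w)"
proof (induction w)
  case (Cons j w)
  then show ?case unfolding word_perm_simps by (intro bij_comp bij_transpose)
qed (simp only: word_perm_simps bij_id)

lemma word_perm_interval:
  assumes "k \<le> Suc m"
  shows "word_perm [k..<Suc m] x = (if x < k then x else if x \<le> m then Suc x else if x = Suc m then k else x)"
  using assms
proof (induction k rule: inc_induct)
  case (step k)
  have "[k..<Suc m] = k # [Suc k..<Suc m]" using step by (simp add: upt_rec)
  then show ?case using step by (auto simp: transpose_def)
qed (auto)

lemma ascending_comp:
  assumes "ascending \<sigma> w" "\<sigma> permutes {1..m}" "set w \<subseteq> {1..<m}" "\<And>x y. x < y \<Longrightarrow> x \<in> {1..m} \<Longrightarrow> y \<in> {1..m} \<Longrightarrow> \<tau> x < \<tau> y"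
  shows "ascending (\<tau> \<circ> \<sigma>) w"
  using assms(1-3)
proof (induction w arbitrary: \<sigma>)
  case (Cons j w)
  have "\<sigma> j \<in> {1..m}" "\<sigma> (Suc j) \<in> {1..m}"
    using Cons.prems unfolding permutes_in_image[OF Cons.prems(2)] by auto
  then have "\<tau> (\<sigma> j) < \<tau> (\<sigma> (Suc j))" using Cons.prems by (intro assms(4)) auto
  moreover have "ascending (\<tau> \<circ> (\<sigma> \<circ> transpose j (Suc j))) w"
    using Cons.prems unfolding ascending.simps by (intro Cons.IH permutes_compose[OF permutes_swap_id]) (auto simp: comp_def)
  ultimately show ?case by (simp add: comp_def)
qed simp

lemma ascending_interval:
  assumes "k \<le> m"
  shows "ascending id [k..<m]"
  using assms
proof (induction m rule: dec_induct)
  case (step m)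
  have "word_perm [k..<m] m \<le> m" "word_perm [k..<m] (Suc m) = Suc m"
    using word_perm_interval[of k "m - 1"] step by (cases m; simp)+
  then show ?case using step by (simp add: upt_Suc ascending_append)
qed simp

text \<open>The leading run is increasing on \<open>{1..m}\<close> by
  \<open>word_perm_interval\<close>, so multiplying by it on the left leaves all comparisons of the
  remaining word unchanged.\<close>

lemma ascending_CW: "w \<in> canon_words m \<Longrightarrow> ascending id w"
proof (induction m arbitrary: w)
  case (Suc m)
  then obtain k u where w: "w = [k..<Suc m] @ u" "k \<in> {1..Suc m}" "u \<in> canon_words m" by auto
  have "ascending (word_perm [k..<Suc m] \<circ> id) u"
    using w canon_words_letters[OF w(3)] by (intro ascending_comp[of _ _ m] Suc.IH permutes_id) (auto simp: word_perm_interval)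
  then show ?case using w ascending_interval[of k "Suc m"] unfolding w(1) ascending_append by simp
qed simp

text \<open>The start \<open>k\<close> of the leading run can be read off as the image of
  \<open>m + 1\<close>.\<close>

lemma word_perm_CW_inj: "u \<in> canon_words m \<Longrightarrow> w \<in> canon_words m \<Longrightarrow> word_perm u = word_perm w \<Longrightarrow> u = w"
proof (induction m arbitrary: u w)
  case (Suc m)
  obtain k u' where u: "u = [k..<Suc m] @ u'" "k \<in> {1..Suc m}" "u' \<in> canon_words m" using Suc.prems by auto
  obtain l w' where w: "w = [l..<Suc m] @ w'" "l \<in> {1..Suc m}" "w' \<in> canon_words m" using Suc.prems by auto
  have last: "word_perm v (Suc m) = Suc m" if "v \<in> canon_words m" for v
    using word_perm_permutes[OF canon_words_letters[OF that]] by (simp add: permutes_def)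
  have "word_perm u (Suc m) = k" "word_perm w (Suc m) = l"
    using u w by (simp_all add: last word_perm_interval)
  then have "k = l" using Suc.prems by simp
  then have "word_perm [k..<Suc m] \<circ> word_perm u' = word_perm [k..<Suc m] \<circ> word_perm w'"
    using Suc.prems(3) u w by (simp add: comp_def)
  then have "word_perm u' = word_perm w'"
    by (metis bij_word_perm bij_is_inj fun.inj_map inj_eq)
  then show ?case using Suc.IH[OF u(3) w(3)] u w \<open>k = l\<close> by simp
qed simp

lemma word_perm_CW_surj: "\<sigma> permutes {1..m} \<Longrightarrow> \<exists>w\<in>canon_words m. word_perm w = \<sigma>"
proof (induction m arbitrary: \<sigma>)
  case 0
  then show ?case by (simp add: id_def permutes_empty)
next
  case (Suc m)
  define k where "k = \<sigma> (Suc m)"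
  have k: "k \<in> {1..Suc m}" using permutes_in_image[OF Suc.prems, of "Suc m"] by (simp add: k_def)
  let ?D = "word_perm [k..<Suc m]"
  have D: "?D permutes {1..Suc m}" using k by (intro word_perm_permutes) auto
  have Dk: "?D (Suc m) = k" using k by (simp add: word_perm_interval)
  \<comment> \<open>Strip off the run that carries \<open>m + 1\<close> to
    \<open>\<sigma> (m + 1)\<close>; what remains fixes \<open>m + 1\<close>.\<close>
  let ?\<tau> = "inv_fun ?D \<circ> \<sigma>"
  have "?\<tau> permutes {1..Suc m}" by (intro permutes_compose Suc.prems permutes_inv D)
  moreover have "?\<tau> (Suc m) = Suc m"
    using Dk by (simp add: k_def[symmetric]) (metis bij_inv_eq_iff bij_word_perm)
  ultimately have "?\<tau> permutes {1..m}"
    by (elim permutes_superset) (auto simp: le_Suc_eq)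
  then obtain w where w: "w \<in> canon_words m" "word_perm w = ?\<tau>" using Suc.IH by blast
  then have "word_perm ([k..<Suc m] @ w) = \<sigma>"
    by (simp add: o_assoc) (metis bij_word_perm bij_is_surj surj_iff id_comp)
  then show ?case using canon_words_I[OF k w(1)] by blast
qed

text \<open>The exchange condition. The images of \<open>j\<close> and \<open>j + 1\<close> start in
  order and end inverted, so some letter exchanges exactly these two images; deleting it has the
  same effect as multiplying by \<open>s_j\<close> on the right.\<close>

lemma exchange:
  assumes "\<not> word_perm u j < word_perm u (Suc j)"
  shows "\<exists>u'. set u' \<subseteq> set u \<and> length u = Suc (length u') \<and> word_perm u' = word_perm u \<circ> transpose j (Suc j)"
  using assms
proof (induction u)
  case (Cons a u)
  show ?case
  proof (cases "word_perm u j < word_perm u (Suc j)")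
    case False
    then obtain u' where "set u' \<subseteq> set u \<and> length u = Suc (length u') \<and> word_perm u' = word_perm u \<circ> transpose j (Suc j)"
      using Cons.IH by blast
    then show ?thesis by (intro exI[of _ "a # u'"]) (auto simp: o_assoc)
  next
    case True
    have a: "word_perm u j = a" "word_perm u (Suc j) = Suc a"
      using True Cons.prems by (auto simp: transpose_def split: if_splits)
    have "transpose a (Suc a) \<circ> word_perm u \<circ> transpose j (Suc j) = word_perm u"
    proof
      fix x
      have "word_perm u x = a \<longleftrightarrow> x = j" "word_perm u x = Suc a \<longleftrightarrow> x = Suc j"
        using a by (metis bij_pointE bij_word_perm)+
      then show "(transpose a (Suc a) \<circ> word_perm u \<circ> transpose j (Suc j)) x = word_perm u x"
        using a by (cases "x = j"; cases "x = Suc j") (auto simp: transpose_def)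
    qed
    then show ?thesis by (intro exI[of _ u]) (auto simp: comp_def)
  qed
qed simp

text \<open>A letter standing at a descent could be removed together with the letter that
  \<open>exchange\<close> deletes, which gives a word shorter by two. Hence every reduced
  expression, whichever one is chosen in \<open>hc_T_perm\<close>, evaluates to the same delta
  function.\<close>

lemma reduced_ascending:
  assumes "reduced_expression n \<sigma> w"
  shows "ascending id w"
  unfolding ascending_iff
proof (intro allI impI, rule ccontr)
  fix u j r assume w: "w = u @ j # r" and "\<not> id (word_perm u j) < id (word_perm u (Suc j))"
  then obtain u' where u': "set u' \<subseteq> set u" "length u = Suc (length u')" "word_perm u' = word_perm u \<circ> transpose j (Suc j)"
    using exchange by fastforce
  have "word_perm (u' @ r) = word_perm w" using w u' by (simp add: o_assoc)
  moreover have "set (u' @ r) \<subseteq> {1..<n}" using assms w u' by (auto simp: reduced_expression_def)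
  ultimately have "length w \<le> length (u' @ r)" using assms unfolding reduced_expression_def by metis
  then show False using w u' by simp
qed

lemma ex_reduced:
  assumes "\<sigma> permutes {1..n}"
  shows "\<exists>w. reduced_expression n \<sigma> w"
proof -
  let ?P = "\<lambda>w. set w \<subseteq> {1..<n} \<and> word_perm w = \<sigma>"
  obtain w where "w \<in> canon_words n" "word_perm w = \<sigma>" using word_perm_CW_surj[OF assms] by blast
  then have "?P w" using canon_words_letters by blast
  then obtain v where "?P v" "\<forall>u. ?P u \<longrightarrow> length v \<le> length u"
    using exists_least_lemma[of "\<lambda>k. \<exists>w. ?P w \<and> length w = k"] ex_has_least_nat[of ?P w length] by blast
  then show ?thesis unfolding reduced_expression_def by blast
qed

text \<open>The same choice as in \<open>hc_T_perm\<close>, named so that each basis element has a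
  definite representative in the free algebra.\<close>

definition reduced_word :: "nat \<Rightarrow> (nat \<Rightarrow> nat) \<Rightarrow> nat list" where
  "reduced_word n \<sigma> = (SOME w. reduced_expression n \<sigma> w)"

lemma reduced_word:
  assumes "\<sigma> permutes {1..n}"
  shows "set (reduced_word n \<sigma>) \<subseteq> {1..<n}" "word_perm (reduced_word n \<sigma>) = \<sigma>" "ascending id (reduced_word n \<sigma>)"
proof -
  have "reduced_expression n \<sigma> (reduced_word n \<sigma>)"
    unfolding reduced_word_def using ex_reduced[OF assms] by (rule someI_ex)
  then show "set (reduced_word n \<sigma>) \<subseteq> {1..<n}" "word_perm (reduced_word n \<sigma>) = \<sigma>" "ascending id (reduced_word n \<sigma>)"
    using reduced_ascending by (auto simp: reduced_expression_def)
qed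

section \<open>Linear independence and the coefficient functions\<close>

definition basis_lift :: "nat \<Rightarrow> (nat \<Rightarrow> nat) \<times> nat set \<Rightarrow> hc_free" where
  "basis_lift n = (\<lambda>(\<sigma>, I). T_word (reduced_word n \<sigma>) * C_word (sorted_list_of_set I))"

lemma basis_lift_FA: "b \<in> basis_index n \<Longrightarrow> basis_lift n b \<in> free_carrier n"
  by (cases b) (auto simp: basis_lift_def basis_index_def reduced_word intro!: free_carrier_mult T_word_FA sorted_list_of_set_free_carrier dest!: reduced_word(1))

lemma eval_free_bas: "b \<in> basis_index n \<Longrightarrow> eval_free n (basis_lift n b) = delta (state_of b)"
  by (cases b) (auto simp: basis_lift_def basis_index_def reduced_word eval_free_TC finite_subset)

lemma finite_basis_index [simp]: "finite (basis_index n)"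
  by (simp add: basis_index_def finite_permutations)

lemma eval_free_cong: "hc_cong n p r \<Longrightarrow> eval_free n p = eval_free n r"
  using Phi_ideal[of "p - r" n] by (simp add: hc_cong_def eval_free_def Phi_diff)

lemma eval_free_diff: "eval_free n (p - r) = (\<lambda>x. eval_free n p x - eval_free n r x)"
  and eval_free_scalar: "eval_free n (free_scalar a * p) = (\<lambda>x. a * eval_free n p x)"
  and eval_free_mult: "eval_free n (p * r) = app (Phi n r) (eval_free n p)"
  by (simp_all add: eval_free_def Phi_diff Phi_mult Phi_scalar)

lemma eval_free_sum: "eval_free n (sum f S) = (\<lambda>x. \<Sum>i\<in>S. eval_free n (f i) x)"
  by (simp add: eval_free_def Phi_sum app_sum_op)

text \<open>Spanning and evaluation meet here: canonical elements go to delta functions at different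
  states, so evaluation reads off the coefficients of a spanning combination. This gives
  independence in \<open>eval_free_inj0\<close> and finite support in
  \<open>eval_free_support\<close>.\<close>

lemma eval_free_expand:
  assumes "p \<in> free_carrier n"
  obtains a where "hc_cong n p (\<Sum>b\<in>canon_index n. free_scalar (a b) * canon_elem b)"
    "\<And>x. eval_free n p x = (\<Sum>b\<in>canon_index n. a b * delta (state_of (word_perm (fst b), snd b)) x)"
proof -
  obtain a where a: "hc_cong n p (\<Sum>b\<in>canon_index n. free_scalar (a b) * canon_elem b)"
    using in_span_FA[OF assms] by (auto simp: in_span_def)
  moreover have "eval_free n p x = (\<Sum>b\<in>canon_index n. a b * delta (state_of (word_perm (fst b), snd b)) x)" for x
    unfolding eval_free_cong[OF a] eval_free_sum eval_free_scalar
    by (rule sum.cong) (auto simp: canon_elem_def eval_free_TC ascending_CW finite_subset)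
  ultimately show thesis using that by blast
qed

lemma eval_free_inj0:
  assumes "p \<in> free_carrier n" "eval_free n p = (\<lambda>x. 0)"
  shows "p \<in> hc_ideal n"
proof -
  obtain a where a: "hc_cong n p (\<Sum>b\<in>canon_index n. free_scalar (a b) * canon_elem b)"
    "\<And>x. eval_free n p x = (\<Sum>b\<in>canon_index n. a b * delta (state_of (word_perm (fst b), snd b)) x)"
    using eval_free_expand[OF assms(1)] by blast
  have "a b = 0" if "b \<in> canon_index n" for b
  proof -
    have "(\<Sum>c\<in>canon_index n. a c * delta (state_of (word_perm (fst c), snd c)) (state_of (word_perm (fst b), snd b))) = (\<Sum>c\<in>canon_index n. if c = b then a c else 0)"
      using that by (intro sum.cong) (auto simp: delta_def word_perm_CW_inj)
    then show ?thesis using a(2)[of "state_of (word_perm (fst b), snd b)"] assms(2) that by simp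
  qed
  then have "(\<Sum>b\<in>canon_index n. free_scalar (a b) * canon_elem b) = 0" by (intro sum.neutral) simp
  then show ?thesis using a(1) by (simp add: hc_cong_def)
qed

lemma eval_free_inj:
  assumes "p \<in> free_carrier n" "r \<in> free_carrier n"
  shows "hc_cong n p r \<longleftrightarrow> eval_free n p = eval_free n r"
proof
  assume "eval_free n p = eval_free n r"
  then have "eval_free n (p - r) = (\<lambda>x. 0)" by (simp add: eval_free_diff)
  then show "hc_cong n p r" unfolding hc_cong_def using assms by (intro eval_free_inj0) auto
qed (rule eval_free_cong)

lemma eval_free_support:
  assumes "p \<in> free_carrier n" "eval_free n p x \<noteq> 0"
  shows "x \<in> state_of ` basis_index n"
proof -
  obtain a where a: "\<And>x. eval_free n p x = (\<Sum>b\<in>canon_index n. a b * delta (state_of (word_perm (fst b), snd b)) x)"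
    using eval_free_expand[OF assms(1)] by blast
  have "\<exists>b\<in>canon_index n. delta (state_of (word_perm (fst b), snd b)) x \<noteq> 0"
  proof (rule ccontr)
    assume "\<not> (\<exists>b\<in>canon_index n. delta (state_of (word_perm (fst b), snd b)) x \<noteq> 0)"
    then have "eval_free n p x = 0" unfolding a by (intro sum.neutral) auto
    then show False using assms(2) by simp
  qed
  then obtain b where "b \<in> canon_index n" "delta (state_of (word_perm (fst b), snd b)) x \<noteq> 0" by blast
  then show ?thesis
    using word_perm_permutes[OF canon_words_letters, of "fst b" n]
    by (cases b) (auto simp: delta_def basis_index_def split: if_splits)
qed

lemma hc_T_word_class: "set w \<subseteq> {1..<n} \<Longrightarrow> hc_T_word n w = hc_class n (T_word w)"
  by (induction w) (simp_all add: hc_T_word_def hc_class_one hc_T_def hc_class_mult T_word_FA)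

lemma hc_C_set_class:
  assumes "I \<subseteq> {1..n}"
  shows "hc_C_set n I = hc_class n (C_word (sorted_list_of_set I))"
proof -
  have "foldr (\<lambda>i h. hc_C n i \<otimes>\<^bsub>hecke_clifford n\<^esub> h) xs \<one>\<^bsub>hecke_clifford n\<^esub> = hc_class n (C_word xs)"
    if "set xs \<subseteq> {1..n}" for xs
    using that by (induction xs) (simp_all add: hc_class_one hc_C_def hc_class_mult C_word_FA)
  then show ?thesis using assms finite_subset[OF assms] by (simp add: hc_C_set_def)
qed

lemma hc_basis_class: "b \<in> basis_index n \<Longrightarrow> hc_basis n b = hc_class n (basis_lift n b)"
  by (cases b) (auto simp: hc_basis_def basis_lift_def basis_index_def hc_T_perm_def reduced_word_def[symmetric] hc_T_word_class
      reduced_word hc_C_set_class hc_class_mult T_word_FA sorted_list_of_set_free_carrier)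

text \<open>Equality of classes is equality of evaluations, so the description in
  \<open>hc_coeffs\<close> has exactly one solution and the \<open>THE\<close> can be
  computed.\<close>

lemma hc_coeffs_class:
  assumes p: "p \<in> free_carrier n" and b: "b \<in> basis_index n"
  shows "hc_coeffs n (hc_class n p) b = eval_free n p (state_of b)"
proof -
  let ?B = "basis_index n"
  have "(\<Oplus>\<^bsub>hecke_clifford n\<^esub>b\<in>?B. hc_scalar n (f b) \<otimes>\<^bsub>hecke_clifford n\<^esub> hc_basis n b)
      = hc_class n (\<Sum>b\<in>?B. free_scalar (f b) * basis_lift n b)" for f
  proof -
    interpret ring "hecke_clifford n" by (rule hecke_clifford_ring)
    have "(\<Oplus>\<^bsub>hecke_clifford n\<^esub>b\<in>?B. hc_scalar n (f b) \<otimes>\<^bsub>hecke_clifford n\<^esub> hc_basis n b)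
       = (\<Oplus>\<^bsub>hecke_clifford n\<^esub>b\<in>?B. hc_class n (free_scalar (f b) * basis_lift n b))"
      by (rule finsum_cong') (auto simp: hc_scalar_def hc_basis_class hc_class_mult basis_lift_FA intro!: hc_class_closed)
    also have "\<dots> = hc_class n (\<Sum>b\<in>?B. free_scalar (f b) * basis_lift n b)"
      by (rule hc_class_finsum) (auto simp: basis_lift_FA)
    finally show ?thesis .
  qed
  moreover have "hc_class n p = hc_class n (\<Sum>b\<in>?B. free_scalar (f b) * basis_lift n b) \<longleftrightarrow> (\<forall>b\<in>?B. f b = eval_free n p (state_of b))" for f
  proof -
    let ?r = "\<Sum>b\<in>?B. free_scalar (f b) * basis_lift n b"
    have r: "?r \<in> free_carrier n" by (intro free_carrier_sum free_carrier_mult free_carrier_scalar basis_lift_FA)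
    have evr: "eval_free n ?r x = (\<Sum>b\<in>?B. f b * delta (state_of b) x)" for x
      unfolding eval_free_sum eval_free_scalar by (rule sum.cong) (simp_all add: eval_free_bas)
    have "eval_free n ?r (state_of b) = f b" if "b \<in> ?B" for b
    proof -
      have "(\<Sum>c\<in>?B. f c * delta (state_of c) (state_of b)) = (\<Sum>c\<in>?B. if c = b then f c else 0)"
        by (rule sum.cong) (auto simp: delta_def)
      then show ?thesis using that by (simp add: evr)
    qed
    \<comment> \<open>Off the basis states both evaluations vanish, so agreement on the basis
      suffices.\<close>
    moreover have "eval_free n p = eval_free n ?r \<longleftrightarrow> (\<forall>b\<in>?B. eval_free n p (state_of b) = eval_free n ?r (state_of b))"
    proof (intro iffI ext)
      fix x assume a: "\<forall>b\<in>?B. eval_free n p (state_of b) = eval_free n ?r (state_of b)"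
      show "eval_free n p x = eval_free n ?r x"
        by (cases "x \<in> state_of ` ?B") (use a eval_free_support[OF p, of x] eval_free_support[OF r, of x] in force)+
    qed simp
    ultimately show ?thesis using hc_class_eq_iff[OF p r] eval_free_inj[OF p r] by (auto simp: hc_cong_def)
  qed
  ultimately have "hc_coeffs n (hc_class n p) =
     (THE f. (\<forall>b. b \<notin> ?B \<longrightarrow> f b = 0) \<and> (\<forall>b\<in>?B. f b = eval_free n p (state_of b)))"
    unfolding hc_coeffs_def by simp
  also have "\<dots> = (\<lambda>b. if b \<in> ?B then eval_free n p (state_of b) else 0)"
    by (rule the_equality) (auto simp: fun_eq_iff)
  finally show ?thesis using b by simp
qed

section \<open>Left multiplication in coordinates\<close>

lemma left_T_rC_commute: "left_T i * right_C n j = right_C n j * left_T i"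
proof (rule linop_eqI)
  fix f and u :: "nat \<Rightarrow> site"
  have "(\<lambda>k. fst (flip j u k)) = (\<lambda>k. fst (u k))" by (auto simp: flip_def)
  moreover have "swap_values i (flip j u) = flip j (swap_values i u)" by (auto simp: swap_values_def flip_def)
  moreover have "tail_sign n j (swap_values i u) = tail_sign n j u" by (simp add: tail_sign_def swap_values_def)
  ultimately show "app (left_T i * right_C n j) f u = app (right_C n j * left_T i) f u"
    by (simp add: left_T.rep_eq right_C.rep_eq left_ascent_def algebra_simps)
qed

lemma left_T_Phi_commute: "left_T i * Phi n p = Phi n p * left_T i"
proof -
  have g: "left_T i * gen_action n g = gen_action n g * left_T i" for g
    by (cases g) (simp_all add: gen_action_def left_T_rT_commute left_T_rC_commute)
  have m: "left_T i * Phi n (mon l) = Phi n (mon l) * left_T i" for l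
  proof (induction l)
    case (Cons h l)
    have "left_T i * (gen_action n h * Phi n (mon l)) = gen_action n h * (left_T i * Phi n (mon l))"
      by (simp add: g flip: mult.assoc)
    then show ?case using Cons by (simp add: mon_Cons Phi_mult Phi_gen mult.assoc)
  qed (simp add: Phi_one)
  have "p = (\<Sum>w\<in>Poly_Mapping.keys p. free_scalar (Poly_Mapping.lookup p w) * mon (letters w))"
    by (simp flip: single_eq_mon poly_mapping_eq_sum_single)
  then have e: "Phi n p = (\<Sum>w\<in>Poly_Mapping.keys p. scal (Poly_Mapping.lookup p w) * Phi n (mon (letters w)))"
    by (metis (no_types, lifting) Phi_sum Phi_mult Phi_scalar sum.cong)
  have "left_T i * (scal a * Phi n (mon l)) = scal a * Phi n (mon l) * left_T i" for a l
    by (metis m mult.assoc scal_commute)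
  then show ?thesis unfolding e by (simp add: sum_distrib_left sum_distrib_right)
qed

lemma left_T_rword_commute: "left_T i * right_word w = right_word w * left_T i"
  using left_T_Phi_commute[of i undefined "T_word w"] by (simp add: Phi_T_word)

lemma left_T_dl: "app (left_T i) (delta (state_of (id, {}))) = delta (state_of (transpose i (Suc i), {}))"
proof
  fix u :: "nat \<Rightarrow> site"
  let ?u0 = "state_of (id, {})" and ?u1 = "state_of (transpose i (Suc i), {})"
  have f: "(\<lambda>k. fst (?u0 k)) = id" "(\<lambda>k. fst (?u1 k)) = transpose i (Suc i)" by (auto simp: state_of_def)
  have m: "swap_values i u = ?u0 \<longleftrightarrow> u = ?u1"
  proof
    assume a: "swap_values i u = ?u0"
    show "u = ?u1"
    proof
      fix k show "u k = ?u1 k" using fun_cong[OF a, of k]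
        by (cases "u k") (auto simp: swap_values_def state_of_def transpose_eq_iff)
    qed
  qed (auto simp: swap_values_def state_of_def)
  have "id \<noteq> transpose i (Suc i)" by (metis id_apply transpose_apply_first n_not_Suc_n)
  then have ne: "?u0 \<noteq> ?u1" by simp
  have "left_ascent i ?u0" "\<not> left_ascent i ?u1" by (simp_all add: left_ascent_def f)
  then show "app (left_T i) (delta ?u0) u = delta ?u1 u"
    unfolding left_T.rep_eq delta_def m using ne f by auto
qed

text \<open>On the vector of the unit, left and right multiplication by \<open>T_i\<close> agree.
  Since \<open>left_T\<close> commutes with every right action, the equality spreads from the unit
  to all \<open>p\<close>.\<close>

lemma eval_free_T_left: "eval_free n (free_T i * p) = app (left_T i) (eval_free n p)"
proof -
  have "app (right_T i) (delta (state_of (id, {}))) = app (left_T i) (delta (state_of (id, {})))"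
    by (simp add: left_T_dl right_T_dl)
  then have "eval_free n (free_T i * p) = app (left_T i * Phi n p) (delta (state_of (id, {})))"
    by (simp add: eval_free_def Phi_mult Phi_T)
  then show ?thesis unfolding left_T_Phi_commute by (simp add: eval_free_def)
qed

definition left_word :: "nat list \<Rightarrow> ((nat \<Rightarrow> site) \<Rightarrow> hc_field) \<Rightarrow> (nat \<Rightarrow> site) \<Rightarrow> hc_field" where
  "left_word w = foldr (\<lambda>i. app (left_T i)) w"

lemma left_word_simps [simp]: "left_word [] f = f" "left_word (i # w) f = app (left_T i) (left_word w f)"
  by (simp_all add: left_word_def)

lemma eval_free_Tw_left: "eval_free n (T_word w * p) = left_word w (eval_free n p)"
  by (induction w) (simp_all add: mult.assoc eval_free_T_left)

lemma left_word_rword: "left_word w (app (right_word v) f) = app (right_word v) (left_word w f)"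
proof (induction w)
  case (Cons i w)
  have "app (left_T i) (app (right_word v) g) = app (right_word v) (app (left_T i) g)" for g
    using arg_cong[OF left_T_rword_commute[of i v], of "\<lambda>F. app F g"] by simp
  then show ?case using Cons by simp
qed simp

section \<open>Words for the Coxeter elements and the bitrace as a trace\<close>

fun coxeter_word :: "nat \<Rightarrow> nat list \<Rightarrow> nat list" where
  "coxeter_word d [] = []"
| "coxeter_word d (m # \<mu>) = [d + 1..<d + m] @ coxeter_word (d + m) \<mu>"

lemma coxeter_from_word: "coxeter_from d \<mu> = word_perm (coxeter_word d \<mu>)"
  by (induction \<mu> arbitrary: d) simp_all

lemma set_coxeter_word: "set (coxeter_word d \<mu>) \<subseteq> {d + 1..<d + sum_list \<mu>}"
  by (induction \<mu> arbitrary: d) fastforce+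

lemma sorted_coxeter_word: "sorted_wrt (<) (coxeter_word d \<mu>)"
proof (induction \<mu> arbitrary: d)
  case (Cons m \<mu>)
  then show ?case using set_coxeter_word[of "d + m" \<mu>] by (fastforce simp: sorted_wrt_append)
qed simp

lemma word_perm_above:
  assumes "\<And>i. i \<in> set w \<Longrightarrow> i < j"
  shows "j < x \<Longrightarrow> word_perm w x = x" "x \<le> j \<Longrightarrow> word_perm w x \<le> j"
proof -
  show "j < x \<Longrightarrow> word_perm w x = x" using assms by (induction w) (force simp: transpose_def)+
  show "x \<le> j \<Longrightarrow> word_perm w x \<le> j" using assms by (induction w) (force simp: transpose_def)+
qed

text \<open>The letters before \<open>j\<close> are smaller than \<open>j\<close>, so they fix
  \<open>j + 1\<close> and send \<open>j\<close> to something at most \<open>j\<close>: the letter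
  \<open>j\<close> is used at an ascent.\<close>

lemma sorted_ascending: "sorted_wrt (<) w \<Longrightarrow> ascending id w"
  unfolding ascending_iff
proof (intro allI impI)
  fix u j r assume "sorted_wrt (<) w" "w = u @ j # r"
  then have "\<And>i. i \<in> set u \<Longrightarrow> i < j" by (auto simp: sorted_wrt_append)
  then show "id (word_perm u j) < id (word_perm u (Suc j))"
    using word_perm_above[of u j "Suc j"] word_perm_above[of u j j] by auto
qed

text \<open>The reduced word chosen for \<open>\<gamma>_\<mu>\<close> may differ from
  \<open>coxeter_word\<close>, but both evaluate to the same delta function and hence have the same
  class.\<close>

lemma basis_lift_coxeter:
  assumes "sum_list \<mu> = n"
  shows "(coxeter_perm \<mu>, {}) \<in> basis_index n" "hc_basis n (coxeter_perm \<mu>, {}) = hc_class n (T_word (coxeter_word 0 \<mu>))"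
    "T_word (coxeter_word 0 \<mu>) \<in> free_carrier n"
proof -
  have s: "set (coxeter_word 0 \<mu>) \<subseteq> {1..<n}" using set_coxeter_word[of 0 \<mu>] assms by simp
  show free_carrier: "T_word (coxeter_word 0 \<mu>) \<in> free_carrier n" using s by (rule T_word_FA)
  show b: "(coxeter_perm \<mu>, {}) \<in> basis_index n"
    using word_perm_permutes[OF s] by (simp add: basis_index_def coxeter_perm_def coxeter_from_word)
  have "eval_free n (T_word (coxeter_word 0 \<mu>)) = eval_free n (basis_lift n (coxeter_perm \<mu>, {}))"
    using eval_free_TC[OF sorted_ascending[OF sorted_coxeter_word], of "{}" n 0 \<mu>]
    by (simp add: eval_free_bas[OF b]) (simp add: coxeter_perm_def coxeter_from_word)
  then show "hc_basis n (coxeter_perm \<mu>, {}) = hc_class n (T_word (coxeter_word 0 \<mu>))"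
    using b free_carrier basis_lift_FA[OF b] by (simp add: hc_basis_class hc_class_eq_iff hc_cong_def[symmetric] eval_free_inj)
qed

lemma sbtr_comp_trace:
  assumes "sum_list \<mu> = n" "sum_list \<nu> = n"
  shows "sbtr_comp n \<mu> \<nu> =
    (\<Sum>c\<in>basis_index n. left_word (coxeter_word 0 \<mu>) (app (right_word (coxeter_word 0 \<nu>)) (delta (state_of c))) (state_of c))"
  unfolding sbtr_comp_def sbtr_def
proof (rule sum.cong[OF refl])
  fix c assume c: "c \<in> basis_index n"
  let ?x = "T_word (coxeter_word 0 \<mu>)" and ?y = "T_word (coxeter_word 0 \<nu>)"
  have free_carrier: "?x \<in> free_carrier n" "?y \<in> free_carrier n" "basis_lift n c \<in> free_carrier n" using basis_lift_coxeter(3)[OF assms(1)] basis_lift_coxeter(3)[OF assms(2)] basis_lift_FA[OF c] by auto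
  have "hc_coeffs n (hc_class n (?x * basis_lift n c * ?y)) c = eval_free n (?x * basis_lift n c * ?y) (state_of c)"
    using free_carrier c by (intro hc_coeffs_class) auto
  also have "\<dots> = left_word (coxeter_word 0 \<mu>) (app (right_word (coxeter_word 0 \<nu>)) (delta (state_of c))) (state_of c)"
    unfolding eval_free_mult[of n "?x * basis_lift n c"] Phi_T_word eval_free_Tw_left eval_free_bas[OF c] left_word_rword ..
  finally show "hc_coeffs n (hc_basis n (coxeter_perm \<mu>, {}) \<otimes>\<^bsub>hecke_clifford n\<^esub> hc_basis n c
      \<otimes>\<^bsub>hecke_clifford n\<^esub> hc_basis n (coxeter_perm \<nu>, {})) c = \<dots>"
    using free_carrier c by (simp add: basis_lift_coxeter(2)[OF assms(1)] basis_lift_coxeter(2)[OF assms(2)] hc_basis_class hc_class_mult)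
qed

section \<open>Signed words and restriction to parabolic subalgebras\<close>

type_synonym slist = "site list"

fun before :: "slist \<Rightarrow> nat \<Rightarrow> nat \<Rightarrow> bool" where
  "before [] x y \<longleftrightarrow> False"
| "before (z # w) x y \<longleftrightarrow> fst z = x \<or> fst z \<noteq> y \<and> before w x y"

definition sub2 :: "nat \<Rightarrow> bool \<Rightarrow> bool \<Rightarrow> bool \<Rightarrow> slist \<Rightarrow> slist" where
  "sub2 j s a b w = map (\<lambda>e. if fst e = j then (if s then (Suc j, b) else (j, a))
     else if fst e = Suc j then (if s then (j, a) else (Suc j, b)) else e) w"

lift_definition right_T_sw :: "nat \<Rightarrow> slist linop" is
  "\<lambda>j F w. local_T (before w j (Suc j)) ((j, True) \<in> set w) ((Suc j, True) \<in> set w) (\<lambda>s a b. F (sub2 j s a b w))"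
  by (simp add: fun_eq_iff local_T_def algebra_simps)

text \<open>In a block the outermost generator decides the first entry, which the later generators
  do not touch, so the recursion continues on the tail. Blocks of size 0 are allowed because
  splittings produce them; the value 0 on words that are too short is a placeholder.\<close>

fun left_coxeter :: "nat list \<Rightarrow> (slist \<Rightarrow> hc_field) \<Rightarrow> slist \<Rightarrow> hc_field" where
  "left_coxeter [] F w = F w"
| "left_coxeter (0 # \<mu>) F w = left_coxeter \<mu> F w"
| "left_coxeter (Suc 0 # \<mu>) F (x # w) = left_coxeter \<mu> (\<lambda>v. F (x # v)) w"
| "left_coxeter (Suc (Suc m) # \<mu>) F (x # y # w) =
    (if fst x < fst y then q * left_coxeter (Suc m # \<mu>) (\<lambda>v. F (y # v)) (x # w)
     else left_coxeter (Suc m # \<mu>) (\<lambda>v. F (y # v)) (x # w) + (q - 1) * left_coxeter (Suc m # \<mu>) (\<lambda>v. F (x # v)) (y # w))"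
| "left_coxeter (Suc 0 # \<mu>) F [] = 0"
| "left_coxeter (Suc (Suc m) # \<mu>) F [] = 0"
| "left_coxeter (Suc (Suc m) # \<mu>) F [x] = 0"

lemma left_coxeter_zero [simp]: "left_coxeter \<mu> (\<lambda>v. 0) w = 0"
  by (induction \<mu> "\<lambda>v :: slist. 0 :: hc_field" w rule: left_coxeter.induct) simp_all

text \<open>Left multiplication only permutes the entries of a word.\<close>

lemma left_coxeter_cong: "(\<And>v. mset v = mset w \<Longrightarrow> F v = G v) \<Longrightarrow> left_coxeter \<mu> F w = left_coxeter \<mu> G w"
proof (induction \<mu> F w arbitrary: G rule: left_coxeter.induct)
  case (3 \<mu> F x w)
  have "left_coxeter \<mu> (\<lambda>v. F (x # v)) w = left_coxeter \<mu> (\<lambda>v. G (x # v)) w" using 3 by simp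
  then show ?case by simp
next
  case (4 m \<mu> F x y w)
  have a: "left_coxeter (Suc m # \<mu>) (\<lambda>v. F (y # v)) (x # w) = left_coxeter (Suc m # \<mu>) (\<lambda>v. G (y # v)) (x # w)"
    by (cases "fst x < fst y"; rule 4(1,2)) (use 4(4) in auto)
  have b: "left_coxeter (Suc m # \<mu>) (\<lambda>v. F (x # v)) (y # w) = left_coxeter (Suc m # \<mu>) (\<lambda>v. G (x # v)) (y # w)" if "\<not> fst x < fst y"
    using 4(3)[OF that] 4(4) by simp
  show ?case using a b by simp
qed simp_all

text \<open>The inverse picture: the \<open>k\<close>-th letter of the word of \<open>(\<sigma>, I)\<close> is the site \<open>j\<close> with \<open>\<sigma> j = k\<close>, with its
  Clifford bit. Right multiplication changes labels and left multiplication permutes positions, so a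
  parabolic subalgebra acting on the right only sees the subword of its own labels.\<close>

definition signed_words :: "nat set \<Rightarrow> slist set" where
  "signed_words J = {w. distinct (map fst w) \<and> fst ` set w = J}"

lemma signed_words_length: "w \<in> signed_words J \<Longrightarrow> length w = card J"
  unfolding signed_words_def by (metis (mono_tags) distinct_card length_map list.set_map mem_Collect_eq)

section \<open>Interleavings, and operators that see only one of two subwords\<close>

fun merge :: "bool list \<Rightarrow> 'a list \<Rightarrow> 'a list \<Rightarrow> 'a list" where
  "merge (True # L) (x # v) v' = x # merge L v v'"
| "merge (False # L) v (y # v') = y # merge L v v'"
| "merge L v v' = []"

text \<open>The length condition under which \<open>merge\<close> consumes both lists
  completely.\<close>

definition shape :: "bool list \<Rightarrow> 'a list \<Rightarrow> 'a list \<Rightarrow> bool" where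
  "shape L v v' \<longleftrightarrow> length (filter (\<lambda>b. b) L) = length v \<and> length (filter Not L) = length v'"

lemma shape_simps [simp]:
  "shape [] v v' \<longleftrightarrow> v = [] \<and> v' = []"
  "shape (True # L) v v' \<longleftrightarrow> (\<exists>x u. v = x # u \<and> shape L u v')"
  "shape (False # L) v v' \<longleftrightarrow> (\<exists>y u. v' = y # u \<and> shape L v u)"
  by (auto simp: shape_def Suc_length_conv)

lemma shape_induct [consumes 1, case_names Nil True False]:
  assumes "shape L v v'" "P [] [] []"
    "\<And>L x v v'. shape L v v' \<Longrightarrow> P L v v' \<Longrightarrow> P (True # L) (x # v) v'"
    "\<And>L y v v'. shape L v v' \<Longrightarrow> P L v v' \<Longrightarrow> P (False # L) v (y # v')"
  shows "P L v v'"
  using assms(1)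
proof (induction L arbitrary: v v')
  case (Cons b L)
  then show ?case using assms(3,4) by (cases b) auto
qed (use assms(2) in simp)

lemma set_merge: "shape L v v' \<Longrightarrow> set (merge L v v') = set v \<union> set v'"
  by (induction rule: shape_induct) auto

lemma merge_swap: "shape L v v' \<Longrightarrow> merge (map Not L) v' v = merge L v v'"
  by (induction rule: shape_induct) auto

lemma shape_swap: "shape (map Not L) v' v \<longleftrightarrow> shape L v v'"
  by (auto simp: shape_def filter_map comp_def)

lemma map_merge: "shape L v v' \<Longrightarrow> map f (merge L v v') = merge L (map f v) (map f v')"
  by (induction rule: shape_induct) auto

lemma shape_map [simp]: "shape L (map f v) (map g v') \<longleftrightarrow> shape L v v'"
  by (simp add: shape_def)

lemma distinct_merge:
  "shape L v v' \<Longrightarrow> distinct (merge L v v') \<longleftrightarrow> distinct v \<and> distinct v' \<and> set v \<inter> set v' = {}"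
  by (induction rule: shape_induct) (auto simp: set_merge)

lemma merge_filter: "merge (map P w) (filter P w) (filter (\<lambda>x. \<not> P x) w) = w"
  by (induction w) auto

lemma shape_filter: "shape (map P w) (filter P w) (filter (\<lambda>x. \<not> P x) w)"
  by (simp add: shape_def filter_map comp_def)

lemma filter_merge:
  assumes "shape L v v'" "\<forall>x\<in>set v. P x" "\<forall>x\<in>set v'. \<not> P x"
  shows "map P (merge L v v') = L" "filter P (merge L v v') = v" "filter (\<lambda>x. \<not> P x) (merge L v v') = v'"
  using assms by (induction rule: shape_induct) auto

lemma before_merge:
  assumes "shape L v v'" "x \<notin> fst ` set v'" "y \<notin> fst ` set v'"
  shows "before (merge L v v') x y = before v x y"
  using assms by (induction rule: shape_induct) auto

text \<open>First clause: the operator reads and changes only the subword with labels in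
  \<open>J\<close> and keeps all positions. Second clause: on words over \<open>J\<close> it depends
  only on values at such words, so that functions may be rewritten underneath it.\<close>

definition slicing :: "nat set \<Rightarrow> nat set \<Rightarrow> slist linop \<Rightarrow> bool" where
  "slicing J K R \<longleftrightarrow>
    (\<forall>L v v' F. shape L v v' \<and> v \<in> signed_words J \<and> v' \<in> signed_words K \<longrightarrow>
       app R F (merge L v v') = app R (\<lambda>u. F (merge L u v')) v) \<and>
    (\<forall>F G. (\<forall>v\<in>signed_words J. F v = G v) \<longrightarrow> (\<forall>v\<in>signed_words J. app R F v = app R G v))"

lemma slicingD: "slicing J K R \<Longrightarrow> shape L v v' \<Longrightarrow> v \<in> signed_words J \<Longrightarrow> v' \<in> signed_words K \<Longrightarrow>
   app R F (merge L v v') = app R (\<lambda>u. F (merge L u v')) v"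
  by (simp add: slicing_def)

lemma slicing_local: "slicing J K R \<Longrightarrow> (\<And>v. v \<in> signed_words J \<Longrightarrow> F v = G v) \<Longrightarrow> v \<in> signed_words J \<Longrightarrow> app R F v = app R G v"
  by (simp add: slicing_def)

text \<open>Negating the labelling exchanges the roles of the two subwords.\<close>

lemma slicingD2:
  assumes "slicing K J R" "shape L v v'" "v \<in> signed_words J" "v' \<in> signed_words K"
  shows "app R F (merge L v v') = app R (\<lambda>u. F (merge L v u)) v'"
proof -
  have sh: "shape L v u" if "u \<in> signed_words K" for u
    using assms that by (simp add: shape_def signed_words_length)
  have "app R F (merge L v v') = app R (\<lambda>u. F (merge (map Not L) u v)) v'"
    using slicingD[OF assms(1), of "map Not L" v' v F] assms by (simp add: shape_swap merge_swap)
  also have "\<dots> = app R (\<lambda>u. F (merge L v u)) v'"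
    by (rule slicing_local[OF assms(1) _ assms(4)]) (simp add: merge_swap sh)
  finally show ?thesis .
qed

lemma slicing_one: "slicing J K 1"
  by (simp add: slicing_def)

lemma slicing_zero: "slicing J K 0"
  by (simp add: slicing_def)

lemma slicing_add:
  assumes "slicing J K R" "slicing J K R'"
  shows "slicing J K (R + R')"
  unfolding slicing_def
proof (intro conjI allI impI ballI; (elim conjE)?)
  fix L v v' F assume "shape L v v'" "v \<in> signed_words J" "v' \<in> signed_words K"
  then show "app (R + R') F (merge L v v') = app (R + R') (\<lambda>u. F (merge L u v')) v"
    using slicingD[OF assms(1)] slicingD[OF assms(2)] by simp
next
  fix F G :: "slist \<Rightarrow> hc_field" and v
  assume "\<forall>v\<in>signed_words J. F v = G v" "v \<in> signed_words J"
  then have "app R F v = app R G v" "app R' F v = app R' G v"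
    by (auto intro!: slicing_local[OF assms(1)] slicing_local[OF assms(2)])
  then show "app (R + R') F v = app (R + R') G v" by simp
qed

lemma slicing_mult:
  assumes "slicing J K R" "slicing J K R'"
  shows "slicing J K (R * R')"
  unfolding slicing_def
proof (intro conjI allI impI ballI; (elim conjE)?)
  fix L v v' F assume a: "shape L v v'" "v \<in> signed_words J" "v' \<in> signed_words K"
  have "app R' (app R F) (merge L v v') = app R' (\<lambda>u. app R F (merge L u v')) v"
    by (rule slicingD[OF assms(2) a])
  also have "\<dots> = app R' (app R (\<lambda>u. F (merge L u v'))) v"
    by (rule slicing_local[OF assms(2) _ a(2)], rule slicingD[OF assms(1)])
      (use a in \<open>simp_all add: shape_def signed_words_length\<close>)
  finally show "app (R * R') F (merge L v v') = app (R * R') (\<lambda>u. F (merge L u v')) v" by simp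
next
  fix F G :: "slist \<Rightarrow> hc_field" and v
  assume a: "\<forall>v\<in>signed_words J. F v = G v" "v \<in> signed_words J"
  show "app (R * R') F v = app (R * R') G v"
    using a by (auto intro!: slicing_local[OF assms(2)] slicing_local[OF assms(1)])
qed

lemma sub2_W: "w \<in> signed_words J \<Longrightarrow> j \<in> J \<Longrightarrow> Suc j \<in> J \<Longrightarrow> sub2 j s a b w \<in> signed_words J"
proof -
  assume w: "w \<in> signed_words J" and j: "j \<in> J" "Suc j \<in> J"
  define t where "t = (if s then transpose j (Suc j) else id)"
  have e: "map fst (sub2 j s a b w) = map t (map fst w)"
    by (auto simp: sub2_def transpose_def t_def)
  have J: "t ` J = J" using j by (auto simp: t_def)
  have inj: "inj t" by (simp add: t_def)
  have "distinct (map t (map fst w))"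
    using w inj unfolding signed_words_def distinct_map[of t] by (auto intro: inj_on_subset)
  moreover have "fst ` set (sub2 j s a b w) = t ` (fst ` set w)"
    using arg_cong[OF e, of set] by (simp add: image_image)
  ultimately show ?thesis using w J unfolding signed_words_def e[symmetric] by simp
qed

text \<open>Entries with labels other than \<open>j\<close>, \<open>j + 1\<close> are invisible to
  \<open>before\<close> and fixed by \<open>sub2\<close>.\<close>

lemma slicing_right_T_sw:
  assumes "j \<in> J" "Suc j \<in> J" "J \<inter> K = {}"
  shows "slicing J K (right_T_sw j)"
  unfolding slicing_def
proof (intro conjI allI impI ballI; (elim conjE)?)
  fix L v v' F assume a: "shape L v v'" "v \<in> signed_words J" "v' \<in> signed_words K"
  have n: "j \<notin> fst ` set v'" "Suc j \<notin> fst ` set v'" using a assms by (auto simp: signed_words_def)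
  have "(j, b) \<notin> set v'" "(Suc j, b) \<notin> set v'" for b using n by force+
  moreover have "sub2 j s a b v' = v'" for s a b
    unfolding sub2_def by (rule map_idI) (use n in force)
  moreover have "sub2 j s a b (merge L v v') = merge L (sub2 j s a b v) (sub2 j s a b v')" for s a b
    unfolding sub2_def by (rule map_merge[OF a(1)])
  ultimately show "app (right_T_sw j) F (merge L v v') = app (right_T_sw j) (\<lambda>u. F (merge L u v')) v"
    by (simp add: right_T_sw.rep_eq before_merge[OF a(1) n] set_merge[OF a(1)])
next
  fix F G :: "slist \<Rightarrow> hc_field" and v
  assume a: "\<forall>v\<in>signed_words J. F v = G v" "v \<in> signed_words J"
  then show "app (right_T_sw j) F v = app (right_T_sw j) G v"
    using sub2_W[OF a(2) assms(1,2)] by (simp add: right_T_sw.rep_eq)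
qed

section \<open>Diagonal coefficients of Coxeter elements on labellings\<close>

definition count_val :: "bool \<Rightarrow> bool list \<Rightarrow> nat" where
  "count_val b L = length (filter (\<lambda>x. x = b) L)"

lemma count_val_simps [simp]: "count_val b [] = 0" "count_val b (a # L) = (if a = b then Suc (count_val b L) else count_val b L)"
  "count_val b (L @ L') = count_val b L + count_val b L'"
  by (simp_all add: count_val_def)

text \<open>\<open>True\<close> marks the smaller labels. The pair \<open>True, False\<close> is
  then an ascent, whose single term exchanges the entries, so its diagonal part is 0; the pair
  \<open>False, True\<close> is a descent with diagonal part \<open>q - 1\<close>.\<close>

fun block_coeff :: "bool list \<Rightarrow> hc_field" where
  "block_coeff (a # b # L) = (if a = b then 1 else if a then 0 else q - 1) * block_coeff (b # L)"
| "block_coeff L = 1"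

fun label_coeff :: "nat list \<Rightarrow> bool list \<Rightarrow> hc_field" where
  "label_coeff [] L = 1"
| "label_coeff (m # \<mu>) L = block_coeff (take m L) * label_coeff \<mu> (drop m L)"

fun label_counts :: "bool \<Rightarrow> nat list \<Rightarrow> bool list \<Rightarrow> nat list" where
  "label_counts b [] L = []"
| "label_counts b (m # \<mu>) L = count_val b (take m L) # label_counts b \<mu> (drop m L)"

lemma block_coeff_True: "block_coeff (True # L) \<noteq> 0 \<Longrightarrow> count_val False L = 0"
proof (induction L)
  case (Cons b L)
  then show ?case by (cases b) auto
qed simp

text \<open>A step that exchanges differently labelled neighbours changes the label of an entry that the
  remaining steps do not touch. Hence only the diagonal terms survive on a function supported on one
  labelling.\<close>

lemma left_coxeter_diag:
  fixes F :: "slist \<Rightarrow> hc_field"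
  assumes "length w = sum_list \<mu>" "\<And>x y. x \<in> set w \<Longrightarrow> y \<in> set w \<Longrightarrow> P x \<Longrightarrow> \<not> P y \<Longrightarrow> fst x < fst y"
  shows "left_coxeter \<mu> (\<lambda>v. if map P v = map P w then F1 (filter P v) * F2 (filter (\<lambda>x. \<not> P x) v) else 0) w =
    label_coeff \<mu> (map P w) * left_coxeter (label_counts True \<mu> (map P w)) F1 (filter P w) * left_coxeter (label_counts False \<mu> (map P w)) F2 (filter (\<lambda>x. \<not> P x) w)"
  using assms
proof (induction \<mu> F w arbitrary: F1 F2 rule: left_coxeter.induct)
  case (3 \<mu> F x w)
  have len: "length w = sum_list \<mu>" using 3 by simp
  show ?case
  proof (cases "P x")
    case True
    then show ?thesis using 3(1)[OF len, of "\<lambda>v. F1 (x # v)" F2] 3(3) by (simp cong: if_cong)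
  next
    case False
    then show ?thesis using 3(1)[OF len, of F1 "\<lambda>v. F2 (x # v)"] 3(3) by (simp cong: if_cong)
  qed
next
  case (4 m \<mu> F x y w)
  let ?L = "map P w" and ?w1 = "filter P w" and ?w2 = "filter (\<lambda>x. \<not> P x) w"
  have len: "length (x # w) = sum_list (Suc m # \<mu>)" "length (y # w) = sum_list (Suc m # \<mu>)" using 4 by simp_all
  have IHx: "left_coxeter (Suc m # \<mu>) (\<lambda>v. if map P v = map P (x # w) then G1 (filter P v) * G2 (filter (\<lambda>x. \<not> P x) v) else 0) (x # w) =
    label_coeff (Suc m # \<mu>) (map P (x # w)) * left_coxeter (label_counts True (Suc m # \<mu>) (map P (x # w))) G1 (filter P (x # w)) *
      left_coxeter (label_counts False (Suc m # \<mu>) (map P (x # w))) G2 (filter (\<lambda>x. \<not> P x) (x # w))" for G1 G2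
  proof (cases "fst x < fst y")
    case True
    then show ?thesis by (rule 4(1)) (use 4(5) len in auto)
  next
    case False
    then show ?thesis by (rule 4(2)) (use 4(5) len in auto)
  qed
  have IHy: "left_coxeter (Suc m # \<mu>) (\<lambda>v. if map P v = map P (y # w) then G1 (filter P v) * G2 (filter (\<lambda>x. \<not> P x) v) else 0) (y # w) =
    label_coeff (Suc m # \<mu>) (map P (y # w)) * left_coxeter (label_counts True (Suc m # \<mu>) (map P (y # w))) G1 (filter P (y # w)) *
      left_coxeter (label_counts False (Suc m # \<mu>) (map P (y # w))) G2 (filter (\<lambda>x. \<not> P x) (y # w))" if "\<not> fst x < fst y" for G1 G2
    using that by (rule 4(3)) (use 4(5) len in auto)
  consider "P x" "P y" | "\<not> P x" "\<not> P y" | "P x" "\<not> P y" | "\<not> P x" "P y" by blast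
  then show ?case
  proof cases
    case 1
    then show ?thesis using IHx[of "\<lambda>v. F1 (y # v)" F2] IHy[of "\<lambda>v. F1 (x # v)" F2]
      by (cases "fst x < fst y") (simp_all cong: if_cong add: algebra_simps)
  next
    case 2
    then show ?thesis using IHx[of F1 "\<lambda>v. F2 (y # v)"] IHy[of F1 "\<lambda>v. F2 (x # v)"]
      by (cases "fst x < fst y") (simp_all cong: if_cong add: algebra_simps)
  next
    case 3
    then have "fst x < fst y" using 4(5) by simp
    then show ?thesis using 3 by simp
  next
    case d: 4
    then have lt: "\<not> fst x < fst y" using 4(5)[of y x] d by auto
    \<comment> \<open>The rest of the block begins with \<open>True\<close>, so it contributes only
      if it contains no \<open>False\<close>. In that case \<open>x\<close> is alone in its block of
      the second factor.\<close>
    have "block_coeff (True # take m ?L) = 0 \<or> count_val False (take m ?L) = 0" using block_coeff_True[of "take m ?L"] by (cases "block_coeff (True # take m ?L) = 0") simp_all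
    then show ?thesis
      using lt d IHy[OF lt, of F1 "\<lambda>v. F2 (x # v)"] by (auto cong: if_cong)
  qed
qed (simp_all)

fun split_sum_q :: "nat list \<Rightarrow> (nat list \<Rightarrow> nat list \<Rightarrow> hc_field) \<Rightarrow> hc_field" where
  "split_sum_q [] G = G [] []"
| "split_sum_q (m # \<mu>) G = (\<Sum>i\<le>m. (if 0 < i \<and> i < m then q - 1 else 1) * split_sum_q \<mu> (\<lambda>\<kappa> \<kappa>'. G (i # \<kappa>) ((m - i) # \<kappa>')))"

lemma sum_lists_Suc:
  "(\<Sum>L | length L = Suc m. f L) = (\<Sum>L | length L = m. f (True # L)) + (\<Sum>L | length L = m. f (False # L))"
  for f :: "bool list \<Rightarrow> 'a::comm_monoid_add"
proof -
  have fin: "finite {L :: bool list. length L = m}" using finite_lists_length_eq[of "UNIV :: bool set"] by simp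
  have e: "{L :: bool list. length L = Suc m} = (#) True ` {L. length L = m} \<union> (#) False ` {L. length L = m}"
    by (auto simp: length_Suc_conv)
  show ?thesis unfolding e
    by (subst sum.union_disjoint) (use fin in \<open>auto simp: sum.reindex\<close>)
qed

lemma sum_block_coeff:
  fixes g :: "nat \<Rightarrow> nat \<Rightarrow> hc_field"
  shows "(\<Sum>L | length L = m. block_coeff (True # L) * g (count_val True L) (count_val False L)) = g m 0"
    "(\<Sum>L | length L = m. block_coeff (False # L) * g (count_val True L) (count_val False L)) = (\<Sum>i\<le>m. (if 0 < i then q - 1 else 1) * g i (m - i))"
proof -
  show T: "(\<Sum>L | length L = m. block_coeff (True # L) * g (count_val True L) (count_val False L)) = g m 0" for m g
  proof (induction m arbitrary: g)
    case (Suc m)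
    show ?case unfolding sum_lists_Suc using Suc[of "\<lambda>i. g (Suc i)"] by simp
  qed simp
  show "(\<Sum>L | length L = m. block_coeff (False # L) * g (count_val True L) (count_val False L)) = (\<Sum>i\<le>m. (if 0 < i then q - 1 else 1) * g i (m - i))" for m
  proof (induction m arbitrary: g)
    case (Suc m)
    have "(\<Sum>L | length L = Suc m. block_coeff (False # L) * g (count_val True L) (count_val False L))
      = (q - 1) * g (Suc m) 0 + (\<Sum>i\<le>m. (if 0 < i then q - 1 else 1) * g i (Suc (m - i)))"
      unfolding sum_lists_Suc using Suc[of "\<lambda>i j. g i (Suc j)"] T[where m = m and g = "\<lambda>i. g (Suc i)"]
      by (simp add: sum_distrib_left[symmetric] mult.assoc)
    also have "(\<Sum>i\<le>m. (if 0 < i then q - 1 else 1) * g i (Suc (m - i))) = (\<Sum>i\<le>m. (if 0 < i then q - 1 else 1) * g i (Suc m - i))"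
      by (rule sum.cong) (auto simp: Suc_diff_le)
    finally show ?case by (simp add: add.commute)
  qed simp
qed

text \<open>The labellings with nonzero coefficient have the form
  \<open>False ... False True ... True\<close>, one for each number of \<open>True\<close> entries;
  the single change of label, if there is one, gives \<open>q - 1\<close>.\<close>

lemma sum_block:
  fixes g :: "nat \<Rightarrow> nat \<Rightarrow> hc_field"
  shows "(\<Sum>L | length L = m. block_coeff L * g (count_val True L) (count_val False L)) = (\<Sum>i\<le>m. (if 0 < i \<and> i < m then q - 1 else 1) * g i (m - i))"
proof (cases m)
  case (Suc k)
  have "(\<Sum>L | length L = m. block_coeff L * g (count_val True L) (count_val False L))
    = g m 0 + (\<Sum>i\<le>k. (if 0 < i then q - 1 else 1) * g i (Suc (k - i)))"
    unfolding Suc sum_lists_Suc using sum_block_coeff(1)[where m = k and g = "\<lambda>i. g (Suc i)"] sum_block_coeff(2)[where m = k and g = "\<lambda>i j. g i (Suc j)"]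
    by simp
  also have "(\<Sum>i\<le>k. (if 0 < i then q - 1 else 1) * g i (Suc (k - i))) = (\<Sum>i\<le>k. (if 0 < i \<and> i < m then q - 1 else 1) * g i (m - i))"
    by (rule sum.cong) (auto simp: Suc Suc_diff_le)
  finally show ?thesis by (simp add: Suc add.commute)
qed simp

lemma sum_lists_append:
  fixes f :: "bool list \<Rightarrow> 'a::comm_monoid_add"
  shows "(\<Sum>L | length L = m + n. f L) = (\<Sum>L | length L = m. \<Sum>L' | length L' = n. f (L @ L'))"
  by (induction m arbitrary: f) (simp_all add: sum_lists_Suc)

lemma sum_label_coeff:
  fixes G :: "nat list \<Rightarrow> nat list \<Rightarrow> hc_field"
  shows "(\<Sum>L | length L = sum_list \<mu>. label_coeff \<mu> L * G (label_counts True \<mu> L) (label_counts False \<mu> L)) = split_sum_q \<mu> G"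
proof (induction \<mu> arbitrary: G)
  case (Cons m \<mu>)
  have "(\<Sum>L | length L = sum_list (m # \<mu>). label_coeff (m # \<mu>) L * G (label_counts True (m # \<mu>) L) (label_counts False (m # \<mu>) L))
    = (\<Sum>L | length L = m. block_coeff L * (\<Sum>L' | length L' = sum_list \<mu>. label_coeff \<mu> L' * G (count_val True L # label_counts True \<mu> L') (count_val False L # label_counts False \<mu> L')))"
    by (simp add: sum_lists_append sum_distrib_left mult.assoc)
  also have "\<dots> = (\<Sum>L | length L = m. block_coeff L * split_sum_q \<mu> (\<lambda>\<kappa> \<kappa>'. G (count_val True L # \<kappa>) (count_val False L # \<kappa>')))"
    using Cons[of "\<lambda>\<kappa> \<kappa>'. G (count_val True L # \<kappa>) (count_val False L # \<kappa>')" for L] by simp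
  also have "\<dots> = split_sum_q (m # \<mu>) G"
    using sum_block[where m = m and g = "\<lambda>i j. split_sum_q \<mu> (\<lambda>\<kappa> \<kappa>'. G (i # \<kappa>) (j # \<kappa>'))"] by simp
  finally show ?case .
qed simp

text \<open>The value 0 for compositions of the wrong size lets later sums run over all labellings
  and all splittings without a size condition.\<close>

definition trace_sw :: "nat set \<Rightarrow> nat list \<Rightarrow> slist linop \<Rightarrow> hc_field" where
  "trace_sw J \<mu> R = (if sum_list \<mu> = card J then \<Sum>w\<in>signed_words J. left_coxeter \<mu> (app R (delta w)) w else 0)"

lemma sum_label_counts: "length L = sum_list \<mu> \<Longrightarrow> sum_list (label_counts b \<mu> L) = count_val b L"
proof (induction \<mu> arbitrary: L)
  case (Cons m \<mu>)
  then have "sum_list (label_counts b \<mu> (drop m L)) = count_val b (drop m L)" by simp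
  then show ?case using count_val_simps(3)[of b "take m L" "drop m L"] by simp
qed simp

lemma signed_words_filter:
  assumes "w \<in> signed_words (J \<union> K)" "J \<inter> K = {}"
  shows "filter (\<lambda>x. fst x \<in> J) w \<in> signed_words J" "filter (\<lambda>x. fst x \<notin> J) w \<in> signed_words K"
proof -
  have e: "fst ` {x \<in> S. Q (fst x)} = {y \<in> fst ` S. Q y}" for S :: "site set" and Q by auto
  show "filter (\<lambda>x. fst x \<in> J) w \<in> signed_words J" "filter (\<lambda>x. fst x \<notin> J) w \<in> signed_words K"
    using assms e[of "set w" "\<lambda>y. y \<in> J"] e[of "set w" "\<lambda>y. y \<notin> J"]
    by (auto simp: signed_words_def intro!: distinct_map_filter)
qed

lemma bij_merge:
  assumes "J \<inter> K = {}" "finite J" "finite K"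
  shows "bij_betw (\<lambda>(L, v, v'). merge L v v')
    ({L. count_val True L = card J \<and> count_val False L = card K} \<times> signed_words J \<times> signed_words K) (signed_words (J \<union> K))"
proof (rule bij_betw_byWitness[where f' = "\<lambda>w. (map (\<lambda>x. fst x \<in> J) w, filter (\<lambda>x. fst x \<in> J) w, filter (\<lambda>x. fst x \<notin> J) w)"])
  have sh: "shape L v v'" if "count_val True L = card J" "count_val False L = card K" "v \<in> signed_words J" "v' \<in> signed_words K" for L v v'
    using that by (simp add: shape_def signed_words_length count_val_def)
  have in1: "fst x \<in> J" if "v \<in> signed_words J" "x \<in> set v" for v x using that by (auto simp: signed_words_def)
  have in2: "fst x \<notin> J" if "v \<in> signed_words K" "x \<in> set v" for v x using that assms by (auto simp: signed_words_def)
  show "\<forall>a\<in>{L. count_val True L = card J \<and> count_val False L = card K} \<times> signed_words J \<times> signed_words K.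
      (\<lambda>w. (map (\<lambda>x. fst x \<in> J) w, filter (\<lambda>x. fst x \<in> J) w, filter (\<lambda>x. fst x \<notin> J) w))
        ((\<lambda>(L, v, v'). merge L v v') a) = a"
    using filter_merge[OF sh, where P = "\<lambda>x. fst x \<in> J"] in1 in2 by auto
  show "\<forall>w\<in>signed_words (J \<union> K). (\<lambda>(L, v, v'). merge L v v') (map (\<lambda>x. fst x \<in> J) w, filter (\<lambda>x. fst x \<in> J) w, filter (\<lambda>x. fst x \<notin> J) w) = w"
    by (simp add: merge_filter)
  show "(\<lambda>(L, v, v'). merge L v v') ` ({L. count_val True L = card J \<and> count_val False L = card K} \<times> signed_words J \<times> signed_words K) \<subseteq> signed_words (J \<union> K)"
  proof clarify
    fix L v v' assume a: "count_val True L = card J" "count_val False L = card K" "v \<in> signed_words J" "v' \<in> signed_words K"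
    note s = sh[OF a]
    show "merge L v v' \<in> signed_words (J \<union> K)"
      using a assms(1) unfolding signed_words_def map_merge[OF s]
      by (auto simp: map_merge[OF s] distinct_merge[of L "map fst v" "map fst v'"] s set_merge[OF s] image_Un)
  qed
  show "(\<lambda>w. (map (\<lambda>x. fst x \<in> J) w, filter (\<lambda>x. fst x \<in> J) w, filter (\<lambda>x. fst x \<notin> J) w)) ` signed_words (J \<union> K)
      \<subseteq> {L. count_val True L = card J \<and> count_val False L = card K} \<times> signed_words J \<times> signed_words K"
  proof (rule image_subsetI)
    fix w assume w: "w \<in> signed_words (J \<union> K)"
    note 1 = signed_words_filter(1)[OF w assms(1)] and 2 = signed_words_filter(2)[OF w assms(1)]
    show "(map (\<lambda>x. fst x \<in> J) w, filter (\<lambda>x. fst x \<in> J) w, filter (\<lambda>x. fst x \<notin> J) w)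
      \<in> {L. count_val True L = card J \<and> count_val False L = card K} \<times> signed_words J \<times> signed_words K"
      using 1 2 signed_words_length[OF 1] signed_words_length[OF 2] by (simp add: count_val_def filter_map comp_def)
  qed
qed

text \<open>\<open>R\<close> and \<open>R'\<close> act on different subwords and neither moves an
  entry to another position. So the labelling is preserved and the matrix coefficient
  factors.\<close>

lemma merge_kernel:
  assumes R: "slicing J K R" "slicing K J R'" and JK: "J \<inter> K = {}"
    and v: "v \<in> signed_words J" "u \<in> signed_words J" and v': "v' \<in> signed_words K" "u' \<in> signed_words K" and s: "shape L v v'" "shape M u u'"
  shows "app (R * R') (delta (merge L v v')) (merge M u u') = (if L = M then app R (delta v) u * app R' (delta v') u' else 0)"
proof -
  have sM: "shape M x x'" if "x \<in> signed_words J" "x' \<in> signed_words K" for x x'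
    using that s v v' by (simp add: shape_def signed_words_length)
  have dlm: "delta (merge L v v') (merge M x x') = (if L = M then delta v' x' else 0) * delta v x" if "x \<in> signed_words J" "x' \<in> signed_words K" for x x'
  proof -
    have "\<forall>y\<in>set z. fst y \<in> J" if "z \<in> signed_words J" for z using that by (auto simp: signed_words_def)
    moreover have "\<forall>y\<in>set z. fst y \<notin> J" if "z \<in> signed_words K" for z using that JK by (auto simp: signed_words_def)
    ultimately have "merge M x x' = merge L v v' \<longleftrightarrow> M = L \<and> x = v \<and> x' = v'"
      using filter_merge[OF s(1), of "\<lambda>x. fst x \<in> J"] filter_merge[OF sM[OF that], of "\<lambda>x. fst x \<in> J"] v v' that
      by metis
    then show ?thesis by (auto simp: delta_def)
  qed
  have "app (R * R') (delta (merge L v v')) (merge M u u') = app R' (\<lambda>x'. app R (delta (merge L v v')) (merge M u x')) u'"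
    using slicingD2[OF R(2) s(2) v(2) v'(2)] by simp
  also have "\<dots> = app R' (\<lambda>x'. (if L = M then app R (delta v) u else 0) * delta v' x') u'"
  proof (rule slicing_local[OF R(2) _ v'(2)])
    fix x' assume x': "x' \<in> signed_words K"
    have "app R (delta (merge L v v')) (merge M u x') = app R (\<lambda>x. delta (merge L v v') (merge M x x')) u"
      by (rule slicingD[OF R(1) sM v(2) x']) (use v x' in auto)
    also have "\<dots> = app R (\<lambda>x. (if L = M then delta v' x' else 0) * delta v x) u"
      by (rule slicing_local[OF R(1) _ v(2)]) (simp add: dlm x')
    finally show "app R (delta (merge L v v')) (merge M u x') = (if L = M then app R (delta v) u else 0) * delta v' x'"
      unfolding app_scale by (simp add: mult.commute)
  qed
  finally show ?thesis unfolding app_scale by simp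
qed

text \<open>Restriction to a parabolic subalgebra: \<open>H\<close> is the direct sum of the double cosets, and on each of them
  left multiplication by \<open>T\<^sub>\<gamma>\<close> has diagonal part a product of smaller Coxeter elements.\<close>

lemma trace_sw_mackey:
  assumes R: "slicing J K R" "slicing K J R'" and JK: "\<And>x y. x \<in> J \<Longrightarrow> y \<in> K \<Longrightarrow> x < y"
    and fin: "finite J" "finite K" and sum: "sum_list \<mu> = card J + card K"
  shows "trace_sw (J \<union> K) \<mu> (R * R') = split_sum_q \<mu> (\<lambda>\<kappa> \<kappa>'. trace_sw J \<kappa> R * trace_sw K \<kappa>' R')"
proof -
  have dis: "J \<inter> K = {}" using JK by fastforce
  let ?\<L> = "{L. count_val True L = card J \<and> count_val False L = card K}"
  have cl: "count_val True L + count_val False L = length L" for L by (induction L) auto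
  have \<L>: "?\<L> \<subseteq> {L. length L = sum_list \<mu>}" using sum cl by (auto simp flip: cl)
  have term_eq: "left_coxeter \<mu> (app (R * R') (delta (merge L v v'))) (merge L v v') =
      label_coeff \<mu> L * left_coxeter (label_counts True \<mu> L) (app R (delta v)) v * left_coxeter (label_counts False \<mu> L) (app R' (delta v')) v'"
    if a: "L \<in> ?\<L>" "v \<in> signed_words J" "v' \<in> signed_words K" for L v v'
  proof -
    let ?P = "\<lambda>x :: site. fst x \<in> J" and ?w = "merge L v v'"
    have s: "shape L v v'" using a by (simp add: shape_def signed_words_length count_val_def)
    have inJ: "\<forall>x\<in>set v. ?P x" "\<forall>x\<in>set v'. \<not> ?P x" using a dis by (auto simp: signed_words_def)
    note f = filter_merge[OF s inJ]
    have w: "?w \<in> signed_words (J \<union> K)" using bij_betw_apply[OF bij_merge[OF dis fin], of "(L, v, v')"] a by simp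
    have "left_coxeter \<mu> (app (R * R') (delta ?w)) ?w = left_coxeter \<mu> (\<lambda>u. if map ?P u = map ?P ?w
        then app R (delta v) (filter ?P u) * app R' (delta v') (filter (\<lambda>x. \<not> ?P x) u) else 0) ?w"
    \<comment> \<open>Only rearrangements of the word matter; these are again words on
      \<open>J \<union> K\<close>, where the factorised kernel is available.\<close>
    proof (rule left_coxeter_cong)
      fix u assume "mset u = mset ?w"
      then have m: "mset (map fst u) = mset (map fst ?w)" and set: "set u = set ?w"
        unfolding mset_map by (metis, metis mset_eq_setD)
      from mset_eq_imp_distinct_iff[OF m] have u: "u \<in> signed_words (J \<union> K)"
        using w unfolding signed_words_def mem_Collect_eq set by metis
      have "filter ?P u \<in> signed_words J" "filter (\<lambda>x. \<not> ?P x) u \<in> signed_words K"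
        by (rule signed_words_filter[OF u dis])+
      then have "app (R * R') (delta ?w) (merge (map ?P u) (filter ?P u) (filter (\<lambda>x. \<not> ?P x) u)) =
        (if L = map ?P u then app R (delta v) (filter ?P u) * app R' (delta v') (filter (\<lambda>x. \<not> ?P x) u) else 0)"
        using a by (intro merge_kernel[OF R dis] s shape_filter)
      then show "app (R * R') (delta ?w) u = (if map ?P u = map ?P ?w
        then app R (delta v) (filter ?P u) * app R' (delta v') (filter (\<lambda>x. \<not> ?P x) u) else 0)"
        unfolding f merge_filter by auto
    qed
    also have "\<dots> = label_coeff \<mu> (map ?P ?w) * left_coxeter (label_counts True \<mu> (map ?P ?w)) (app R (delta v)) (filter ?P ?w) *
        left_coxeter (label_counts False \<mu> (map ?P ?w)) (app R' (delta v')) (filter (\<lambda>x. \<not> ?P x) ?w)"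
    proof (rule left_coxeter_diag)
      show "length ?w = sum_list \<mu>"
        using signed_words_length[OF w] sum fin dis by (simp add: card_Un_disjoint)
      fix x y assume "x \<in> set ?w" "y \<in> set ?w" "fst x \<in> J" "fst y \<notin> J"
      then show "fst x < fst y" using w by (intro JK) (auto simp: signed_words_def)
    qed
    finally show ?thesis unfolding f .
  qed
  have "trace_sw (J \<union> K) \<mu> (R * R') = (\<Sum>w\<in>signed_words (J \<union> K). left_coxeter \<mu> (app (R * R') (delta w)) w)"
    using sum fin dis by (simp add: trace_sw_def card_Un_disjoint)
  also have "\<dots> = (\<Sum>(L, v, v')\<in>?\<L> \<times> signed_words J \<times> signed_words K. label_coeff \<mu> L * left_coxeter (label_counts True \<mu> L) (app R (delta v)) v * left_coxeter (label_counts False \<mu> L) (app R' (delta v')) v')"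
    by (subst sum.reindex_bij_betw[OF bij_merge[OF dis fin], symmetric])
      (auto intro!: sum.cong simp: term_eq simp del: app_times)
  also have "\<dots> = (\<Sum>L\<in>?\<L>. label_coeff \<mu> L * ((\<Sum>v\<in>signed_words J. left_coxeter (label_counts True \<mu> L) (app R (delta v)) v) * (\<Sum>v'\<in>signed_words K. left_coxeter (label_counts False \<mu> L) (app R' (delta v')) v')))"
    unfolding sum_product unfolding sum_distrib_left sum.cartesian_product[symmetric] mult.assoc ..
  also have "\<dots> = (\<Sum>L\<in>?\<L>. label_coeff \<mu> L * (trace_sw J (label_counts True \<mu> L) R * trace_sw K (label_counts False \<mu> L) R'))"
    by (rule sum.cong) (use \<L> in \<open>auto simp: trace_sw_def sum_label_counts\<close>)
  \<comment> \<open>Labellings with other counts contribute 0 by the convention in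
    \<open>trace_sw\<close>.\<close>
  also have "\<dots> = (\<Sum>L | length L = sum_list \<mu>. label_coeff \<mu> L * (trace_sw J (label_counts True \<mu> L) R * trace_sw K (label_counts False \<mu> L) R'))"
    by (rule sum.mono_neutral_left)
      (use \<L> finite_lists_length_eq[of "UNIV :: bool set"] in \<open>auto simp: trace_sw_def sum_label_counts\<close>)
  also have "\<dots> = split_sum_q \<mu> (\<lambda>\<kappa> \<kappa>'. trace_sw J \<kappa> R * trace_sw K \<kappa>' R')"
    by (rule sum_label_coeff)
  finally show ?thesis .
qed

section \<open>Normalised traces and sums over splittings\<close>

fun split_sum :: "nat list \<Rightarrow> (nat list \<Rightarrow> nat list \<Rightarrow> 'a::comm_monoid_add) \<Rightarrow> 'a" where
  "split_sum [] G = G [] []"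
| "split_sum (m # \<mu>) G = (\<Sum>i\<le>m. split_sum \<mu> (\<lambda>\<kappa> \<kappa>'. G (i # \<kappa>) ((m - i) # \<kappa>')))"

definition norm_factor :: "nat list \<Rightarrow> hc_field" where
  "norm_factor \<mu> = (\<Prod>m\<leftarrow>\<mu>. if m = 0 then 1 else q - 1)"

lemma split_sum_mult: "split_sum \<mu> (\<lambda>\<kappa> \<kappa>'. a * G \<kappa> \<kappa>') = a * split_sum \<mu> G" for a :: "'a::comm_semiring_0"
  by (induction \<mu> arbitrary: G) (simp_all add: sum_distrib_left)

text \<open>Part by part: a part that is really divided has its own \<open>q - 1\<close> and the
  weight \<open>q - 1\<close> on the left, matching its two nonzero pieces on the right; an
  undivided nonzero part has one factor on either side.\<close>

lemma norm_factor_wsum: "norm_factor \<mu> * split_sum_q \<mu> G = split_sum \<mu> (\<lambda>\<kappa> \<kappa>'. norm_factor \<kappa> * norm_factor \<kappa>' * G \<kappa> \<kappa>')"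
proof (induction \<mu> arbitrary: G)
  case (Cons m \<mu>)
  let ?e = "\<lambda>m :: nat. if m = 0 then 1 else q - 1"
  have "norm_factor (m # \<mu>) * split_sum_q (m # \<mu>) G = (\<Sum>i\<le>m. (?e m * (if 0 < i \<and> i < m then q - 1 else 1)) *
      (norm_factor \<mu> * split_sum_q \<mu> (\<lambda>\<kappa> \<kappa>'. G (i # \<kappa>) ((m - i) # \<kappa>'))))"
    by (simp add: norm_factor_def sum_distrib_left mult_ac)
  also have "\<dots> = (\<Sum>i\<le>m. (?e i * ?e (m - i)) * split_sum \<mu> (\<lambda>\<kappa> \<kappa>'. norm_factor \<kappa> * norm_factor \<kappa>' * G (i # \<kappa>) ((m - i) # \<kappa>')))"
    unfolding Cons by (rule sum.cong) (auto split: if_splits)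
  also have "\<dots> = split_sum (m # \<mu>) (\<lambda>\<kappa> \<kappa>'. norm_factor \<kappa> * norm_factor \<kappa>' * G \<kappa> \<kappa>')"
    unfolding split_sum.simps split_sum_mult[symmetric] by (simp add: norm_factor_def mult_ac cong: if_cong)
  finally show ?case .
qed (simp add: norm_factor_def)

definition trace_norm :: "nat set \<Rightarrow> nat list \<Rightarrow> slist linop \<Rightarrow> hc_field" where
  "trace_norm J \<mu> R = norm_factor \<mu> * trace_sw J \<mu> R"

lemma trace_norm_mackey:
  assumes "slicing J K R" "slicing K J R'" "\<And>x y. x \<in> J \<Longrightarrow> y \<in> K \<Longrightarrow> x < y"
    "finite J" "finite K" "sum_list \<mu> = card J + card K"
  shows "trace_norm (J \<union> K) \<mu> (R * R') = split_sum \<mu> (\<lambda>\<kappa> \<kappa>'. trace_norm J \<kappa> R * trace_norm K \<kappa>' R')"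
proof -
  have "trace_sw (J \<union> K) \<mu> (R * R') = split_sum_q \<mu> (\<lambda>\<kappa> \<kappa>'. trace_sw J \<kappa> R * trace_sw K \<kappa>' R')"
    using assms by (rule trace_sw_mackey)
  then show ?thesis unfolding trace_norm_def by (simp add: norm_factor_wsum mult_ac)
qed

section \<open>The dictionary between basis states and signed words\<close>

definition signed_word :: "nat \<Rightarrow> (nat \<Rightarrow> nat) \<times> nat set \<Rightarrow> slist" where
  "signed_word n = (\<lambda>(\<sigma>, I). map (\<lambda>k. (inv_fun \<sigma> k, inv_fun \<sigma> k \<in> I)) [1..<Suc n])"

lemma length_signed_word [simp]: "length (signed_word n c) = n"
  by (cases c) (simp add: signed_word_def)

lemma nth_signed_word: "k < n \<Longrightarrow> signed_word n (\<sigma>, I) ! k = (inv_fun \<sigma> (Suc k), inv_fun \<sigma> (Suc k) \<in> I)"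
  by (simp add: signed_word_def Suc_eq_plus1_left del: upt_Suc)

lemma inv_fun_permutes_iff:
  assumes "\<sigma> permutes S"
  shows "inv_fun \<sigma> k = j \<longleftrightarrow> k = \<sigma> j"
  using assms permutes_bij bij_inv_eq_iff by (metis)

lemma before_map:
  assumes "sorted_wrt (<) xs" "inj_on (\<lambda>k. fst (e k)) (set xs)" "p \<in> set xs" "r \<in> set xs" "p \<noteq> r"
  shows "before (map e xs) (fst (e p)) (fst (e r)) \<longleftrightarrow> p < (r :: nat)"
  using assms
proof (induction xs)
  case (Cons z xs)
  have "fst (e p) \<noteq> fst (e r)" using Cons.prems by (metis inj_onD)
  moreover have "fst (e z) = fst (e k) \<longleftrightarrow> z = k" if "k \<in> set (z # xs)" for k
    using Cons.prems(2) that by (metis inj_onD list.set_intros(1))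
  ultimately show ?case using Cons by (auto simp: inj_on_def)
qed simp

lemma before_signed_word:
  assumes "\<sigma> permutes {1..n}" "j \<in> {1..n}" "k \<in> {1..n}" "j \<noteq> k"
  shows "before (signed_word n (\<sigma>, I)) j k \<longleftrightarrow> \<sigma> j < \<sigma> k"
proof -
  have im: "\<sigma> j \<in> set [1..<Suc n]" "\<sigma> k \<in> set [1..<Suc n]"
    using permutes_in_image[OF assms(1), of j] permutes_in_image[OF assms(1), of k] assms
    by (auto simp: less_Suc_eq_le)
  have inj: "inj (inv_fun \<sigma>)" using permutes_inv[OF assms(1)] permutes_inj by blast
  have ne: "\<sigma> j \<noteq> \<sigma> k" using assms permutes_inj by (metis injD)
  have iv: "inv_fun \<sigma> (\<sigma> x) = x" for x using inv_fun_permutes_iff[OF assms(1)] by simp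
  have "inj_on (\<lambda>k. fst (inv_fun \<sigma> k, inv_fun \<sigma> k \<in> I)) (set [1..<Suc n])"
    using inj_on_subset[OF inj subset_UNIV] by simp
  from before_map[OF _ this im ne] show ?thesis unfolding fst_conv iv signed_word_def prod.case by simp
qed

lemma mem_signed_word:
  assumes "\<sigma> permutes {1..n}" "j \<in> {1..n}"
  shows "(j, b) \<in> set (signed_word n (\<sigma>, I)) \<longleftrightarrow> b = (j \<in> I)"
proof -
  have "\<sigma> j \<in> {1..n}" using permutes_in_image[OF assms(1)] assms by simp
  moreover have "(j, b) \<in> set (signed_word n (\<sigma>, I)) \<longleftrightarrow> (\<exists>k\<in>{1..n}. inv_fun \<sigma> k = j \<and> b = (j \<in> I))"
    by (auto simp: signed_word_def less_Suc_eq_le)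
  ultimately show ?thesis unfolding inv_fun_permutes_iff[OF assms(1)] by blast
qed

definition set_sites_index :: "nat \<Rightarrow> (nat \<Rightarrow> nat) \<times> nat set \<Rightarrow> bool \<Rightarrow> bool \<Rightarrow> bool \<Rightarrow> (nat \<Rightarrow> nat) \<times> nat set" where
  "set_sites_index j c s a b = (if s then fst c \<circ> transpose j (Suc j) else fst c,
     {k. if k = j then a else if k = Suc j then b else k \<in> snd c})"

lemma state_of_updc: "state_of (set_sites_index j c s a b) = set_sites j (state_of c) s a b"
  by (cases c) (auto simp: state_of_def set_sites_index_def set_sites_def fun_eq_iff transpose_def)

lemma set_sites_index_index:
  assumes "c \<in> basis_index n" "1 \<le> j" "j < n"
  shows "set_sites_index j c s a b \<in> basis_index n"
proof -
  have "fst c \<circ> transpose j (Suc j) permutes {1..n}"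
    using assms by (intro permutes_compose[OF permutes_swap_id]) (auto simp: basis_index_def)
  then show ?thesis using assms by (auto simp: basis_index_def set_sites_index_def split: if_splits)
qed

lemma signed_word_updc:
  assumes "c \<in> basis_index n" "1 \<le> j" "j < n"
  shows "signed_word n (set_sites_index j c s a b) = sub2 j s a b (signed_word n c)"
proof -
  obtain \<sigma> I where c: "c = (\<sigma>, I)" "\<sigma> permutes {1..n}" using assms by (auto simp: basis_index_def)
  have "inv_fun (\<sigma> \<circ> transpose j (Suc j)) k = transpose j (Suc j) (inv_fun \<sigma> k)" for k
    using inv_transpose[of \<sigma> j "Suc j"] permutes_bij[OF c(2)] by simp
  then show ?thesis by (auto simp: c signed_word_def sub2_def set_sites_index_def transpose_def)
qed

text \<open>Agreement is required only at basis elements, where the two pictures match; both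
  operators live on larger spaces of functions.\<close>

definition corresponds :: "nat \<Rightarrow> (((nat \<Rightarrow> site) \<Rightarrow> hc_field) \<Rightarrow> (nat \<Rightarrow> site) \<Rightarrow> hc_field) \<Rightarrow>
    ((slist \<Rightarrow> hc_field) \<Rightarrow> slist \<Rightarrow> hc_field) \<Rightarrow> bool" where
  "corresponds n R S \<longleftrightarrow> (\<forall>f F. (\<forall>c\<in>basis_index n. F (signed_word n c) = f (state_of c)) \<longrightarrow>
     (\<forall>c\<in>basis_index n. S F (signed_word n c) = R f (state_of c)))"

lemma corrD: "corresponds n R S \<Longrightarrow> (\<And>c. c \<in> basis_index n \<Longrightarrow> F (signed_word n c) = f (state_of c)) \<Longrightarrow>
   c \<in> basis_index n \<Longrightarrow> S F (signed_word n c) = R f (state_of c)"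
  by (simp add: corresponds_def)

lemma corresponds_one: "corresponds n (app 1) (app 1)"
  by (simp add: corresponds_def)

lemma corresponds_add:
  assumes "corresponds n (app R) (app S)" "corresponds n (app R') (app S')"
  shows "corresponds n (app (R + R')) (app (S + S'))"
  unfolding corresponds_def
proof (intro allI impI ballI)
  fix f and F :: "slist \<Rightarrow> hc_field" and c
  assume F: "\<forall>c\<in>basis_index n. F (signed_word n c) = f (state_of c)" and c: "c \<in> basis_index n"
  show "app (S + S') F (signed_word n c) = app (R + R') f (state_of c)"
    using corrD[OF assms(1) _ c, of F f] corrD[OF assms(2) _ c, of F f] F by simp
qed

lemma corresponds_mult:
  assumes "corresponds n (app R) (app S)" "corresponds n (app R') (app S')"
  shows "corresponds n (app (R * R')) (app (S * S'))"
  unfolding corresponds_def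
proof (intro allI impI ballI)
  fix f and F :: "slist \<Rightarrow> hc_field" and c
  assume F: "\<forall>c\<in>basis_index n. F (signed_word n c) = f (state_of c)" and c: "c \<in> basis_index n"
  have "app S F (signed_word n d) = app R f (state_of d)" if "d \<in> basis_index n" for d
    using corrD[OF assms(1) _ that, of F f] F by simp
  then show "app (S * S') F (signed_word n c) = app (R * R') f (state_of c)"
    using corrD[OF assms(2) _ c, of "app S F" "app R f"] by simp
qed

lemma corresponds_rT:
  assumes "1 \<le> j" "j < n"
  shows "corresponds n (app (right_T j)) (app (right_T_sw j))"
  unfolding corresponds_def
proof (intro allI impI ballI)
  fix f and F :: "slist \<Rightarrow> hc_field" and c
  assume f: "\<forall>c\<in>basis_index n. F (signed_word n c) = f (state_of c)" and c: "c \<in> basis_index n"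
  obtain \<sigma> I where c': "c = (\<sigma>, I)" "\<sigma> permutes {1..n}" using c by (auto simp: basis_index_def)
  have "F (sub2 j s a b (signed_word n c)) = f (set_sites j (state_of c) s a b)" for s a b
    using f set_sites_index_index[OF c assms] by (simp flip: signed_word_updc[OF c assms] state_of_updc)
  then show "app (right_T_sw j) F (signed_word n c) = app (right_T j) f (state_of c)"
    using assms unfolding right_T.rep_eq right_T_sw.rep_eq c'(1)
    by (simp add: before_signed_word[OF c'(2)] mem_signed_word[OF c'(2)]) (simp add: state_of_def)
qed

text \<open>List positions count from 0, so the generator with index \<open>i\<close> exchanges the
  positions \<open>i - 1\<close> and \<open>i\<close>.\<close>

definition swap_at :: "nat \<Rightarrow> 'a list \<Rightarrow> 'a list" where
  "swap_at i w = w[i - 1 := w ! i, i := w ! (i - 1)]"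

definition left_T_sw :: "nat \<Rightarrow> (slist \<Rightarrow> hc_field) \<Rightarrow> slist \<Rightarrow> hc_field" where
  "left_T_sw i F w = (if fst (w ! (i - 1)) < fst (w ! i) then q * F (swap_at i w) else F (swap_at i w) + (q - 1) * F w)"

text \<open>The inverse of \<open>s_i \<sigma>\<close> is the inverse of \<open>\<sigma>\<close>
  precomposed with \<open>s_i\<close>. Left multiplication therefore exchanges two adjacent
  positions, and \<open>left_ascent\<close> compares the labels found there.\<close>

lemma corresponds_lT:
  assumes "1 \<le> i" "i < n"
  shows "corresponds n (app (left_T i)) (left_T_sw i)"
  unfolding corresponds_def
proof (intro allI impI ballI)
  fix f and F :: "slist \<Rightarrow> hc_field" and c
  assume f: "\<forall>c\<in>basis_index n. F (signed_word n c) = f (state_of c)" and c: "c \<in> basis_index n"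
  obtain \<sigma> I where c': "c = (\<sigma>, I)" "\<sigma> permutes {1..n}" "I \<subseteq> {1..n}" using c by (auto simp: basis_index_def)
  have bij: "bij \<sigma>" using permutes_bij[OF c'(2)] .
  let ?c = "(transpose i (Suc i) \<circ> \<sigma>, I)"
  have t: "transpose i (Suc i) \<circ> \<sigma> permutes {1..n}"
    using assms by (intro permutes_compose[OF c'(2)] permutes_swap_id) auto
  have "inv_fun (transpose i (Suc i) \<circ> \<sigma>) k = inv_fun \<sigma> (transpose i (Suc i) k)" for k
    using inv_fun_permutes_iff[OF c'(2)] inv_fun_permutes_iff[OF t] by (metis comp_apply transpose_involutory)
  then have "signed_word n ?c = swap_at i (signed_word n c)"
    using assms by (auto simp: list_eq_iff_nth_eq nth_signed_word swap_at_def c'(1) nth_list_update transpose_def)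
  moreover have "state_of ?c = swap_values i (state_of c)" by (simp add: state_of_def swap_values_def c')
  ultimately have 1: "F (swap_at i (signed_word n c)) = f (swap_values i (state_of c))"
    using f t c' by (metis (no_types, lifting) basis_index_def mem_Collect_eq mem_Sigma_iff PowI)
  have fe: "(\<lambda>k. fst (state_of c k)) = \<sigma>" by (auto simp: state_of_def c')
  have "fst (signed_word n c ! (i - 1)) < fst (signed_word n c ! i) \<longleftrightarrow> left_ascent i (state_of c)"
    using assms by (simp add: c'(1) nth_signed_word left_ascent_def) (simp add: state_of_def)
  then show "left_T_sw i F (signed_word n c) = app (left_T i) f (state_of c)"
    using 1 f c bij by (simp add: left_T_sw_def left_T.rep_eq fe)
qed

lemma corresponds_lword:
  assumes "set w \<subseteq> {1..<n}"
  shows "corresponds n (left_word w) (foldr left_T_sw w)"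
  using assms
proof (induction w)
  case (Cons i w)
  have l: "corresponds n (app (left_T i)) (left_T_sw i)" and "corresponds n (left_word w) (foldr left_T_sw w)"
    using Cons corresponds_lT[of i n] by auto
  then show ?case unfolding corresponds_def by simp
qed (simp add: corresponds_def)

lemma signed_word_W: "c \<in> basis_index n \<Longrightarrow> signed_word n c \<in> signed_words {1..n}"
proof -
  assume "c \<in> basis_index n"
  then obtain \<sigma> I where c: "c = (\<sigma>, I)" "\<sigma> permutes {1..n}" by (auto simp: basis_index_def)
  have p: "inv_fun \<sigma> permutes {1..n}" using c permutes_inv by blast
  have m: "map fst (signed_word n c) = map (inv_fun \<sigma>) [1..<Suc n]" by (simp add: c signed_word_def comp_def del: upt_Suc)
  have "distinct (map (inv_fun \<sigma>) [1..<Suc n])"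
    using permutes_inj[OF p] by (simp add: distinct_map inj_on_def)
  moreover have "fst ` set (signed_word n c) = inv_fun \<sigma> ` {1..n}"
    using arg_cong[OF m, of set] by (simp add: atLeastLessThanSuc_atLeastAtMost del: upt_Suc)
  ultimately show ?thesis using permutes_image[OF p] by (simp add: signed_words_def m)
qed

lemma bij_signed_word: "bij_betw (signed_word n) (basis_index n) (signed_words {1..n})"
  unfolding bij_betw_def
proof
  show "inj_on (signed_word n) (basis_index n)"
  proof (rule inj_onI)
    fix c d assume cd: "c \<in> basis_index n" "d \<in> basis_index n" "signed_word n c = signed_word n d"
    obtain \<sigma> I where c: "c = (\<sigma>, I)" "\<sigma> permutes {1..n}" "I \<subseteq> {1..n}" using cd by (auto simp: basis_index_def)
    obtain \<tau> J where d: "d = (\<tau>, J)" "\<tau> permutes {1..n}" "J \<subseteq> {1..n}" using cd by (auto simp: basis_index_def)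
    have "inv_fun \<sigma> k = inv_fun \<tau> k" for k
    proof (cases "k \<in> {1..n}")
      case True
      then obtain k' where "k = Suc k'" "k' < n" by (cases k) auto
      then show ?thesis using nth_signed_word[of k' n \<sigma> I] nth_signed_word[of k' n \<tau> J] cd(3) by (simp add: c d)
    next
      case False
      then show ?thesis using permutes_inv[OF c(2)] permutes_inv[OF d(2)] by (metis permutes_not_in)
    qed
    then have "inv_fun \<sigma> = inv_fun \<tau>" by blast
    then have st: "\<sigma> = \<tau>" using c(2) d(2) by (metis permutes_inv_inv)
    have "k \<in> I \<longleftrightarrow> k \<in> J" if "k \<in> {1..n}" for k
      using mem_signed_word[OF c(2) that, of True I] mem_signed_word[OF d(2) that, of True J] cd(3) by (simp add: c d)
    then show "c = d" using c d st by auto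
  qed
  show "signed_word n ` basis_index n = signed_words {1..n}"
  proof
    show "signed_word n ` basis_index n \<subseteq> signed_words {1..n}" using signed_word_W by blast
    show "signed_words {1..n} \<subseteq> signed_word n ` basis_index n"
    proof
      fix w assume w: "w \<in> signed_words {1..n}"
      have len: "length w = n" using signed_words_length[OF w] by simp
      \<comment> \<open>The labels of \<open>w\<close>, read in order, are the one-line notation of
        the inverse of the permutation sought.\<close>
      define p where "p k = (if k \<in> {1..n} then fst (w ! (k - 1)) else k)" for k
      define I where "I = {x. (x, True) \<in> set w}"
      have inj: "inj_on p {1..n}"
      proof (rule inj_onI)
        fix x y assume xy: "x \<in> {1..n}" "y \<in> {1..n}" "p x = p y"
        then have "x - 1 < length w" "y - 1 < length w" using len by auto
        then have "map fst w ! (x - 1) = map fst w ! (y - 1)" using xy len by (simp add: p_def)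
        then have "x - 1 = y - 1" using w len xy by (subst (asm) nth_eq_iff_index_eq) (auto simp: signed_words_def)
        then show "x = y" using xy by auto
      qed
      have sub: "p ` {1..n} \<subseteq> {1..n}"
      proof clarify
        fix k assume k: "k \<in> {1..n}"
        then have "fst (w ! (k - 1)) \<in> fst ` set w" using len by (intro imageI nth_mem) auto
        then show "p k \<in> {1..n}" using w k by (auto simp: p_def signed_words_def)
      qed
      have "bij_betw p {1..n} {1..n}"
        using inj sub endo_inj_surj[OF _ sub inj] by (simp add: bij_betw_def)
      then have p: "p permutes {1..n}" by (rule bij_imp_permutes) (auto simp: p_def)
      have "signed_word n (inv_fun p, I) = w"
      proof (rule nth_equalityI)
        fix k assume "k < length (signed_word n (inv_fun p, I))"
        then have k: "k < n" by simp
        have "(fst (w ! k), True) \<in> set w \<longleftrightarrow> snd (w ! k)"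
        proof
          assume "(fst (w ! k), True) \<in> set w"
          moreover have "w ! k \<in> set w" using k len by simp
          ultimately show "snd (w ! k)" using w unfolding signed_words_def mem_Collect_eq distinct_map
            by (metis fst_conv inj_onD snd_conv)
        next
          assume "snd (w ! k)"
          then show "(fst (w ! k), True) \<in> set w" using k len by (metis nth_mem prod.collapse)
        qed
        moreover have "inv_fun (inv_fun p) (Suc k) = fst (w ! k)"
          using permutes_inv_inv[OF p] k by (simp add: p_def)
        ultimately show "signed_word n (inv_fun p, I) ! k = w ! k" using k by (simp add: nth_signed_word I_def prod_eq_iff)
      qed (simp add: len)
      moreover have "(inv_fun p, I) \<in> basis_index n"
        using permutes_inv[OF p] w by (force simp: basis_index_def I_def signed_words_def)
      ultimately show "w \<in> signed_word n ` basis_index n" by (metis imageI)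
    qed
  qed
qed

lemma swap_at_Cons: "1 \<le> i \<Longrightarrow> swap_at (Suc i) (x # w) = x # swap_at i w"
  by (cases i) (simp_all add: swap_at_def)

lemma left_T_sw_Cons: "1 \<le> i \<Longrightarrow> left_T_sw (Suc i) F (x # w) = left_T_sw i (\<lambda>v. F (x # v)) w"
  by (cases i) (simp_all add: left_T_sw_def swap_at_Cons)

lemma left_T_sw_1: "left_T_sw 1 F (x # y # w) = (if fst x < fst y then q * F (y # x # w) else F (y # x # w) + (q - 1) * F (x # y # w))"
  by (simp add: left_T_sw_def swap_at_def One_nat_def)

lemma foldr_lamw_Cons:
  assumes "\<forall>i\<in>set js. 1 \<le> i"
  shows "foldr left_T_sw (map Suc js) F (x # w) = foldr left_T_sw js (\<lambda>v. F (x # v)) w"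
  using assms
proof (induction js arbitrary: w)
  case (Cons j js)
  have "(\<lambda>v. foldr left_T_sw (map Suc js) F (x # v)) = foldr left_T_sw js (\<lambda>v. F (x # v))"
    using Cons by auto
  then show ?case using Cons.prems by (simp add: left_T_sw_Cons)
qed simp

lemma coxeter_word_Suc: "coxeter_word (Suc d) \<mu> = map Suc (coxeter_word d \<mu>)"
  by (induction \<mu> arbitrary: d) (simp_all add: map_Suc_upt)

text \<open>Behind the first letter 1 stand the letters of the shortened composition, shifted by 1;
  shifted letters leave the first entry alone.\<close>

lemma foldr_lamw_coxeter_word: "length w = sum_list \<mu> \<Longrightarrow> foldr left_T_sw (coxeter_word 0 \<mu>) F w = left_coxeter \<mu> F w"
proof (induction \<mu> F w rule: left_coxeter.induct)
  case (3 \<mu> F x w)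
  have "coxeter_word 0 (Suc 0 # \<mu>) = map Suc (coxeter_word 0 \<mu>)" by (simp add: coxeter_word_Suc[symmetric])
  moreover have "\<forall>i\<in>set (coxeter_word 0 \<mu>). 1 \<le> i" using set_coxeter_word[of 0 \<mu>] by fastforce
  ultimately show ?case using 3 foldr_lamw_Cons[of "coxeter_word 0 \<mu>" F x w] by simp
next
  case (4 m \<mu> F x y w)
  let ?js = "coxeter_word 0 (Suc m # \<mu>)"
  have "[0 + 1..<0 + Suc (Suc m)] = 1 # map Suc [0 + 1..<0 + Suc m]"
    using upt_conv_Cons[of 1 "Suc (Suc m)"] by (simp add: map_Suc_upt)
  then have js: "coxeter_word 0 (Suc (Suc m) # \<mu>) = 1 # map Suc ?js" by (simp add: coxeter_word_Suc)
  have pos: "\<forall>i\<in>set ?js. 1 \<le> i" using set_coxeter_word[of 0 "Suc m # \<mu>"] by fastforce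
  have len: "length (x # w) = sum_list (Suc m # \<mu>)" "length (y # w) = sum_list (Suc m # \<mu>)" using 4 by simp_all
  note fl = foldr_lamw_Cons[OF pos]
  show ?case
  proof (cases "fst x < fst y")
    case True
    then show ?thesis using 4(1)[OF True len(1)] unfolding js by (simp add: left_T_sw_1 fl del: coxeter_word.simps)
  next
    case False
    then show ?thesis using 4(2)[OF False len(1)] 4(3)[OF False len(2)] unfolding js by (simp add: left_T_sw_1 fl del: coxeter_word.simps)
  qed
qed simp_all

definition op_bitrace :: "nat \<Rightarrow> nat list \<Rightarrow> (nat \<Rightarrow> site) linop \<Rightarrow> hc_field" where
  "op_bitrace n \<mu> R = (\<Sum>c\<in>basis_index n. left_word (coxeter_word 0 \<mu>) (app R (delta (state_of c))) (state_of c))"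

lemma op_bitrace_Z:
  assumes R: "corresponds n (app R) (app S)" and \<mu>: "sum_list \<mu> = n"
  shows "op_bitrace n \<mu> R = trace_sw {1..n} \<mu> S"
proof -
  have "trace_sw {1..n} \<mu> S = (\<Sum>w\<in>signed_words {1..n}. left_coxeter \<mu> (app S (delta w)) w)"
    using \<mu> by (simp add: trace_sw_def)
  also have "\<dots> = (\<Sum>c\<in>basis_index n. left_coxeter \<mu> (app S (delta (signed_word n c))) (signed_word n c))"
    by (rule sum.reindex_bij_betw[OF bij_signed_word, symmetric])
  also have "\<dots> = op_bitrace n \<mu> R"
    unfolding op_bitrace_def
  proof (rule sum.cong[OF refl])
    fix c assume c: "c \<in> basis_index n"
    have delta: "delta (signed_word n c) (signed_word n d) = delta (state_of c) (state_of d)" if "d \<in> basis_index n" for d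
      using bij_signed_word[of n] c that by (auto simp: delta_def bij_betw_def inj_on_def)
    have "set (coxeter_word 0 \<mu>) \<subseteq> {1..<n}" using set_coxeter_word[of 0 \<mu>] \<mu> by simp
    then have "foldr left_T_sw (coxeter_word 0 \<mu>) (app S (delta (signed_word n c))) (signed_word n c) = left_word (coxeter_word 0 \<mu>) (app R (delta (state_of c))) (state_of c)"
      using corrD[OF corresponds_lword _ c] corrD[OF R, of "delta (signed_word n c)" "delta (state_of c)"] delta by blast
    then show "left_coxeter \<mu> (app S (delta (signed_word n c))) (signed_word n c) = left_word (coxeter_word 0 \<mu>) (app R (delta (state_of c))) (state_of c)"
      using \<mu> by (simp add: foldr_lamw_coxeter_word)
  qed
  finally show ?thesis ..
qed

section \<open>Symmetrizers and the Newton identity\<close>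

text \<open>For \<open>a > 0\<close> this is
  \<open>1 + T_{a-1} + T_{a-1} T_{a-2} + ... + T_{a-1} ... T_1\<close>, the sum over minimal coset
  representatives. The value 0 at index 0 cancels \<open>T 0\<close>, which belongs to no generator,
  and makes the value at 1 equal to 1.\<close>

fun sym_factor :: "(nat \<Rightarrow> 'r::ring_1) \<Rightarrow> nat \<Rightarrow> 'r" where
  "sym_factor T 0 = 0"
| "sym_factor T (Suc a) = 1 + T a * sym_factor T a"

fun symmetrizer :: "(nat \<Rightarrow> 'r::ring_1) \<Rightarrow> nat \<Rightarrow> 'r" where
  "symmetrizer T 0 = 1"
| "symmetrizer T (Suc a) = symmetrizer T a * sym_factor T (Suc a)"

text \<open>The mirror image, with coset representatives on the other side. Comparing the two
  symmetrizers yields the eigenvalue equation from both sides.\<close>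

fun sym_factor' :: "(nat \<Rightarrow> 'r::ring_1) \<Rightarrow> nat \<Rightarrow> 'r" where
  "sym_factor' T 0 = 0"
| "sym_factor' T (Suc a) = 1 + sym_factor' T a * T a"

fun symmetrizer' :: "(nat \<Rightarrow> 'r::ring_1) \<Rightarrow> nat \<Rightarrow> 'r" where
  "symmetrizer' T 0 = 1"
| "symmetrizer' T (Suc a) = sym_factor' T (Suc a) * symmetrizer' T a"

fun q_int :: "nat \<Rightarrow> hc_field" where
  "q_int 0 = 0"
| "q_int (Suc a) = 1 + q * q_int a"

fun q_fact :: "nat \<Rightarrow> hc_field" where
  "q_fact 0 = 1"
| "q_fact (Suc a) = q_fact a * q_int (Suc a)"

lemma q_int_eq: "(q - 1) * q_int a = q ^ a - 1"
  by (induction a) (simp_all add: algebra_simps)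

lemma q_half_power: "q_half ^ k = Fract (monom 1 k) 1"
proof (induction k)
  case 0
  then show ?case by (simp add: One_fract_def monom_0 One_nat_def pCons_one)
next
  case (Suc k)
  then show ?case by (simp add: q_half_def monom_Suc)
qed

text \<open>\<open>q\<close> is not a root of unity, which makes the quantum integers and factorials
  invertible.\<close>

lemma q_power_ne_1: "k > 0 \<Longrightarrow> q ^ k \<noteq> 1"
proof
  assume k: "k > 0" "q ^ k = 1"
  then have "Fract (monom (1::complex) (2 * k)) 1 = 1"
    unfolding q_def power_mult[symmetric] by (simp add: q_half_power)
  then have "monom (1::complex) (2 * k) = 1" by (simp add: One_fract_def eq_fract)
  then have "degree (monom (1::complex) (2 * k)) = 0" by simp
  then show False using k by (simp add: degree_monom_eq)
qed

lemma q_ne_1 [simp]: "q \<noteq> 1"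
  using q_power_ne_1[of 1] by simp

lemma q_int_ne_0: "a > 0 \<Longrightarrow> q_int a \<noteq> 0"
  using q_int_eq[of a] q_power_ne_1[of a] by auto

lemma q_fact_ne_0: "q_fact a \<noteq> 0"
proof (induction a)
  case (Suc a)
  then show ?case using q_int_ne_0[of "Suc a"] by (simp del: q_int.simps)
qed simp

section \<open>Eigenvalue equations of the symmetrizers\<close>

lemma sym_factor_commute:
  assumes "\<And>i. i < a \<Longrightarrow> 0 < i \<Longrightarrow> T i * x = x * T i"
  shows "sym_factor T a * x = x * sym_factor T a"
  using assms
proof (induction a)
  case (Suc a)
  show ?case
  proof (cases "a = 0")
    case False
    then have "T a * sym_factor T a * x = x * (T a * sym_factor T a)"
      using Suc by (simp add: mult.assoc) (simp flip: mult.assoc)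
    then show ?thesis by (simp add: algebra_simps)
  qed simp
qed simp

lemma sym_factor'_commute:
  assumes "\<And>i. i < a \<Longrightarrow> 0 < i \<Longrightarrow> T i * x = x * T i"
  shows "sym_factor' T a * x = x * sym_factor' T a"
  using assms
proof (induction a)
  case (Suc a)
  show ?case
  proof (cases "a = 0")
    case False
    then have "sym_factor' T a * T a * x = x * (sym_factor' T a * T a)"
      using Suc by (simp add: mult.assoc) (simp flip: mult.assoc)
    then show ?thesis by (simp add: algebra_simps)
  qed simp
qed simp

lemma sym_commute:
  assumes "\<And>i. i < a \<Longrightarrow> 0 < i \<Longrightarrow> T i * x = x * T i"
  shows "symmetrizer T a * x = x * symmetrizer T a"
  using assms
proof (induction a)
  case (Suc a)
  then have "symmetrizer T a * x = x * symmetrizer T a" "sym_factor T (Suc a) * x = x * sym_factor T (Suc a)"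
    using sym_factor_commute[of "Suc a" T x] by simp_all
  then show ?case unfolding symmetrizer.simps by (simp only: mult.assoc) (simp only: mult.assoc[symmetric])
qed simp

lemma sym'_commute:
  assumes "\<And>i. i < a \<Longrightarrow> 0 < i \<Longrightarrow> T i * x = x * T i"
  shows "symmetrizer' T a * x = x * symmetrizer' T a"
  using assms
proof (induction a)
  case (Suc a)
  then have "symmetrizer' T a * x = x * symmetrizer' T a" "sym_factor' T (Suc a) * x = x * sym_factor' T (Suc a)"
    using sym_factor'_commute[of "Suc a" T x] by simp_all
  then show ?case unfolding symmetrizer'.simps by (simp only: mult.assoc) (simp only: mult.assoc[symmetric])
qed simp

abbreviation "Q \<equiv> scal q"

lemma right_T_quad: "right_T j * right_T j = Q * right_T j - right_T j + Q"
  using right_T_quadratic[of j] by (simp add: scal_diff algebra_simps)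

text \<open>This is the eigenvalue equation of the symmetrizer of size \<open>b + 2\<close> for its
  last generator: the factors of the symmetrizer before these two commute with that
  generator.\<close>

lemma sym_factor_eigen: "right_T (Suc b) * (sym_factor right_T (Suc b) * sym_factor right_T (Suc (Suc b))) = Q * (sym_factor right_T (Suc b) * sym_factor right_T (Suc (Suc b)))"
proof (induction b)
  case 0
  show ?case by (simp add: algebra_simps right_T_quad)
next
  case (Suc b)
  define T U F where d: "T = right_T (Suc (Suc b))" "U = right_T (Suc b)" "F = sym_factor right_T (Suc b)"
  have FT: "F * T = T * F" unfolding d by (rule sym_factor_commute, rule right_T_commute) auto
  have TT: "T * T = Q * T - T + Q" unfolding d by (rule right_T_quad)
  have TUT: "T * (U * T) = U * (T * U)" using right_T_braid[of "Suc b"] by (simp add: d mult.assoc)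
  \<comment> \<open>Since the next factor is \<open>1 + U * F\<close>, the induction hypothesis
    becomes a rewrite rule for \<open>U * (F * (U * F))\<close>.\<close>
  have IH: "U * (F * (U * F)) = Q * F + Q * (F * (U * F)) - U * F"
  proof -
    have "U * (F * (1 + U * F)) = Q * (F * (1 + U * F))"
      using Suc[unfolded sym_factor.simps(2)[of right_T "Suc b"]] by (simp only: d)
    then show ?thesis by (simp add: distrib_left eq_diff_eq add.commute)
  qed
  have TT': "T * (T * x) = Q * (T * x) - T * x + Q * x" and TUT': "T * (U * (T * x)) = U * (T * (U * x))"
    and FT': "F * (T * x) = T * (F * x)" for x
    using arg_cong[OF TT, of "\<lambda>y. y * x"] arg_cong[OF TUT, of "\<lambda>y. y * x"] arg_cong[OF FT, of "\<lambda>y. y * x"]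
    by (simp_all add: algebra_simps)
  have c: "y * Q = Q * y" "y * (Q * x) = Q * (y * x)" if "y \<in> {T, U, F}" for x y
    using scal_commute[of q y] by (simp_all flip: mult.assoc)
  have "T * ((1 + U * F) * (1 + T * (1 + U * F))) = Q * ((1 + U * F) * (1 + T * (1 + U * F)))"
    by (simp add: distrib_left distrib_right left_diff_distrib right_diff_distrib mult.assoc FT FT' TT TT' TUT TUT' IH c[of T] c[of U] c[of F])
  then show ?case unfolding d sym_factor.simps(2)[of right_T "Suc b"] sym_factor.simps(2)[of right_T "Suc (Suc b)"] .
qed

lemma sym_factor'_eigen: "sym_factor' right_T (Suc (Suc b)) * sym_factor' right_T (Suc b) * right_T (Suc b) = Q * (sym_factor' right_T (Suc (Suc b)) * sym_factor' right_T (Suc b))"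
proof (induction b)
  case 0
  show ?case by (simp add: algebra_simps right_T_quad)
next
  case (Suc b)
  define T U F where d: "T = right_T (Suc (Suc b))" "U = right_T (Suc b)" "F = sym_factor' right_T (Suc b)"
  have FT: "F * T = T * F" unfolding d by (rule sym_factor'_commute, rule right_T_commute) auto
  have TT: "T * T = Q * T - T + Q" unfolding d by (rule right_T_quad)
  have TUT: "T * (U * T) = U * (T * U)" using right_T_braid[of "Suc b"] by (simp add: d mult.assoc)
  have IH: "F * (U * (F * U)) = Q * F + Q * (F * (U * F)) - F * U"
  proof -
    have "(1 + F * U) * F * U = Q * ((1 + F * U) * F)"
      using Suc[unfolded sym_factor'.simps(2)[of right_T "Suc b"]] by (simp only: d)
    then show ?thesis by (simp add: distrib_right distrib_left eq_diff_eq add.commute mult.assoc)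
  qed
  have TT': "T * (T * x) = Q * (T * x) - T * x + Q * x" and TUT': "U * (T * (U * x)) = T * (U * (T * x))"
    and FT': "T * (F * x) = F * (T * x)" and IH': "F * (U * (F * (U * x))) = Q * (F * x) + Q * (F * (U * (F * x))) - F * (U * x)" for x
    using arg_cong[OF TT, of "\<lambda>y. y * x"] arg_cong[OF TUT, of "\<lambda>y. y * x"] arg_cong[OF FT, of "\<lambda>y. y * x"]
      arg_cong[OF IH, of "\<lambda>y. y * x"]
    by (simp_all add: algebra_simps)
  have c: "y * Q = Q * y" "y * (Q * x) = Q * (y * x)" if "y \<in> {T, U, F}" for x y
    using scal_commute[of q y] by (simp_all flip: mult.assoc)
  have "(1 + (1 + F * U) * T) * (1 + F * U) * T = Q * ((1 + (1 + F * U) * T) * (1 + F * U))"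
    by (simp add: distrib_left distrib_right left_diff_distrib right_diff_distrib mult.assoc FT[symmetric] FT' TT TT' TUT TUT' IH IH' c[of T] c[of U] c[of F])
  then show ?case unfolding d sym_factor'.simps(2)[of right_T "Suc b"] sym_factor'.simps(2)[of right_T "Suc (Suc b)"] .
qed

lemma sym_left: "0 < i \<Longrightarrow> i < a \<Longrightarrow> right_T i * symmetrizer right_T a = Q * symmetrizer right_T a"
proof (induction a)
  case (Suc a)
  show ?case
  proof (cases "i < a")
    case True
    then show ?thesis using Suc unfolding symmetrizer.simps by (simp only: mult.assoc[symmetric])
  next
    case False
    then have "a = Suc (a - 1)" "i = Suc (a - 1)" using Suc.prems by auto
    then obtain b where b: "a = Suc b" "i = Suc b" by blast
    have c: "symmetrizer right_T b * right_T (Suc b) = right_T (Suc b) * symmetrizer right_T b"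
      by (rule sym_commute, rule right_T_commute) auto
    have "right_T i * symmetrizer right_T (Suc a) = right_T (Suc b) * symmetrizer right_T b * (sym_factor right_T (Suc b) * sym_factor right_T (Suc (Suc b)))"
      unfolding b symmetrizer.simps by (simp only: mult.assoc)
    also have "\<dots> = symmetrizer right_T b * (right_T (Suc b) * (sym_factor right_T (Suc b) * sym_factor right_T (Suc (Suc b))))"
      unfolding c[symmetric] by (simp only: mult.assoc)
    also have "\<dots> = Q * symmetrizer right_T (Suc a)"
      unfolding sym_factor_eigen b symmetrizer.simps scal_commute[of q "symmetrizer right_T b * sym_factor right_T (Suc b) * sym_factor right_T (Suc (Suc b))"]
      by (simp only: mult.assoc scal_commute[of q "sym_factor right_T (Suc b) * sym_factor right_T (Suc (Suc b))"])
    finally show ?thesis .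
  qed
qed simp

lemma sym'_right: "0 < i \<Longrightarrow> i < a \<Longrightarrow> symmetrizer' right_T a * right_T i = Q * symmetrizer' right_T a"
proof (induction a)
  case (Suc a)
  show ?case
  proof (cases "i < a")
    case True
    then have "symmetrizer' right_T (Suc a) * right_T i = sym_factor' right_T (Suc a) * (Q * symmetrizer' right_T a)"
      using Suc unfolding symmetrizer'.simps by (simp only: mult.assoc)
    then show ?thesis unfolding symmetrizer'.simps
      by (simp only: mult.assoc[symmetric] scal_commute[of q "sym_factor' right_T (Suc a)"])
  next
    case False
    then have "a = Suc (a - 1)" "i = Suc (a - 1)" using Suc.prems by auto
    then obtain b where b: "a = Suc b" "i = Suc b" by blast
    have c: "symmetrizer' right_T b * right_T (Suc b) = right_T (Suc b) * symmetrizer' right_T b"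
      by (rule sym'_commute, rule right_T_commute) auto
    have "symmetrizer' right_T (Suc a) * right_T i = sym_factor' right_T (Suc (Suc b)) * sym_factor' right_T (Suc b) * (symmetrizer' right_T b * right_T (Suc b))"
      unfolding b symmetrizer'.simps by (simp only: mult.assoc)
    also have "\<dots> = (sym_factor' right_T (Suc (Suc b)) * sym_factor' right_T (Suc b) * right_T (Suc b)) * symmetrizer' right_T b"
      unfolding c by (simp only: mult.assoc)
    also have "\<dots> = Q * symmetrizer' right_T (Suc a)"
      unfolding sym_factor'_eigen b symmetrizer'.simps by (simp only: mult.assoc)
    finally show ?thesis .
  qed
qed simp

lemma sym_factor_left_eigen:
  assumes "\<And>i. 0 < i \<Longrightarrow> i < a \<Longrightarrow> right_T i * x = Q * x"
  shows "sym_factor right_T a * x = scal (q_int a) * x"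
  using assms
proof (induction a)
  case (Suc a)
  show ?case
  proof (cases "a = 0")
    case False
    have "sym_factor right_T a * x = scal (q_int a) * x" using Suc by simp
    then have "right_T a * sym_factor right_T a * x = scal (q_int a) * (right_T a * x)"
      by (simp only: mult.assoc) (simp only: mult.assoc[symmetric] scal_commute[of "q_int a" "right_T a"])
    then show ?thesis using Suc.prems[of a] False
      by (simp add: distrib_right scal_add scal_mult mult.assoc) (simp only: mult.assoc[symmetric] scal_commute[of "q_int a" Q])
  qed simp
qed simp

lemma sym_factor'_left_eigen:
  assumes "\<And>i. 0 < i \<Longrightarrow> i < a \<Longrightarrow> right_T i * x = Q * x"
  shows "sym_factor' right_T a * x = scal (q_int a) * x"
  using assms
proof (induction a)
  case (Suc a)
  show ?case
  proof (cases "a = 0")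
    case False
    have "sym_factor' right_T a * right_T a * x = sym_factor' right_T a * (Q * x)"
      using Suc.prems[of a] False by (simp add: mult.assoc)
    also have "\<dots> = Q * (sym_factor' right_T a * x)"
      by (simp only: mult.assoc[symmetric] scal_commute[of q "sym_factor' right_T a"])
    finally show ?thesis using Suc by (simp add: distrib_right scal_add scal_mult mult.assoc)
  qed simp
qed simp

lemma sym_factor_right_eigen:
  assumes "\<And>i. 0 < i \<Longrightarrow> i < a \<Longrightarrow> x * right_T i = Q * x"
  shows "x * sym_factor right_T a = scal (q_int a) * x"
  using assms
proof (induction a)
  case (Suc a)
  show ?case
  proof (cases "a = 0")
    case False
    have "x * (right_T a * sym_factor right_T a) = Q * (x * sym_factor right_T a)"
      using Suc.prems[of a] False by (simp flip: mult.assoc)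
    then show ?thesis using Suc by (simp add: distrib_left distrib_right scal_add scal_mult mult.assoc)
  qed simp
qed simp

lemma sym'_left_eigen:
  assumes "\<And>i. 0 < i \<Longrightarrow> i < a \<Longrightarrow> right_T i * x = Q * x"
  shows "symmetrizer' right_T a * x = scal (q_fact a) * x"
  using assms
proof (induction a)
  case (Suc a)
  have "symmetrizer' right_T (Suc a) * x = sym_factor' right_T (Suc a) * (scal (q_fact a) * x)"
    using Suc by (simp only: symmetrizer'.simps mult.assoc)
  also have "\<dots> = scal (q_fact a) * (sym_factor' right_T (Suc a) * x)"
    by (simp only: mult.assoc[symmetric] scal_commute[of "q_fact a" "sym_factor' right_T (Suc a)"])
  also have "\<dots> = scal (q_fact (Suc a)) * x"
    using sym_factor'_left_eigen[of "Suc a" x] Suc.prems by (simp add: scal_mult mult.assoc del: sym_factor'.simps q_int.simps)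
  finally show ?case .
qed simp

lemma sym_right_eigen:
  assumes "\<And>i. 0 < i \<Longrightarrow> i < a \<Longrightarrow> x * right_T i = Q * x"
  shows "x * symmetrizer right_T a = scal (q_fact a) * x"
  using assms
proof (induction a)
  case (Suc a)
  have "x * symmetrizer right_T (Suc a) = (scal (q_fact a) * x) * sym_factor right_T (Suc a)"
    using Suc by (simp only: symmetrizer.simps mult.assoc[symmetric])
  also have "\<dots> = scal (q_fact a) * (x * sym_factor right_T (Suc a))"
    by (simp only: mult.assoc)
  also have "\<dots> = scal (q_fact (Suc a)) * x"
    using sym_factor_right_eigen[of "Suc a" x] Suc.prems by (simp add: scal_mult mult.assoc del: sym_factor.simps q_int.simps)
  finally show ?case .
qed simp

text \<open>By the eigenvalue equations the product of \<open>symmetrizer'\<close> and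
  \<open>symmetrizer\<close> is \<open>q_fact a\<close> times either factor.\<close>

lemma sym_eq_sym': "symmetrizer right_T a = symmetrizer' right_T a"
proof -
  have "scal (q_fact a) * symmetrizer right_T a = scal (q_fact a) * symmetrizer' right_T a"
    using sym'_left_eigen[of a "symmetrizer right_T a"] sym_right_eigen[of a "symmetrizer' right_T a"] sym_left[of _ a] sym'_right[of _ a] by simp
  then have "scal (1 / q_fact a) * scal (q_fact a) * symmetrizer right_T a = scal (1 / q_fact a) * scal (q_fact a) * symmetrizer' right_T a"
    by (simp only: mult.assoc)
  then show ?thesis by (simp add: q_fact_ne_0 flip: scal_mult)
qed

lemma sym_right: "0 < i \<Longrightarrow> i < a \<Longrightarrow> symmetrizer right_T a * right_T i = Q * symmetrizer right_T a"
  unfolding sym_eq_sym' by (rule sym'_right)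

section \<open>Supports and the cyclicity of the trace\<close>

definition preserves_support :: "nat \<Rightarrow> (nat \<Rightarrow> site) linop \<Rightarrow> bool" where
  "preserves_support n R \<longleftrightarrow> (\<forall>f. (\<forall>x. x \<notin> state_of ` basis_index n \<longrightarrow> f x = 0) \<longrightarrow> (\<forall>x. x \<notin> state_of ` basis_index n \<longrightarrow> app R f x = 0))"

lemma presD: "preserves_support n R \<Longrightarrow> (\<And>x. x \<notin> state_of ` basis_index n \<Longrightarrow> f x = 0) \<Longrightarrow> x \<notin> state_of ` basis_index n \<Longrightarrow> app R f x = 0"
  by (simp add: preserves_support_def)

lemma preserves_support_basic: "preserves_support n 0" "preserves_support n 1" "preserves_support n (scal a)"
  by (simp_all add: preserves_support_def)

lemma preserves_support_add: "preserves_support n R \<Longrightarrow> preserves_support n S \<Longrightarrow> preserves_support n (R + S)"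
  unfolding preserves_support_def app_plus by simp

lemma preserves_support_mult: "preserves_support n R \<Longrightarrow> preserves_support n S \<Longrightarrow> preserves_support n (R * S)"
  unfolding preserves_support_def app_times by simp

lemma preserves_support_rT:
  assumes "1 \<le> j" "j < n"
  shows "preserves_support n (right_T j)"
  unfolding preserves_support_def
proof (intro allI impI)
  fix f :: "(nat \<Rightarrow> site) \<Rightarrow> hc_field" and x
  assume f: "\<forall>x. x \<notin> state_of ` basis_index n \<longrightarrow> f x = 0" and x: "x \<notin> state_of ` basis_index n"
  have "set_sites j x s a b \<notin> state_of ` basis_index n" for s a b
  proof
    assume "set_sites j x s a b \<in> state_of ` basis_index n"
    then obtain c where c: "c \<in> basis_index n" "set_sites j x s a b = state_of c" by auto
    have "x = set_sites j (set_sites j x s a b) s (snd (x j)) (snd (x (Suc j)))"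
      by (auto simp: set_sites_def fun_eq_iff)
    then have "x = state_of (set_sites_index j c s (snd (x j)) (snd (x (Suc j))))" by (simp add: c state_of_updc)
    then show False using x set_sites_index_index[OF c(1) assms] by blast
  qed
  then show "app (right_T j) f x = 0" using f by (simp add: right_T.rep_eq local_T_def)
qed

lemma preserves_support_lT:
  assumes "1 \<le> i" "i < n"
  shows "preserves_support n (left_T i)"
  unfolding preserves_support_def
proof (intro allI impI)
  fix f :: "(nat \<Rightarrow> site) \<Rightarrow> hc_field" and x
  assume f: "\<forall>x. x \<notin> state_of ` basis_index n \<longrightarrow> f x = 0" and x: "x \<notin> state_of ` basis_index n"
  have "swap_values i x \<notin> state_of ` basis_index n"
  proof
    assume "swap_values i x \<in> state_of ` basis_index n"
    then obtain \<sigma> I where c: "\<sigma> permutes {1..n}" "I \<subseteq> {1..n}" "swap_values i x = state_of (\<sigma>, I)"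
      by (auto simp: basis_index_def)
    have "x = swap_values i (swap_values i x)" by (simp add: swap_values_def)
    also have "\<dots> = state_of (transpose i (Suc i) \<circ> \<sigma>, I)" unfolding c by (simp add: swap_values_def state_of_def)
    finally have "x = state_of (transpose i (Suc i) \<circ> \<sigma>, I)" .
    moreover have "transpose i (Suc i) \<circ> \<sigma> permutes {1..n}"
      using assms by (intro permutes_compose[OF c(1)] permutes_swap_id) auto
    ultimately show False using x c by (auto simp: basis_index_def)
  qed
  then show "app (left_T i) f x = 0" using f x by (simp add: left_T.rep_eq)
qed

text \<open>The trace on the finite-dimensional space of functions supported on basis states. The
  operators act on an infinite-dimensional space, so cyclicity needs that this subspace is
  preserved.\<close>

definition op_trace :: "nat \<Rightarrow> (nat \<Rightarrow> site) linop \<Rightarrow> hc_field" where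
  "op_trace n R = (\<Sum>c\<in>basis_index n. app R (delta (state_of c)) (state_of c))"

lemma delta_notin: "c \<in> basis_index n \<Longrightarrow> x \<notin> state_of ` basis_index n \<Longrightarrow> delta (state_of c) x = 0"
  by (auto simp: delta_def)

lemma expand_delta:
  assumes "\<And>x. x \<notin> state_of ` basis_index n \<Longrightarrow> f x = 0"
  shows "f = (\<lambda>x. \<Sum>d\<in>basis_index n. f (state_of d) * delta (state_of d) x)"
proof
  fix x
  show "f x = (\<Sum>d\<in>basis_index n. f (state_of d) * delta (state_of d) x)"
  proof (cases "x \<in> state_of ` basis_index n")
    case True
    then obtain c where c: "c \<in> basis_index n" "x = state_of c" by blast
    have "(\<Sum>d\<in>basis_index n. f (state_of d) * delta (state_of d) x) = (\<Sum>d\<in>basis_index n. if d = c then f (state_of d) else 0)"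
      by (rule sum.cong) (auto simp: delta_def c)
    then show ?thesis using c by simp
  qed (use assms in \<open>auto simp: delta_notin\<close>)
qed

lemma app_expand:
  assumes "\<And>x. x \<notin> state_of ` basis_index n \<Longrightarrow> f x = 0"
  shows "app R f x = (\<Sum>d\<in>basis_index n. f (state_of d) * app R (delta (state_of d)) x)"
proof -
  have "app R f x = app R (\<lambda>x. \<Sum>d\<in>basis_index n. f (state_of d) * delta (state_of d) x) x"
    using expand_delta[of n f] assms by simp
  then show ?thesis by (simp add: app_sum)
qed

lemma op_trace_commute:
  assumes "preserves_support n F" "preserves_support n G"
  shows "op_trace n (F * G) = op_trace n (G * F)"
proof -
  have e: "op_trace n (F * G) = (\<Sum>c\<in>basis_index n. \<Sum>d\<in>basis_index n. app F (delta (state_of c)) (state_of d) * app G (delta (state_of d)) (state_of c))"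
    if "preserves_support n F" for F G
    unfolding op_trace_def app_times
    by (rule sum.cong[OF refl], rule app_expand) (use presD[OF that] delta_notin in blast)
  show ?thesis unfolding e[OF assms(1)] e[OF assms(2)] by (subst sum.swap) (simp add: mult.commute)
qed

lemma op_trace_add: "op_trace n (F + G) = op_trace n F + op_trace n G"
  by (simp add: op_trace_def sum.distrib)

lemma op_trace_scal: "op_trace n (scal a * F) = a * op_trace n F"
  by (simp add: op_trace_def sum_distrib_left)

text \<open>Reversed because operators multiply in application order, whereas the last letter of a
  left word acts first.\<close>

definition left_op :: "nat list \<Rightarrow> (nat \<Rightarrow> site) linop" where
  "left_op w = prod_list (map left_T (rev w))"

lemma app_left_op: "app (left_op w) f = left_word w f"
  by (induction w) (simp_all add: left_op_def)

lemma op_bitrace_tr: "op_bitrace n \<mu> R = op_trace n (R * left_op (coxeter_word 0 \<mu>))"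
  by (simp add: op_bitrace_def op_trace_def app_left_op)

lemma left_op_rT: "left_op w * right_T j = right_T j * left_op w"
proof (induction w)
  case (Cons i w)
  have "left_op (i # w) = left_op w * left_T i" by (simp add: left_op_def)
  then show ?case using Cons left_T_rT_commute[of i j] by (simp add: mult.assoc) (simp flip: mult.assoc)
qed (simp add: left_op_def)

lemma sym_factor_induct:
  assumes "P 0" "P 1" "\<And>x y. P x \<Longrightarrow> P y \<Longrightarrow> P (x + y)" "\<And>x y. P x \<Longrightarrow> P y \<Longrightarrow> P (x * y)"
    "\<And>i. 0 < i \<Longrightarrow> i < a \<Longrightarrow> P (T i)"
  shows "P (sym_factor T a)" "P (symmetrizer T a)"
proof -
  have E: "P (sym_factor T b)" if "b \<le> a" for b
    using that
  proof (induction b)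
    case (Suc b)
    then show ?case using assms by (cases "b = 0") auto
  qed (simp add: assms(1))
  then show "P (sym_factor T a)" by simp
  have "P (symmetrizer T b)" if "b \<le> a" for b
    using that
  proof (induction b)
    case (Suc b)
    then show ?case unfolding symmetrizer.simps by (intro assms(4) E) simp_all
  qed (simp add: assms)
  then show "P (symmetrizer T a)" by simp
qed

lemma preserves_support_EE: "a \<le> n \<Longrightarrow> preserves_support n (sym_factor right_T a)" and preserves_support_sym: "a \<le> n \<Longrightarrow> preserves_support n (symmetrizer right_T a)"
  by (rule sym_factor_induct; auto intro: preserves_support_basic preserves_support_add preserves_support_mult preserves_support_rT)+

lemma preserves_support_rword: "set w \<subseteq> {1..<n} \<Longrightarrow> preserves_support n (right_word w)"
  by (induction w) (auto intro: preserves_support_basic preserves_support_mult preserves_support_rT)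

lemma preserves_support_lop: "set w \<subseteq> {1..<n} \<Longrightarrow> preserves_support n (left_op w)"
proof (induction w)
  case (Cons i w)
  have "left_op (i # w) = left_op w * left_T i" by (simp add: left_op_def)
  then show ?case using Cons by (auto intro: preserves_support_mult preserves_support_lT)
qed (simp add: left_op_def preserves_support_basic)

lemma left_op_commute_sym: "left_op w * sym_factor right_T a = sym_factor right_T a * left_op w" "left_op w * symmetrizer right_T a = symmetrizer right_T a * left_op w"
  using sym_factor_commute[of a right_T "left_op w"] sym_commute[of a right_T "left_op w"] left_op_rT by metis+

lemma right_word_EE: "\<forall>j\<in>set w. a < j \<Longrightarrow> sym_factor right_T a * right_word w = right_word w * sym_factor right_T a"
proof (rule sym_factor_commute)
  fix i assume "\<forall>j\<in>set w. a < j" "i < a"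
  then show "right_T i * right_word w = right_word w * right_T i"
  proof (induction w)
    case (Cons j w)
    have "right_T i * right_T j = right_T j * right_T i" using Cons.prems by (intro right_T_commute) auto
    then show ?case using Cons by (simp add: mult.assoc[symmetric]) (simp add: mult.assoc)
  qed simp
qed

text \<open>In the cocenter, \<open>[n] h\<^sub>n = \<Sum>\<^sub>b h\<^bsub>n-b\<^esub> \<gamma>\<^sub>b\<close> for the symmetrizing idempotents \<open>h\<^sub>n\<close>.\<close>

lemma newton:
  assumes "sum_list \<kappa> = n" "0 < n"
  shows "q_int n * op_bitrace n \<kappa> (symmetrizer right_T n) / q_fact n =
    (\<Sum>a<n. op_bitrace n \<kappa> (symmetrizer right_T a * right_word [Suc a..<n]) / q_fact a)"
proof -
  define L where "L = left_op (coxeter_word 0 \<kappa>)"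
  define X where "X a = op_trace n (symmetrizer right_T a * right_word [Suc a..<n] * L)" for a
  define Y where "Y a = op_trace n (symmetrizer right_T a * right_word [a..<n] * L)" for a
  have pL: "preserves_support n L" unfolding L_def using set_coxeter_word[of 0 \<kappa>] assms by (intro preserves_support_lop) auto
  \<comment> \<open>Expand the symmetrizer by one factor \<open>1 + T_a E_a\<close> with
    \<open>E_a = sym_factor right_T a\<close>. \<open>E_a\<close> commutes with the later letters
    and with \<open>L\<close>; cyclicity brings it in front of the smaller symmetrizer, where it
    becomes the scalar \<open>q_int a\<close>.\<close>
  have step: "Y (Suc a) = X a + q_int a * Y a" if a: "a < n" for a
  proof (cases "a = 0")
    \<comment> \<open>\<open>Y 0\<close> contains \<open>right_T 0\<close>, the operator of no
      generator; its coefficient is \<open>q_int 0 = 0\<close>.\<close>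
    case True
    then show ?thesis by (simp add: X_def Y_def)
  next
    case False
    let ?w = "right_word [Suc a..<n]"
    have w: "right_word [a..<n] = right_T a * ?w" using a by (simp add: upt_conv_Cons)
    have ew: "sym_factor right_T a * ?w = ?w * sym_factor right_T a" by (rule right_word_EE) auto
    have eL: "sym_factor right_T a * L = L * sym_factor right_T a" unfolding L_def by (rule left_op_commute_sym(1)[symmetric])
    have "symmetrizer right_T (Suc a) * ?w * L = symmetrizer right_T a * ?w * L + symmetrizer right_T a * right_T a * (sym_factor right_T a * ?w) * L"
      by (simp add: distrib_left distrib_right mult.assoc)
    also have "symmetrizer right_T a * right_T a * (sym_factor right_T a * ?w) * L = symmetrizer right_T a * right_T a * ?w * (sym_factor right_T a * L)"
      unfolding ew by (simp only: mult.assoc)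
    also have "\<dots> = (symmetrizer right_T a * right_word [a..<n] * L) * sym_factor right_T a"
      unfolding eL w by (simp only: mult.assoc)
    finally have "Y (Suc a) = X a + op_trace n ((symmetrizer right_T a * right_word [a..<n] * L) * sym_factor right_T a)"
      by (simp add: X_def Y_def op_trace_add del: symmetrizer.simps)
    also have "op_trace n ((symmetrizer right_T a * right_word [a..<n] * L) * sym_factor right_T a) = op_trace n (sym_factor right_T a * (symmetrizer right_T a * right_word [a..<n] * L))"
      using a False by (intro op_trace_commute preserves_support_mult preserves_support_sym preserves_support_rword pL preserves_support_EE) auto
    also have "sym_factor right_T a * (symmetrizer right_T a * right_word [a..<n] * L) = scal (q_int a) * (symmetrizer right_T a * right_word [a..<n] * L)"
      using sym_factor_left_eigen[of a "symmetrizer right_T a"] sym_left[of _ a] by (simp flip: mult.assoc)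
    finally show ?thesis by (simp add: op_trace_scal Y_def)
  qed
  \<comment> \<open>Division by quantum factorials makes the recursion telescope; \<open>Y n\<close>
    is the trace with the full symmetrizer.\<close>
  have "Y (Suc b) / q_fact b = (\<Sum>a<Suc b. X a / q_fact a)" if "b < n" for b
    using that
  proof (induction b)
    case 0
    then show ?case using step[of 0] by simp
  next
    case (Suc b)
    have "Y (Suc (Suc b)) / q_fact (Suc b) = X (Suc b) / q_fact (Suc b) + Y (Suc b) / q_fact b"
      using step[of "Suc b"] Suc.prems q_int_ne_0[of "Suc b"] q_fact_ne_0[of b]
      by (simp add: add_divide_distrib del: q_int.simps)
    then show ?case using Suc by (simp del: q_fact.simps)
  qed
  from this[of "n - 1"] have "Y n / q_fact (n - 1) = (\<Sum>a<n. X a / q_fact a)" using assms by simp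
  moreover have "Y n / q_fact (n - 1) = q_int n * Y n / q_fact n"
    using assms(2) q_int_ne_0[of n] q_fact_ne_0[of "n - 1"] by (cases n) (simp_all del: q_int.simps)
  ultimately show ?thesis by (simp add: op_bitrace_tr X_def Y_def L_def)
qed

section \<open>The anti-automorphism and the trace of the symmetrizer\<close>

text \<open>Reversing words alone would turn \<open>T_i c_i = c_{i+1} T_i\<close> into
  \<open>c_i T_i = T_i c_{i+1}\<close>, which is false by the correction terms in
  \<open>hc_cong_CT\<close>. Reversing the indices as well sends the relation to another instance of
  itself.\<close>

definition theta_letter :: "nat \<Rightarrow> hc_gen \<Rightarrow> hc_gen" where
  "theta_letter n g = (case g of T_gen i \<Rightarrow> T_gen (n - i) | C_gen i \<Rightarrow> C_gen (Suc n - i))"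

definition theta :: "nat \<Rightarrow> hc_free \<Rightarrow> hc_free" where
  "theta n = free_scalar.ext (\<lambda>w. mon (rev (map (theta_letter n) (letters w))))"

lemma theta_mult: "theta n (p * r) = theta n r * theta n p"
  unfolding theta_def by (rule free_scalar.ext_antihom) (simp add: plus_hc_word_def mon_append)

lemma theta_zero [simp]: "theta n 0 = 0"
  and theta_add: "theta n (p + r) = theta n p + theta n r"
  and theta_diff: "theta n (p - r) = theta n p - theta n r"
  and theta_uminus: "theta n (- p) = - theta n p"
  and theta_sum: "theta n (sum f S) = (\<Sum>i\<in>S. theta n (f i))"
  by (simp_all add: theta_def free_scalar.ext_add free_scalar.ext_diff free_scalar.ext_uminus free_scalar.ext_sum)

lemma theta_mon: "theta n (mon l) = mon (rev (map (theta_letter n) l))"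
  by (simp add: theta_def mon_def free_scalar.ext_single)

lemma theta_gen: "theta n (free_gen g) = free_gen (theta_letter n g)"
  using theta_mon[of n "[g]"] by (simp add: mon_def free_gen_def)

lemma theta_T: "theta n (free_T i) = free_T (n - i)" and theta_C: "theta n (free_C i) = free_C (Suc n - i)"
  by (simp_all add: theta_gen theta_letter_def)

lemma theta_scalar: "theta n (free_scalar a) = free_scalar a"
  by (simp add: theta_def free_scalar_def free_scalar.ext_single zero_hc_word_def)

lemma theta_one: "theta n 1 = 1"
  using theta_scalar[of n 1] by simp

lemma free_carrier_expand: "p = (\<Sum>w\<in>Poly_Mapping.keys p. free_scalar (Poly_Mapping.lookup p w) * mon (letters w))"
  by (simp flip: single_eq_mon poly_mapping_eq_sum_single)

lemma theta_expand: "theta n p = (\<Sum>w\<in>Poly_Mapping.keys p. free_scalar (Poly_Mapping.lookup p w) * mon (rev (map (theta_letter n) (letters w))))"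
  by (simp add: theta_def free_scalar.ext_def)

lemma theta_letter_gens: "g \<in> gens n \<Longrightarrow> theta_letter n g \<in> gens n" "g \<in> gens n \<Longrightarrow> theta_letter n (theta_letter n g) = g"
  by (auto simp: gens_def theta_letter_def image_iff)

lemma theta_free_carrier [intro]: "p \<in> free_carrier n \<Longrightarrow> theta n p \<in> free_carrier n"
  unfolding theta_expand using theta_letter_gens(1)
  by (intro free_carrier_sum free_carrier_mult free_carrier_scalar free_carrier_mon) (fastforce simp: free_carrier_iff)

lemma theta_theta:
  assumes "p \<in> free_carrier n"
  shows "theta n (theta n p) = p"
proof -
  have "theta n (theta n p) = (\<Sum>w\<in>Poly_Mapping.keys p. free_scalar (Poly_Mapping.lookup p w) * mon (letters w))"
    unfolding theta_expand[of n p] theta_sum theta_mult theta_mon theta_scalar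
  proof (rule sum.cong[OF refl])
    fix w assume w: "w \<in> Poly_Mapping.keys p"
    then have "map (theta_letter n) (map (theta_letter n) (letters w)) = letters w"
      unfolding map_map by (intro map_idI) (use assms theta_letter_gens(2) in \<open>auto simp: free_carrier_iff\<close>)
    then show "mon (rev (map (theta_letter n) (rev (map (theta_letter n) (letters w))))) * free_scalar (Poly_Mapping.lookup p w) =
        free_scalar (Poly_Mapping.lookup p w) * mon (letters w)"
      by (simp add: rev_map free_scalar_commute)
  qed
  then show ?thesis using free_carrier_expand[of p] by simp
qed

lemma theta_relators:
  assumes "x \<in> relators n"
  shows "theta n x \<in> hc_ideal n"
proof -
  have 1: "(free_T i + 1) * (free_T i - free_scalar q) \<in> hc_ideal n" if "i \<in> {1..<n}" for i
  proof -
    have "(free_T i + 1) * (free_T i - free_scalar q) = (free_T i - free_scalar q) * (free_T i + 1)"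
      using free_scalar_commute[of q "free_T i"] by (simp add: algebra_simps)
    then show ?thesis using that by (auto intro!: hc_ideal_relators simp: relators_def)
  qed
  consider i where "i \<in> {1..<n}" "x = (free_T i - free_scalar q) * (free_T i + 1)"
    | i j where "i \<in> {1..<n}" "j \<in> {1..<n}" "\<bar>int i - int j\<bar> > 1" "x = free_T i * free_T j - free_T j * free_T i"
    | i where "i \<in> {1..<n}" "i + 1 \<in> {1..<n}" "x = free_T i * free_T (i + 1) * free_T i - free_T (i + 1) * free_T i * free_T (i + 1)"
    | i where "i \<in> {1..n}" "x = free_C i * free_C i - 1"
    | i j where "i \<in> {1..n}" "j \<in> {1..n}" "i \<noteq> j" "x = free_C i * free_C j + free_C j * free_C i"
    | i j where "i \<in> {1..<n}" "j \<in> {1..n}" "j \<noteq> i" "j \<noteq> i + 1" "x = free_T i * free_C j - free_C j * free_T i"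
    | i where "i \<in> {1..<n}" "x = free_T i * free_C i - free_C (i + 1) * free_T i"
    using assms unfolding relators_def by blast
  then show ?thesis
  proof cases
    case 1
    then show ?thesis using \<open>\<And>i. i \<in> {1..<n} \<Longrightarrow> _ \<in> hc_ideal n\<close>[of "n - i"]
      by (auto simp: theta_mult theta_diff theta_add theta_T theta_scalar theta_one)
  next
    case 2
    have "Suc (n - j) < n - i \<or> Suc (n - i) < n - j" using 2 by auto
    with 2 show ?thesis using hc_cong_far[of "n - j" n "n - i"]
      by (auto simp: theta_mult theta_diff theta_T hc_cong_def)
  next
    case 3
    then have "n - i = Suc (n - (i + 1))" by auto
    then show ?thesis using 3 hc_cong_sym[OF hc_cong_braid[of "n - (i + 1)" n]]
      by (auto simp: theta_mult theta_diff theta_T hc_cong_def mult.assoc)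
  next
    case 4
    then have "Suc n - i \<in> {1..n}" by auto
    with 4 show ?thesis using hc_cong_CC[of "Suc n - i" n]
      by (auto simp: theta_mult theta_diff theta_C hc_cong_def theta_one)
  next
    case 5
    then have "Suc n - j \<in> {1..n}" "Suc n - i \<in> {1..n}" "Suc n - j \<noteq> Suc n - i" by auto
    with 5 show ?thesis using hc_cong_anti[of "Suc n - j" n "Suc n - i"]
      by (auto simp: theta_mult theta_add theta_C hc_cong_def)
  next
    case 6
    then have "n - i \<in> {1..<n}" "Suc n - j \<in> {1..n}" "Suc n - j \<noteq> n - i" "Suc n - j \<noteq> Suc (n - i)" by auto
    with 6 show ?thesis using hc_cong_sym[OF hc_cong_TC_far[of "n - i" n "Suc n - j"]]
      by (auto simp: theta_mult theta_diff theta_T theta_C hc_cong_def)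
  next
    case 7
    then have "Suc n - i = Suc (n - i)" "Suc n - (i + 1) = n - i" by auto
    then show ?thesis using 7 hc_cong_sym[OF hc_cong_TC[of "n - i" n]]
      by (auto simp: theta_mult theta_diff theta_T theta_C hc_cong_def)
  qed
qed

lemma theta_ideal:
  assumes "x \<in> hc_ideal n"
  shows "theta n x \<in> hc_ideal n"
proof -
  have "hc_ideal n \<subseteq> {p \<in> free_carrier n. theta n p \<in> hc_ideal n}"
    using relators_subset[of n] theta_free_carrier
    by (intro hc_ideal_minimal)
      (auto simp: theta_add theta_uminus theta_mult theta_relators
        intro: hc_ideal_add hc_ideal_uminus hc_ideal_left hc_ideal_right)
  then show ?thesis using assms by blast
qed

section \<open>The anti-automorphism as an operator on coordinates\<close>

definition theta_op :: "nat \<Rightarrow> (nat \<Rightarrow> site) linop" where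
  "theta_op n = Linop (\<lambda>f x. \<Sum>c\<in>basis_index n. f (state_of c) * eval_free n (theta n (basis_lift n c)) x)"

lemma app_theta_op: "app (theta_op n) f x = (\<Sum>c\<in>basis_index n. f (state_of c) * eval_free n (theta n (basis_lift n c)) x)"
proof -
  have "app (theta_op n) = (\<lambda>f x. \<Sum>c\<in>basis_index n. f (state_of c) * eval_free n (theta n (basis_lift n c)) x)"
    unfolding theta_op_def
    by (rule Linop_inverse) (simp add: sum.distrib distrib_right sum_distrib_left mult.assoc)
  then show ?thesis by simp
qed

abbreviation supp :: "nat \<Rightarrow> ((nat \<Rightarrow> site) \<Rightarrow> hc_field) \<Rightarrow> bool" where
  "supp n f \<equiv> (\<forall>x. x \<notin> state_of ` basis_index n \<longrightarrow> f x = 0)"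

lemma supp_eval_free: "p \<in> free_carrier n \<Longrightarrow> supp n (eval_free n p)"
  using eval_free_support by blast

lemma supp_lift:
  assumes "supp n f"
  shows "\<exists>p\<in>free_carrier n. p = (\<Sum>c\<in>basis_index n. free_scalar (f (state_of c)) * basis_lift n c) \<and> eval_free n p = f"
proof -
  let ?p = "\<Sum>c\<in>basis_index n. free_scalar (f (state_of c)) * basis_lift n c"
  have "eval_free n ?p = (\<lambda>x. \<Sum>d\<in>basis_index n. f (state_of d) * delta (state_of d) x)"
    unfolding eval_free_sum eval_free_scalar by (auto simp: eval_free_bas intro!: sum.cong ext)
  also have "\<dots> = f" using assms by (intro expand_delta[symmetric]) auto
  finally show ?thesis by (auto intro!: free_carrier_sum free_carrier_mult basis_lift_FA)
qed

text \<open>\<open>theta_op\<close> is defined through the representatives of basis elements. That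
  any other representative gives the same result is the invariance of the ideal under
  \<open>theta\<close>.\<close>

lemma theta_op_ev:
  assumes "p \<in> free_carrier n"
  shows "app (theta_op n) (eval_free n p) = eval_free n (theta n p)"
proof -
  let ?r = "\<Sum>c\<in>basis_index n. free_scalar (eval_free n p (state_of c)) * basis_lift n c"
  have r: "?r \<in> free_carrier n" "eval_free n ?r = eval_free n p" using supp_lift[OF supp_eval_free[OF assms]] by auto
  then have "p - ?r \<in> hc_ideal n" using eval_free_inj[OF assms r(1)] by (simp add: hc_cong_def)
  then have "hc_cong n (theta n p) (theta n ?r)"
    using theta_ideal by (fastforce simp: hc_cong_def theta_diff)
  then have "eval_free n (theta n p) = eval_free n (theta n ?r)" by (rule eval_free_cong)
  also have "\<dots> = app (theta_op n) (eval_free n p)"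
    by (simp add: fun_eq_iff app_theta_op theta_sum theta_mult theta_scalar eval_free_sum eval_free_scalar flip: free_scalar_commute)
  finally show ?thesis by simp
qed

lemma theta_op_supp: "supp n f \<Longrightarrow> supp n (app (theta_op n) f)"
proof -
  assume "supp n f"
  then obtain p where p: "p \<in> free_carrier n" "eval_free n p = f" using supp_lift by blast
  then have "app (theta_op n) f = eval_free n (theta n p)" using theta_op_ev[OF p(1)] by simp
  then show ?thesis using supp_eval_free[OF theta_free_carrier[OF p(1)]] by simp
qed

lemma preserves_support_Th: "preserves_support n (theta_op n)"
  unfolding preserves_support_def using theta_op_supp by blast

lemma theta_op_Th: "supp n f \<Longrightarrow> app (theta_op n) (app (theta_op n) f) = f"
proof -
  assume "supp n f"
  then obtain p where p: "p \<in> free_carrier n" "eval_free n p = f" using supp_lift by blast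
  then have "app (theta_op n) f = eval_free n (theta n p)" using theta_op_ev[OF p(1)] by simp
  then show ?thesis using p by (simp add: theta_op_ev theta_free_carrier theta_theta)
qed

lemma theta_op_rT:
  assumes "supp n f" "1 \<le> i" "i < n"
  shows "app (theta_op n) (app (right_T i) f) = app (left_T (n - i)) (app (theta_op n) f)"
proof -
  obtain p where p: "p \<in> free_carrier n" "eval_free n p = f" using supp_lift[OF assms(1)] by blast
  have T: "free_T i \<in> free_carrier n" using assms by simp
  have "app (right_T i) f = eval_free n (p * free_T i)" by (simp add: eval_free_mult Phi_T p)
  then have "app (theta_op n) (app (right_T i) f) = eval_free n (theta n (p * free_T i))"
    using theta_op_ev[OF free_carrier_mult[OF p(1) T]] by simp
  also have "\<dots> = app (left_T (n - i)) (eval_free n (theta n p))"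
    by (simp add: theta_mult theta_T eval_free_T_left)
  also have "eval_free n (theta n p) = app (theta_op n) f" using theta_op_ev[OF p(1)] unfolding p(2) ..
  finally show ?thesis .
qed

lemma theta_op_lT:
  assumes "supp n f" "1 \<le> i" "i < n"
  shows "app (theta_op n) (app (left_T i) f) = app (right_T (n - i)) (app (theta_op n) f)"
proof -
  obtain p where p: "p \<in> free_carrier n" "eval_free n p = f" using supp_lift[OF assms(1)] by blast
  have T: "free_T i \<in> free_carrier n" using assms by simp
  have "app (left_T i) f = eval_free n (free_T i * p)" by (simp add: eval_free_T_left p)
  then have "app (theta_op n) (app (left_T i) f) = eval_free n (theta n (free_T i * p))"
    using theta_op_ev[OF free_carrier_mult[OF T p(1)]] by simp
  also have "\<dots> = app (right_T (n - i)) (eval_free n (theta n p))"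
    by (simp add: theta_mult theta_T eval_free_mult Phi_T)
  also have "eval_free n (theta n p) = app (theta_op n) f" using theta_op_ev[OF p(1)] unfolding p(2) ..
  finally show ?thesis .
qed

lemma supp_delta: "c \<in> basis_index n \<Longrightarrow> supp n (delta (state_of c))"
  by (auto simp: delta_def)

lemma supp_left_word:
  assumes "supp n f" "set w \<subseteq> {1..<n}"
  shows "supp n (left_word w f)"
  using preserves_support_lop[OF assms(2)] assms(1) unfolding preserves_support_def app_left_op by blast

lemma supp_right_word:
  assumes "supp n f" "set w \<subseteq> {1..<n}"
  shows "supp n (app (right_word w) f)"
  using preserves_support_rword[OF assms(2)] assms(1) unfolding preserves_support_def by blast

lemma theta_op_lword:
  assumes "supp n f" "set w \<subseteq> {1..<n}"
  shows "app (theta_op n) (left_word w f) = app (right_word (rev (map (\<lambda>i. n - i) w))) (app (theta_op n) f)"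
  using assms(2)
proof (induction w)
  case (Cons i w)
  then show ?case using theta_op_lT[OF supp_left_word[OF assms(1)], of w i] by simp
qed simp

text \<open>In the algebra \<open>theta (theta p h) = theta h p\<close>, so conjugation turns right
  multiplication by the symmetrizer \<open>h\<close> into left multiplication by its image.\<close>

definition theta_sym :: "nat \<Rightarrow> (nat \<Rightarrow> site) linop" where
  "theta_sym n = theta_op n * symmetrizer right_T n * theta_op n"

lemma supp_symmetrizer: "supp n f \<Longrightarrow> supp n (app (symmetrizer right_T n) f)"
  using preserves_support_sym[of n n] unfolding preserves_support_def by blast

lemma theta_sym_lT:
  assumes "supp n f" "1 \<le> i" "i < n"
  shows "app (left_T i) (app (theta_sym n) f) = (\<lambda>x. q * app (theta_sym n) f x)"
proof -
  let ?g = "app (theta_op n) f"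
  have "app (left_T i) (app (theta_sym n) f) = app (theta_op n) (app (right_T (n - i)) (app (symmetrizer right_T n) ?g))"
    using theta_op_rT[OF supp_symmetrizer[OF theta_op_supp[OF assms(1)]], of "n - i"] assms by (simp add: theta_sym_def)
  also have "app (right_T (n - i)) (app (symmetrizer right_T n) ?g) = app (symmetrizer right_T n * right_T (n - i)) ?g" by simp
  also have "\<dots> = (\<lambda>x. q * app (symmetrizer right_T n) ?g x)"
    using assms by (subst sym_right) auto
  finally show ?thesis by (simp add: theta_sym_def)
qed

lemma theta_sym_rT:
  assumes "supp n f" "1 \<le> i" "i < n"
  shows "app (theta_sym n) (app (right_T i) f) = app (right_T i) (app (theta_sym n) f)"
proof -
  let ?g = "app (theta_op n) f"
  have c: "app (symmetrizer right_T n) (app (left_T k) h) = app (left_T k) (app (symmetrizer right_T n) h)" for k h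
    using left_op_commute_sym(2)[of "[k]" n] by (simp add: left_op_def) (metis app_times)
  show ?thesis
    using assms theta_op_rT[OF assms] theta_op_lT[OF supp_symmetrizer[OF theta_op_supp[OF assms(1)]], of "n - i"]
    by (simp add: theta_sym_def c)
qed

lemma theta_sym_rword:
  assumes "supp n f" "set w \<subseteq> {1..<n}"
  shows "app (theta_sym n) (app (right_word w) f) = app (right_word w) (app (theta_sym n) f)"
  using assms
proof (induction w arbitrary: f)
  case (Cons i w)
  have "supp n (app (right_T i) f)" using preserves_support_rT[of i n] Cons.prems unfolding preserves_support_def by auto
  then show ?case using Cons theta_sym_rT[of n f i] by simp
qed simp

text \<open>At an ascent the equation reads \<open>q F' = q F\<close>, at a descent
  \<open>F' + (q - 1) F = q F\<close>, where \<open>F'\<close> is the value after exchanging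
  \<open>i\<close> and \<open>i + 1\<close>. In both cases \<open>F' = F\<close>.\<close>

lemma eigen_const:
  assumes F: "\<And>i. 1 \<le> i \<Longrightarrow> i < n \<Longrightarrow> app (left_T i) F = (\<lambda>x. q * F x)"
    and c: "\<sigma> permutes {1..n}"
  shows "F (state_of (\<sigma>, I)) = F (state_of (id, I))"
proof -
  obtain w where w: "w \<in> canon_words n" "word_perm w = \<sigma>" using word_perm_CW_surj[OF c] by blast
  have "F (state_of (word_perm w, I)) = F (state_of (id, I))"
    using canon_words_letters[OF w(1)]
  proof (induction w)
    case (Cons i w)
    let ?x = "state_of (word_perm (i # w), I)"
    have m: "swap_values i ?x = state_of (word_perm w, I)" by (simp add: swap_values_def state_of_def)
    have b: "bij (\<lambda>k. fst (?x k))" using bij_word_perm[of "i # w"] by (simp add: state_of_def comp_def)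
    have "app (left_T i) F ?x = q * F ?x" using F[of i] Cons.prems by simp
    then have "F (swap_values i ?x) = F ?x" using b by (auto simp: left_T.rep_eq algebra_simps split: if_splits)
    then show ?case using Cons m by (simp add: comp_def)
  qed (simp add: id_def)
  then show ?thesis by (simp add: w)
qed

section \<open>The remaining trace on the Clifford algebra\<close>

definition bit_T :: "nat \<Rightarrow> (nat set \<Rightarrow> hc_field) \<Rightarrow> nat set \<Rightarrow> hc_field" where
  "bit_T j h I = (let u = (\<lambda>a b. {k. if k = j then a else if k = Suc j then b else k \<in> I}) in
     if j \<in> I then if Suc j \<in> I then - h (u True True) else q * h (u False True) + (q - 1) * h (u True False)
     else if Suc j \<in> I then h (u True False) else q * h (u False False) + (q - 1) * h (u True True))"

text \<open>Functions that do not depend on the permutation. By \<open>eigen_const\<close> this is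
  where left symmetrization lands.\<close>

definition bit_lift :: "nat \<Rightarrow> (nat set \<Rightarrow> hc_field) \<Rightarrow> (nat \<Rightarrow> site) \<Rightarrow> hc_field" where
  "bit_lift n h x = (if x \<in> state_of ` basis_index n then h {k. snd (x k)} else 0)"

lemma bit_lift_emb: "c \<in> basis_index n \<Longrightarrow> bit_lift n h (state_of c) = h (snd c)"
  by (cases c) (auto simp: bit_lift_def state_of_def)

lemma supp_bit_lift: "supp n (bit_lift n h)"
  by (simp add: bit_lift_def)

lemma supp_eqI: "supp n f \<Longrightarrow> supp n g \<Longrightarrow> (\<And>c. c \<in> basis_index n \<Longrightarrow> f (state_of c) = g (state_of c)) \<Longrightarrow> f = g"
  by (rule ext) (metis imageE)

text \<open>On functions constant in the permutation, the ascent and the descent branch of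
  \<open>local_T\<close> both reduce to \<open>q\<close> times the value; substituting this gives
  \<open>bit_T\<close>.\<close>

lemma right_T_bfun:
  assumes "1 \<le> j" "j < n"
  shows "app (right_T j) (bit_lift n h) = bit_lift n (bit_T j h)"
proof (rule supp_eqI[of n])
  show "supp n (app (right_T j) (bit_lift n h))" using preserves_support_rT[OF assms] supp_bit_lift[of n h] unfolding preserves_support_def by blast
  show "supp n (bit_lift n (bit_T j h))" by (rule supp_bit_lift)
  fix c assume c: "c \<in> basis_index n"
  have "bit_lift n h (set_sites j (state_of c) s a b) = h {k. if k = j then a else if k = Suc j then b else k \<in> snd c}" for s a b
    using bit_lift_emb[OF set_sites_index_index[OF c assms], of h s a b] by (simp add: state_of_updc) (simp add: set_sites_index_def)
  then show "app (right_T j) (bit_lift n h) (state_of c) = bit_lift n (bit_T j h) (state_of c)"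
    unfolding right_T.rep_eq bit_lift_emb[OF c]
    by (cases c) (simp add: local_T_def bit_T_def state_of_def Let_def algebra_simps)
qed

definition bit_word :: "nat list \<Rightarrow> (nat set \<Rightarrow> hc_field) \<Rightarrow> nat set \<Rightarrow> hc_field" where
  "bit_word w = fold bit_T w"

lemma right_word_bfun: "set w \<subseteq> {1..<n} \<Longrightarrow> app (right_word w) (bit_lift n h) = bit_lift n (bit_word w h)"
  by (induction w arbitrary: h) (simp_all add: bit_word_def right_T_bfun)

lemma left_T_bfun:
  assumes "1 \<le> i" "i < n"
  shows "app (left_T i) (bit_lift n h) = (\<lambda>x. q * bit_lift n h x)"
proof (rule supp_eqI[of n])
  show "supp n (app (left_T i) (bit_lift n h))" using preserves_support_lT[OF assms] supp_bit_lift[of n h] unfolding preserves_support_def by blast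
  show "supp n (\<lambda>x. q * bit_lift n h x)" by (simp add: bit_lift_def)
  fix c assume c: "c \<in> basis_index n"
  obtain \<sigma> I where s: "c = (\<sigma>, I)" "\<sigma> permutes {1..n}" "I \<subseteq> {1..n}" using c by (auto simp: basis_index_def)
  have "transpose i (Suc i) \<circ> \<sigma> permutes {1..n}"
    using assms by (intro permutes_compose[OF s(2)] permutes_swap_id) auto
  then have d: "(transpose i (Suc i) \<circ> \<sigma>, I) \<in> basis_index n" using s by (simp add: basis_index_def)
  have "swap_values i (state_of c) = state_of (transpose i (Suc i) \<circ> \<sigma>, I)" by (simp add: swap_values_def state_of_def s)
  then have "bit_lift n h (swap_values i (state_of c)) = bit_lift n h (state_of c)"
    using bit_lift_emb[OF c] bit_lift_emb[OF d] by (simp add: s)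
  moreover have "bij (\<lambda>k. fst (state_of c k))" using permutes_bij[OF s(2)] by (simp add: state_of_def s)
  ultimately show "app (left_T i) (bit_lift n h) (state_of c) = q * bit_lift n h (state_of c)"
    by (simp add: left_T.rep_eq algebra_simps)
qed

lemma app_symz_eigen:
  assumes "\<And>i. 0 < i \<Longrightarrow> i < a \<Longrightarrow> app (right_T i) g = (\<lambda>x. q * g x)"
  shows "app (symmetrizer right_T a) g = (\<lambda>x. q_fact a * g x)"
proof -
  have E: "app (sym_factor right_T b) g = (\<lambda>x. q_int b * g x)" if "b \<le> a" for b
    using that
  proof (induction b)
    case (Suc b)
    then show ?case using assms[of b] by (cases "b = 0") (simp_all add: algebra_simps)
  qed simp
  have "app (symmetrizer right_T b) g = (\<lambda>x. q_fact b * g x)" if "b \<le> a" for b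
    using that
  proof (induction b)
    case (Suc b)
    then show ?case unfolding symmetrizer.simps app_times using E[of "Suc b"] by (simp add: mult_ac del: sym_factor.simps q_int.simps)
  qed simp
  then show ?thesis by simp
qed

lemma theta_sym_bfun: "app (theta_sym n) (bit_lift n h) = (\<lambda>x. q_fact n * bit_lift n h x)"
proof -
  let ?g = "app (theta_op n) (bit_lift n h)"
  have "app (right_T i) ?g = (\<lambda>x. q * ?g x)" if "0 < i" "i < n" for i
    using theta_op_lT[OF supp_bit_lift, of "n - i" n h] left_T_bfun[of "n - i" n h] that by simp
  then have "app (symmetrizer right_T n) ?g = (\<lambda>x. q_fact n * ?g x)" by (rule app_symz_eigen)
  then show ?thesis by (simp add: theta_sym_def theta_op_Th supp_bit_lift)
qed

text \<open>Conjugation by \<open>theta_op\<close> carries the symmetrizer to the left and the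
  Coxeter element to the right. Symmetrized functions are constant in the permutation, so the
  diagonal entry at \<open>\<sigma>\<close> may be read at \<open>id\<close>; then the sum over
  \<open>\<sigma>\<close> moves inside and produces a function of the bits alone.\<close>

lemma op_bitrace_symz:
  assumes "sum_list \<kappa> = n"
  shows "op_bitrace n \<kappa> (symmetrizer right_T n) = q_fact n * (\<Sum>I\<in>Pow {1..n}. bit_word (rev (map (\<lambda>i. n - i) (coxeter_word 0 \<kappa>))) (delta I) I)"
proof -
  define w where "w = coxeter_word 0 \<kappa>"
  define v where "v = rev (map (\<lambda>i. n - i) w)"
  have w: "set w \<subseteq> {1..<n}" using set_coxeter_word[of 0 \<kappa>] assms by (simp add: w_def)
  then have v: "set v \<subseteq> {1..<n}" by (force simp: v_def)
  let ?R = "symmetrizer right_T n * left_op w"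
  have pR: "preserves_support n ?R" by (intro preserves_support_mult preserves_support_sym preserves_support_lop w order_refl)
  have "op_bitrace n \<kappa> (symmetrizer right_T n) = op_trace n ?R" by (simp add: op_bitrace_tr w_def)
  \<comment> \<open>Insert \<open>theta_op\<close> twice, which is the identity on supported
    functions; cyclicity then moves one copy to the other end.\<close>
  also have "\<dots> = op_trace n (theta_op n * (theta_op n * ?R))"
    unfolding op_trace_def by (rule sum.cong) (simp_all add: theta_op_Th supp_delta)
  also have "\<dots> = op_trace n (theta_op n * ?R * theta_op n)"
    by (intro op_trace_commute preserves_support_mult preserves_support_Th pR)
  also have "\<dots> = (\<Sum>c\<in>basis_index n. app (theta_sym n) (app (right_word v) (delta (state_of c))) (state_of c))"
    unfolding op_trace_def
  proof (rule sum.cong[OF refl])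
    fix c assume c: "c \<in> basis_index n"
    let ?g = "app (symmetrizer right_T n) (app (theta_op n) (delta (state_of c)))"
    have "supp n ?g" using supp_symmetrizer theta_op_supp supp_delta c by blast
    then have "app (theta_op n) (left_word w ?g) = app (right_word v) (app (theta_op n) ?g)"
      unfolding v_def using w by (rule theta_op_lword)
    then have "app (theta_op n * ?R * theta_op n) (delta (state_of c)) = app (right_word v) (app (theta_sym n) (delta (state_of c)))"
      by (simp add: app_left_op theta_sym_def)
    then show "app (theta_op n * ?R * theta_op n) (delta (state_of c)) (state_of c) = app (theta_sym n) (app (right_word v) (delta (state_of c))) (state_of c)"
      using theta_sym_rword[OF supp_delta[OF c] v] by simp
  qed
  also have "\<dots> = (\<Sum>\<sigma> | \<sigma> permutes {1..n}. \<Sum>I\<in>Pow {1..n}. app (theta_sym n) (app (right_word v) (delta (state_of (\<sigma>, I)))) (state_of (id, I)))"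
    unfolding basis_index_def sum.cartesian_product
  proof (rule sum.cong[OF refl], clarify)
    fix \<sigma> I assume c: "\<sigma> permutes {1..n}" "I \<subseteq> {1..n}"
    have "supp n (app (right_word v) (delta (state_of (\<sigma>, I))))"
      using c by (intro supp_right_word v supp_delta) (simp add: basis_index_def)
    then show "app (theta_sym n) (app (right_word v) (delta (state_of (\<sigma>, I)))) (state_of (\<sigma>, I)) = app (theta_sym n) (app (right_word v) (delta (state_of (\<sigma>, I)))) (state_of (id, I))"
      using theta_sym_lT c by (intro eigen_const[of n]) auto
  qed
  also have "\<dots> = (\<Sum>I\<in>Pow {1..n}. \<Sum>\<sigma> | \<sigma> permutes {1..n}. app (theta_sym n) (app (right_word v) (delta (state_of (\<sigma>, I)))) (state_of (id, I)))"
    by (rule sum.swap)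
  also have "\<dots> = (\<Sum>I\<in>Pow {1..n}. q_fact n * bit_word v (delta I) I)"
  proof (rule sum.cong[OF refl])
    fix I assume I: "I \<in> Pow {1..n}"
    have "(\<lambda>x. \<Sum>\<sigma> | \<sigma> permutes {1..n}. delta (state_of (\<sigma>, I)) x) = bit_lift n (delta I)"
    proof (rule supp_eqI[of n])
      show "supp n (\<lambda>x. \<Sum>\<sigma> | \<sigma> permutes {1..n}. delta (state_of (\<sigma>, I)) x)"
      proof (intro allI impI sum.neutral ballI)
        fix x \<sigma> assume "x \<notin> state_of ` basis_index n" "\<sigma> \<in> {\<sigma>. \<sigma> permutes {1..n}}"
        then show "delta (state_of (\<sigma>, I)) x = 0" using I by (intro delta_notin[of _ n]) (simp_all add: basis_index_def)
      qed
      show "supp n (bit_lift n (delta I))" by (rule supp_bit_lift)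
      fix c assume c: "c \<in> basis_index n"
      have "(\<Sum>\<sigma> | \<sigma> permutes {1..n}. delta (state_of (\<sigma>, I)) (state_of c)) = (\<Sum>\<sigma> | \<sigma> permutes {1..n}. if \<sigma> = fst c then delta I (snd c) else 0)"
        by (rule sum.cong) (auto simp: delta_def)
      also have "\<dots> = delta I (snd c)"
        using c by (subst sum.delta) (auto simp: basis_index_def finite_permutations)
      finally show "(\<Sum>\<sigma> | \<sigma> permutes {1..n}. delta (state_of (\<sigma>, I)) (state_of c)) = bit_lift n (delta I) (state_of c)"
        by (simp add: bit_lift_emb[OF c])
    qed
    moreover have "(\<Sum>\<sigma> | \<sigma> permutes {1..n}. app (theta_sym n) (app (right_word v) (delta (state_of (\<sigma>, I)))) (state_of (id, I)))
        = app (theta_sym n) (app (right_word v) (\<lambda>x. \<Sum>\<sigma> | \<sigma> permutes {1..n}. delta (state_of (\<sigma>, I)) x)) (state_of (id, I))"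
      by (simp add: app_sum)
    ultimately have "(\<Sum>\<sigma> | \<sigma> permutes {1..n}. app (theta_sym n) (app (right_word v) (delta (state_of (\<sigma>, I)))) (state_of (id, I)))
        = q_fact n * bit_lift n (bit_word v (delta I)) (state_of (id, I))"
      by (simp add: right_word_bfun[OF v] theta_sym_bfun)
    also have "\<dots> = q_fact n * bit_word v (delta I) I"
      using I by (subst bit_lift_emb) (auto simp: basis_index_def permutes_id)
    finally show "(\<Sum>\<sigma> | \<sigma> permutes {1..n}. app (theta_sym n) (app (right_word v) (delta (state_of (\<sigma>, I)))) (state_of (id, I))) = q_fact n * bit_word v (delta I) I" .
  qed
  finally show ?thesis by (simp add: sum_distrib_left v_def w_def)
qed

text \<open>The diagonal coefficient of \<open>bit_T j\<close>, with the bit at \<open>j + 1\<close>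
  as first and the bit at \<open>j\<close> as second argument.\<close>

definition pair_weight :: "bool \<Rightarrow> bool \<Rightarrow> hc_field" where
  "pair_weight a b = (if a then if b then - 1 else 0 else if b then q - 1 else q)"

lemma bit_word_support:
  assumes "k \<notin> set w" "k \<notin> Suc ` set w" "\<And>J. (k \<in> J \<longleftrightarrow> k \<in> I) \<Longrightarrow> h J = 0"
  shows "bit_word w h I = 0"
  using assms
proof (induction w arbitrary: I rule: rev_induct)
  case (snoc j w)
  have "bit_word w h J = 0" if "k \<in> J \<longleftrightarrow> k \<in> I" for J
    using snoc.prems that by (intro snoc.IH) auto
  then show ?case using snoc.prems by (auto simp: bit_word_def bit_T_def Let_def)
qed (simp add: bit_word_def)

text \<open>Every off-diagonal term of \<open>bit_T j\<close> flips the bit at \<open>j + 1\<close>.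
  The letters applied before are smaller than \<open>j\<close> and cannot touch that site, so only
  diagonal terms survive.\<close>

lemma bit_word_diag:
  assumes "sorted_wrt (<) w"
  shows "bit_word w (delta I) I = (\<Prod>j\<in>set w. pair_weight (Suc j \<in> I) (j \<in> I))"
  using assms
proof (induction w rule: rev_induct)
  case (snoc j w)
  let ?H = "bit_word w (delta I)"
  have lt: "\<forall>i\<in>set w. i < j" and IH: "?H I = (\<Prod>j\<in>set w. pair_weight (Suc j \<in> I) (j \<in> I))"
    using snoc by (auto simp: sorted_wrt_append)
  have z: "?H J = 0" if "(Suc j \<in> J) \<noteq> (Suc j \<in> I)" for J
    by (rule bit_word_support[of "Suc j"]) (use lt that in \<open>auto simp: delta_def\<close>)
  have u: "{k. if k = j then a else if k = Suc j then b else k \<in> I} = I" if "a = (j \<in> I)" "b = (Suc j \<in> I)" for a b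
    using that by auto
  have "bit_word (w @ [j]) (delta I) I = bit_T j ?H I" by (simp add: bit_word_def)
  also have "\<dots> = pair_weight (Suc j \<in> I) (j \<in> I) * ?H I"
    unfolding bit_T_def Let_def pair_weight_def
    using u[of True True] u[of True False] u[of False False] z by (auto simp: u)
  also have "\<dots> = (\<Prod>j\<in>set (w @ [j]). pair_weight (Suc j \<in> I) (j \<in> I))"
    using lt IH by (subst set_append) (auto simp: Un_commute)
  finally show ?case .
qed (simp add: bit_word_def delta_def)

fun block_weight :: "bool list \<Rightarrow> hc_field" where
  "block_weight (a # b # L) = pair_weight a b * block_weight (b # L)"
| "block_weight L = 1"

fun comp_weight :: "nat list \<Rightarrow> bool list \<Rightarrow> hc_field" where
  "comp_weight [] L = 1"
| "comp_weight (m # \<kappa>) L = block_weight (take m L) * comp_weight \<kappa> (drop m L)"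

definition spin_trace :: "nat \<Rightarrow> hc_field" where
  "spin_trace m = (\<Sum>L | length L = m. block_weight L)"

lemma sum_comp_weight: "(\<Sum>L | length L = sum_list \<kappa>. comp_weight \<kappa> L) = (\<Prod>m\<leftarrow>\<kappa>. spin_trace m)"
proof (induction \<kappa>)
  case (Cons m \<kappa>)
  have "(\<Sum>L | length L = sum_list (m # \<kappa>). comp_weight (m # \<kappa>) L) = (\<Sum>L | length L = m. block_weight L * (\<Sum>L' | length L' = sum_list \<kappa>. comp_weight \<kappa> L'))"
    by (simp add: sum_lists_append sum_distrib_left)
  then show ?case by (simp add: Cons spin_trace_def sum_distrib_right)
qed simp

lemma block_weight_prod: "length L = m \<Longrightarrow> (\<Prod>i\<leftarrow>[1..<m]. pair_weight (L ! (i - 1)) (L ! i)) = block_weight L"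
proof (induction L arbitrary: m rule: block_weight.induct)
  case (1 a b L)
  then obtain k where k: "m = Suc (Suc k)" "length (b # L) = Suc k" by auto
  have "[1..<m] = 1 # map Suc [1..<Suc k]" unfolding k(1) by (simp add: upt_conv_Cons map_Suc_upt)
  moreover have "(\<Prod>i\<leftarrow>map Suc [1..<Suc k]. pair_weight ((a # b # L) ! (i - 1)) ((a # b # L) ! i)) = (\<Prod>i\<leftarrow>[1..<Suc k]. pair_weight ((b # L) ! (i - 1)) ((b # L) ! i))"
    unfolding map_map by (rule arg_cong[where f = prod_list], rule map_cong) (auto simp: nth_Cons')
  ultimately show ?case using 1(1)[OF k(2)] by simp
qed (simp_all add: upt_rec)

lemma coxeter_word_add: "coxeter_word d \<kappa> = map ((+) d) (coxeter_word 0 \<kappa>)"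
  by (induction d) (simp_all add: coxeter_word_Suc map_idI)

lemma comp_weight_prod: "length L = sum_list \<kappa> \<Longrightarrow> (\<Prod>i\<leftarrow>coxeter_word 0 \<kappa>. pair_weight (L ! (i - 1)) (L ! i)) = comp_weight \<kappa> L"
proof (induction \<kappa> arbitrary: L)
  case (Cons m \<kappa>)
  let ?A = "take m L" and ?B = "drop m L"
  have len: "length ?A = m" "length ?B = sum_list \<kappa>" using Cons.prems by simp_all
  have "(\<Prod>i\<leftarrow>[1..<m]. pair_weight (L ! (i - 1)) (L ! i)) = (\<Prod>i\<leftarrow>[1..<m]. pair_weight (?A ! (i - 1)) (?A ! i))"
    by (rule arg_cong[where f = prod_list], rule map_cong) auto
  also have "\<dots> = block_weight ?A" by (rule block_weight_prod[OF len(1)])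
  moreover have "(\<Prod>i\<leftarrow>coxeter_word m \<kappa>. pair_weight (L ! (i - 1)) (L ! i)) = (\<Prod>i\<leftarrow>coxeter_word 0 \<kappa>. pair_weight (?B ! (i - 1)) (?B ! i))"
    unfolding coxeter_word_add[of m] map_map
  proof (rule arg_cong[where f = prod_list], rule map_cong[OF refl])
    fix i assume "i \<in> set (coxeter_word 0 \<kappa>)"
    then have "1 \<le> i" using set_coxeter_word[of 0 \<kappa>] by auto
    then show "((\<lambda>i. pair_weight (L ! (i - 1)) (L ! i)) \<circ> (+) m) i = pair_weight (?B ! (i - 1)) (?B ! i)"
      using Cons.prems by (simp add: nth_drop)
  qed
  ultimately show ?case using Cons.IH[OF len(2)] by simp
qed simp

text \<open>The list reads the bits from site \<open>n\<close> down to site 1, as the index reversal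
  in \<open>theta\<close> requires.\<close>

lemma sum_lists_sets:
  "(\<Sum>I\<in>Pow {1..n}. f (map (\<lambda>k. n - k \<in> I) [0..<n])) = (\<Sum>L :: bool list | length L = n. f L)" for f :: "_ \<Rightarrow> 'a::comm_monoid_add"
proof (rule sum.reindex_bij_witness[where i = "\<lambda>L. {j \<in> {1..n}. L ! (n - j)}" and j = "\<lambda>I. map (\<lambda>k. n - k \<in> I) [0..<n]"])
  fix I assume "I \<in> Pow {1..n}"
  then show "{j \<in> {1..n}. map (\<lambda>k. n - k \<in> I) [0..<n] ! (n - j)} = I" by auto
qed (auto intro!: nth_equalityI)

lemma op_bitrace_symz_vv:
  assumes "sum_list \<kappa> = n"
  shows "op_bitrace n \<kappa> (symmetrizer right_T n) = q_fact n * (\<Prod>m\<leftarrow>\<kappa>. spin_trace m)"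
proof -
  define w where "w = coxeter_word 0 \<kappa>"
  define v where "v = rev (map (\<lambda>i. n - i) w)"
  have w: "set w \<subseteq> {1..<n}" "sorted_wrt (<) w"
    using set_coxeter_word[of 0 \<kappa>] sorted_coxeter_word[of 0 \<kappa>] assms by (simp_all add: w_def)
  have "sorted_wrt (\<lambda>i j. n - j < n - i) w"
    using w by (auto elim!: sorted_wrt_mono_rel[rotated])
  then have v: "sorted_wrt (<) v" by (simp add: v_def sorted_wrt_rev sorted_wrt_map)
  have "bit_word v (delta I) I = comp_weight \<kappa> (map (\<lambda>k. n - k \<in> I) [0..<n])" for I
  proof -
    let ?L = "map (\<lambda>k. n - k \<in> I) [0..<n]"
    have "bit_word v (delta I) I = (\<Prod>j\<in>(\<lambda>i. n - i) ` set w. pair_weight (Suc j \<in> I) (j \<in> I))"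
      using bit_word_diag[OF v] by (simp add: v_def)
    also have "\<dots> = (\<Prod>i\<in>set w. pair_weight (Suc (n - i) \<in> I) (n - i \<in> I))"
      by (rule prod.reindex_cong[where l = "\<lambda>i. n - i"]) (use w(1) in \<open>force simp: inj_on_def\<close>)+
    also have "\<dots> = (\<Prod>i\<in>set w. pair_weight (?L ! (i - 1)) (?L ! i))"
    proof (rule prod.cong[OF refl])
      fix i assume "i \<in> set w"
      then have "1 \<le> i" "i < n" using w by auto
      then obtain k where "i = Suc k" "k < n" "Suc k < n" by (cases i) auto
      then show "pair_weight (Suc (n - i) \<in> I) (n - i \<in> I) = pair_weight (?L ! (i - 1)) (?L ! i)"
        by (simp add: Suc_diff_Suc)
    qed
    also have "\<dots> = (\<Prod>i\<leftarrow>w. pair_weight (?L ! (i - 1)) (?L ! i))"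
      using w(2) by (simp add: prod.distinct_set_conv_list strict_sorted_iff)
    also have "\<dots> = comp_weight \<kappa> ?L" unfolding w_def by (rule comp_weight_prod) (simp add: assms)
    finally show ?thesis .
  qed
  then show ?thesis
    unfolding op_bitrace_symz[OF assms] v_def[symmetric] w_def[symmetric]
    using sum_comp_weight[of \<kappa>] sum_lists_sets[of "comp_weight \<kappa>" n] assms by (simp add: v_def w_def)
qed

text \<open>The weight of \<open>True, False\<close> is 0, so after a \<open>True\<close> bit only
  \<open>True\<close> bits follow, with a factor -1 each. The transfer recursion is therefore
  triangular with eigenvalues \<open>q\<close> and -1.\<close>

lemma spin_trace_eq: "m > 0 \<Longrightarrow> (q + 1) * spin_trace m = 2 * (q ^ m - (- 1) ^ m)"
proof -
  have T: "(\<Sum>L | length L = k. block_weight (True # L)) = (- 1) ^ k" for k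
  proof (induction k)
    case (Suc k)
    then show ?case unfolding sum_lists_Suc by (simp add: pair_weight_def sum_negf)
  qed simp
  have F: "(q + 1) * (\<Sum>L | length L = k. block_weight (False # L)) = 2 * q ^ Suc k - (q - 1) * (- 1) ^ k" for k
  proof (induction k)
    case (Suc k)
    have "(\<Sum>L | length L = Suc k. block_weight (False # L)) = (q - 1) * (- 1) ^ k + q * (\<Sum>L | length L = k. block_weight (False # L))"
      unfolding sum_lists_Suc using T[of k] by (simp add: pair_weight_def flip: sum_distrib_left)
    then have "(q + 1) * (\<Sum>L | length L = Suc k. block_weight (False # L)) = (q + 1) * (q - 1) * (- 1) ^ k + q * ((q + 1) * (\<Sum>L | length L = k. block_weight (False # L)))"
      by (simp only: distrib_left) (simp add: mult_ac)
    then show ?case unfolding Suc by (simp add: algebra_simps)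
  qed simp
  assume "m > 0"
  then obtain k where m: "m = Suc k" by (cases m) auto
  show ?thesis unfolding m spin_trace_def sum_lists_Suc distrib_left[of "q + 1"] T F by (simp add: algebra_simps)
qed

section \<open>Generating functions\<close>


lemma of_nat_hc_eq_0 [simp]: "(of_nat k :: hc_field) = 0 \<longleftrightarrow> k = 0"
proof -
  have "(of_nat k :: hc_field) = Fract (of_nat k) 1"
    by (induction k) (simp_all add: Zero_fract_def One_fract_def)
  then show ?thesis by (simp add: Zero_fract_def eq_fract)
qed

lemma two_hc_ne_0 [simp]: "(2 :: hc_field) \<noteq> 0"
  using of_nat_hc_eq_0[of 2] by simp

lemma q_plus_1_ne_0 [simp]: "q + 1 \<noteq> 0"
proof
  assume "q + 1 = 0"
  then have "q = - 1" by (simp add: eq_neg_iff_add_eq_0)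
  then have "q ^ 2 = 1" by (metis power2_minus one_power2)
  then show False using q_power_ne_1[of 2] by simp
qed

section \<open>A recursion for the coefficients of alpha\<close>

definition alpha_q :: "nat \<Rightarrow> hc_field" where
  "alpha_q n = poly (alpha n) q"

definition part_weight :: "nat multiset \<Rightarrow> hc_field" where
  "part_weight \<rho> = (\<Prod>k\<in>#\<rho>. 2 * (q ^ k - 1)\<^sup>2) / of_nat (z_part \<rho>)"

lemma odd_partitions_0: "odd_partitions 0 = {{#}}"
  by (auto simp: odd_partitions_def) (metis multiset_nonemptyE even_zero)

lemma alpha_q_eq: "alpha_q n = (\<Sum>\<rho>\<in>odd_partitions n. part_weight \<rho>)"
proof (cases "n = 0")
  case True
  then show ?thesis by (simp add: alpha_q_def alpha_def odd_partitions_0 part_weight_def z_part_def)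
next
  case False
  have "(\<Prod>k\<in>#\<rho>. 2 * (q ^ k - 1)\<^sup>2) = 2 ^ size \<rho> * (\<Prod>k\<in>#\<rho>. (q ^ k - 1)\<^sup>2)" for \<rho>
    by (induction \<rho>) (simp_all add: mult_ac)
  then show ?thesis using False
    by (simp add: alpha_q_def alpha_def poly_sum poly_prod_mset poly_monom part_weight_def)
qed

lemma z_part_superset:
  assumes "finite S" "set_mset \<rho> \<subseteq> S"
  shows "z_part \<rho> = (\<Prod>i\<in>S. i ^ count \<rho> i * fact (count \<rho> i))"
  unfolding z_part_def by (rule prod.mono_neutral_left) (use assms in \<open>auto simp: not_in_iff One_nat_def\<close>)

lemma z_part_add: "z_part (add_mset k \<rho>) = z_part \<rho> * (k * Suc (count \<rho> k))"
proof -
  let ?S = "insert k (set_mset \<rho>)"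
  have "z_part (add_mset k \<rho>) = (\<Prod>i\<in>?S. i ^ count (add_mset k \<rho>) i * fact (count (add_mset k \<rho>) i))"
    by (rule z_part_superset) auto
  also have "\<dots> = (k ^ Suc (count \<rho> k) * fact (Suc (count \<rho> k))) * (\<Prod>i\<in>?S - {k}. i ^ count \<rho> i * fact (count \<rho> i))"
    by (subst prod.remove[of _ k]) (auto intro!: arg_cong2[where f = "(*)"] prod.cong)
  also have "\<dots> = (k ^ count \<rho> k * fact (count \<rho> k)) * (\<Prod>i\<in>?S - {k}. i ^ count \<rho> i * fact (count \<rho> i)) * (k * Suc (count \<rho> k))"
    by (simp add: algebra_simps)
  also have "(k ^ count \<rho> k * fact (count \<rho> k)) * (\<Prod>i\<in>?S - {k}. i ^ count \<rho> i * fact (count \<rho> i)) = (\<Prod>i\<in>?S. i ^ count \<rho> i * fact (count \<rho> i))"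
    by (rule prod.remove[symmetric]) auto
  also have "\<dots> = z_part \<rho>"
    by (rule z_part_superset[symmetric]) auto
  finally show ?thesis .
qed

lemma part_weight_add:
  assumes "k > 0"
  shows "of_nat (k * count (add_mset k \<rho>) k) * part_weight (add_mset k \<rho>) = 2 * (q ^ k - 1)\<^sup>2 * part_weight \<rho>"
proof -
  have ne: "(of_nat (k * Suc (count \<rho> k)) :: hc_field) \<noteq> 0" using assms by (simp del: of_nat_mult of_nat_Suc mult_Suc_right)
  have "part_weight (add_mset k \<rho>) = 2 * (q ^ k - 1)\<^sup>2 * part_weight \<rho> / of_nat (k * Suc (count \<rho> k))"
    unfolding part_weight_def z_part_add of_nat_mult[of "z_part \<rho>"] by simp
  then show ?thesis using ne by (simp del: of_nat_mult of_nat_Suc mult_Suc_right)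
qed

lemma finite_odd_partitions: "finite (odd_partitions n)"
proof -
  have "odd_partitions n \<subseteq> {\<rho>. set_mset \<rho> \<subseteq> {..n} \<and> size \<rho> \<le> n}"
  proof clarify
    fix \<rho> assume r: "\<rho> \<in> odd_partitions n"
    have "k \<le> sum_mset \<rho>" if "k \<in># \<rho>" for k using that by (metis sum_mset.remove le_add1)
    moreover have "size \<rho> \<le> sum_mset \<rho>" if "\<forall>k\<in>#\<rho>. odd k"
      using that by (induction \<rho>) (auto simp: odd_pos Suc_le_eq add_mono[of 1, simplified] dest!: odd_pos)
    ultimately show "set_mset \<rho> \<subseteq> {..n} \<and> size \<rho> \<le> n" using r by (auto simp: odd_partitions_def)
  qed
  moreover have "finite {\<rho>. set_mset \<rho> \<subseteq> {..n} \<and> size \<rho> \<le> n}"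
  proof (rule finite_subset)
    show "{\<rho>. set_mset \<rho> \<subseteq> {..n} \<and> size \<rho> \<le> n} \<subseteq> mset ` {xs. set xs \<subseteq> {..n} \<and> length xs \<le> n}"
    proof clarify
      fix \<rho> assume "set_mset \<rho> \<subseteq> {..n}" "size \<rho> \<le> n"
      moreover obtain xs where "mset xs = \<rho>" using ex_mset by blast
      ultimately show "\<rho> \<in> mset ` {xs. set xs \<subseteq> {..n} \<and> length xs \<le> n}" by force
    qed
  qed (intro finite_imageI finite_lists_length_le, simp)
  ultimately show ?thesis by (rule finite_subset)
qed

lemma sum_count:
  assumes "finite S" "set_mset \<rho> \<subseteq> S"
  shows "(\<Sum>k\<in>S. k * count \<rho> k) = sum_mset (\<rho> :: nat multiset)"
  using assms(2)
proof (induction \<rho>)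
  case (add x \<rho>)
  have "(\<Sum>k\<in>S. k * count (add_mset x \<rho>) k) = (\<Sum>k\<in>S. k * count \<rho> k + (if k = x then x else 0))"
    by (rule sum.cong) auto
  also have "\<dots> = sum_mset \<rho> + x"
    using add assms(1) by (simp add: sum.distrib)
  finally show ?case by simp
qed simp

text \<open>Sum over partitions with a distinguished part, weighted by that part times its
  multiplicity: for a fixed partition these weights add up to \<open>n\<close>, and removing a part
  \<open>k\<close> divides \<open>z_part\<close> by exactly \<open>k\<close> times its
  multiplicity.\<close>

lemma alpha_q_rec: "of_nat n * alpha_q n = (\<Sum>k | k \<in> {1..n} \<and> odd k. 2 * (q ^ k - 1)\<^sup>2 * alpha_q (n - k))"
proof -
  have "of_nat n * alpha_q n = (\<Sum>\<rho>\<in>odd_partitions n. \<Sum>k\<in>set_mset \<rho>. of_nat (k * count \<rho> k) * part_weight \<rho>)"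
  proof -
    have "of_nat n = (\<Sum>k\<in>set_mset \<rho>. of_nat (k * count \<rho> k) :: hc_field)" if "\<rho> \<in> odd_partitions n" for \<rho>
    proof -
      have "n = (\<Sum>k\<in>set_mset \<rho>. k * count \<rho> k)"
        using that sum_count[of "set_mset \<rho>" \<rho>] by (simp add: odd_partitions_def)
      then show ?thesis by (metis of_nat_sum)
    qed
    then show ?thesis by (simp add: alpha_q_eq sum_distrib_left flip: sum_distrib_right)
  qed
  also have "\<dots> = (\<Sum>(\<rho>, k)\<in>(SIGMA \<rho>:odd_partitions n. set_mset \<rho>). of_nat (k * count \<rho> k) * part_weight \<rho>)"
    by (rule sum.Sigma) (simp_all add: finite_odd_partitions)
  also have "\<dots> = (\<Sum>(k, \<rho>)\<in>(SIGMA k:{k. k \<in> {1..n} \<and> odd k}. odd_partitions (n - k)). 2 * (q ^ k - 1)\<^sup>2 * part_weight \<rho>)"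
  proof (rule sum.reindex_bij_witness[where i = "\<lambda>(k, \<rho>). (add_mset k \<rho>, k)" and j = "\<lambda>(\<rho>, k). (k, \<rho> - {#k#})"])
    fix a assume "a \<in> (SIGMA \<rho>:odd_partitions n. set_mset \<rho>)"
    then obtain \<rho> k where a: "a = (\<rho>, k)" "k \<in># \<rho>" "sum_mset \<rho> = n" "\<forall>k\<in>#\<rho>. odd k" by (auto simp: odd_partitions_def)
    then have k: "odd k" "k > 0" by (auto simp: odd_pos)
    obtain \<rho>' where r: "\<rho> = add_mset k \<rho>'" using a(2) by (metis insert_DiffM)
    show "(case case a of (\<rho>, k) \<Rightarrow> (k, \<rho> - {#k#}) of (k, \<rho>) \<Rightarrow> (add_mset k \<rho>, k)) = a" using a by simp
    show "(case a of (\<rho>, k) \<Rightarrow> (k, \<rho> - {#k#})) \<in> (SIGMA k:{k. k \<in> {1..n} \<and> odd k}. odd_partitions (n - k))"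
      using a k r by (auto simp: odd_partitions_def)
    show "(case case a of (\<rho>, k) \<Rightarrow> (k, \<rho> - {#k#}) of (k, \<rho>) \<Rightarrow> 2 * (q ^ k - 1)\<^sup>2 * part_weight \<rho>) = (case a of (\<rho>, k) \<Rightarrow> of_nat (k * count \<rho> k) * part_weight \<rho>)"
      unfolding a(1) prod.case r using part_weight_add[OF k(2), of \<rho>'] by simp
  next
    fix b assume "b \<in> (SIGMA k:{k. k \<in> {1..n} \<and> odd k}. odd_partitions (n - k))"
    then obtain k \<rho> where b: "b = (k, \<rho>)" "k \<le> n" "odd k" "sum_mset \<rho> = n - k" "\<forall>k\<in>#\<rho>. odd k"
      by (auto simp: odd_partitions_def)
    show "(case case b of (k, \<rho>) \<Rightarrow> (add_mset k \<rho>, k) of (\<rho>, k) \<Rightarrow> (k, \<rho> - {#k#})) = b" by (simp add: b(1))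
    show "(case b of (k, \<rho>) \<Rightarrow> (add_mset k \<rho>, k)) \<in> (SIGMA \<rho>:odd_partitions n. set_mset \<rho>)"
      using b(2-) by (simp add: b(1) odd_partitions_def)
  qed
  also have "\<dots> = (\<Sum>k | k \<in> {1..n} \<and> odd k. 2 * (q ^ k - 1)\<^sup>2 * alpha_q (n - k))"
    by (subst sum.Sigma[symmetric]) (simp_all add: finite_odd_partitions alpha_q_eq sum_distrib_left)
  finally show ?thesis .
qed

section \<open>The series of the normalised symmetrizer traces\<close>

definition spin_coeff :: "nat \<Rightarrow> hc_field" where
  "spin_coeff m = (if m = 0 then 1 else (q - 1) * spin_trace m)"

definition oddfps :: "(nat \<Rightarrow> hc_field) \<Rightarrow> hc_field fps" where
  "oddfps c = Abs_fps (\<lambda>k. if odd k then c k else 0)"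

lemma X_deriv_nth: "fps_nth (fps_X * fps_deriv f) n = of_nat n * fps_nth f n" for f :: "hc_field fps"
  by (cases n) (simp_all add: One_nat_def)

lemma nth_oddfps_mult:
  "fps_nth (oddfps c * f) n = (\<Sum>k | k \<in> {1..n} \<and> odd k. c k * fps_nth f (n - k))"
proof -
  have "fps_nth (oddfps c * f) n = (\<Sum>k\<in>{0..n}. if odd k then c k * fps_nth f (n - k) else 0)"
    unfolding fps_mult_nth oddfps_def by (rule sum.cong) auto
  also have "\<dots> = (\<Sum>k\<in>{k \<in> {0..n}. odd k}. c k * fps_nth f (n - k))"
    by (rule sum.inter_filter[symmetric]) simp
  also have "{k \<in> {0..n}. odd k} = {k. k \<in> {1..n} \<and> odd k}"
    by (auto simp: Suc_le_eq odd_pos One_nat_def)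
  finally show ?thesis .
qed

lemma odd_geometric: "(1 - fps_const (x\<^sup>2) * fps_X ^ 2) * oddfps (\<lambda>k. 2 * x ^ k) = fps_const (2 * x) * fps_X"
proof (rule fps_ext)
  fix n
  show "fps_nth ((1 - fps_const (x\<^sup>2) * fps_X ^ 2) * oddfps (\<lambda>k. 2 * x ^ k)) n = fps_nth (fps_const (2 * x) * fps_X) n"
  proof (cases "n < 2")
    case True
    then have "n = 0 \<or> n = 1" by auto
    then show ?thesis by (auto simp: algebra_simps oddfps_def fps_X_power_mult_nth mult.assoc fps_X_def One_nat_def)
  next
    case False
    then obtain k where n: "n = Suc (Suc k)" by (metis less_2_cases_iff not0_implies_Suc One_nat_def)
    show ?thesis unfolding n
      by (simp add: left_diff_distrib mult.assoc fps_X_power_mult_nth oddfps_def power2_eq_square)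
  qed
qed

lemma spin_coeff_eq: "spin_coeff m = (if m = 0 then 1 else 2 * (q - 1) / (q + 1) * (q ^ m - (- 1) ^ m))"
proof (cases "m = 0")
  case False
  then have "spin_trace m = 2 * (q ^ m - (- 1) ^ m) / (q + 1)"
    using spin_trace_eq[of m] by (simp add: eq_divide_eq mult.commute)
  then show ?thesis using False by (simp add: spin_coeff_def algebra_simps)
qed (simp add: spin_coeff_def)

definition spin_fps :: "hc_field fps" where
  "spin_fps = Abs_fps spin_coeff"

lemma spin_fps_rational:
  "((1 - fps_const q * fps_X) * (1 + fps_X)) * spin_fps = (1 + fps_const q * fps_X) * (1 - fps_X)"
proof (rule fps_ext)
  fix n
  have D: "(1 - fps_const q * fps_X) * (1 + fps_X) = 1 + fps_const (1 - q) * fps_X - fps_const q * fps_X ^ 2"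
    by (simp add: algebra_simps power2_eq_square flip: fps_const_sub)
  have N: "(1 + fps_const q * fps_X) * (1 - fps_X) = 1 + fps_const (q - 1) * fps_X - fps_const q * fps_X ^ 2"
    by (simp add: algebra_simps power2_eq_square flip: fps_const_sub)
  have l: "fps_nth ((1 + fps_const (1 - q) * fps_X - fps_const q * fps_X ^ 2) * spin_fps) n
    = spin_coeff n + (1 - q) * (if n = 0 then 0 else spin_coeff (n - 1)) - q * (if n < 2 then 0 else spin_coeff (n - 2))"
    by (simp add: distrib_right left_diff_distrib mult.assoc fps_X_power_mult_nth spin_fps_def)
  have r: "fps_nth (1 + fps_const (q - 1) * fps_X - fps_const q * fps_X ^ 2) n
    = (if n = 0 then 1 else if n = 1 then q - 1 else if n = 2 then - q else 0)"
    by (auto simp: fps_X_nth fps_X_power_nth)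
  have spin_coeff: "spin_coeff 1 = 2 * (q - 1)" by (simp add: spin_coeff_eq)
  consider "n = 0" | "n = 1" | "n = 2" | k where "n = Suc (Suc (Suc k))"
    by (metis One_nat_def Suc_1 not0_implies_Suc)
  then have "spin_coeff n + (1 - q) * (if n = 0 then 0 else spin_coeff (n - 1)) - q * (if n < 2 then 0 else spin_coeff (n - 2))
     = (if n = 0 then 1 else if n = 1 then q - 1 else if n = 2 then - q else 0)"
  proof cases
    case 4
    obtain c where c: "\<And>m. m > 0 \<Longrightarrow> spin_coeff m = c * (q ^ m - (- 1) ^ m)"
      using spin_coeff_eq by (metis neq0_conv)
    show ?thesis using 4 by (simp add: c) (simp add: algebra_simps)
  next
    case 3
    have V2: "spin_coeff 2 = 2 * (q - 1) ^ 2"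
      by (simp add: spin_coeff_eq divide_eq_eq power2_eq_square) (simp add: algebra_simps)
    have "spin_coeff 2 + (1 - q) * spin_coeff 1 - q * spin_coeff 0 = - q"
      unfolding spin_coeff V2 by (simp add: spin_coeff_def power2_eq_square algebra_simps)
    then show ?thesis using 3 by (simp add: One_nat_def)
  next
    case 2
    moreover have "spin_coeff (1 - 1) = 1" by (simp add: spin_coeff_def)
    ultimately show ?thesis using spin_coeff by simp
  qed (simp add: spin_coeff_def)
  then show "fps_nth (((1 - fps_const q * fps_X) * (1 + fps_X)) * spin_fps) n = fps_nth ((1 + fps_const q * fps_X) * (1 - fps_X)) n"
    unfolding D N l r .
qed

text \<open>The logarithmic derivative of the rational function \<open>N / D\<close>, computed with
  all denominators cleared. \<open>D\<close> and \<open>N\<close> have constant term 1 and can be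
  cancelled at the end.\<close>

lemma spin_fps_ode: "fps_X * fps_deriv spin_fps = oddfps (\<lambda>k. 2 * (q ^ k - 1)) * spin_fps"
proof -
  define c X where "c = fps_const q" and "X = (fps_X :: hc_field fps)"
  define D N where "D = (1 - c * X) * (1 + X)" and "N = (1 + c * X) * (1 - X)"
  define Bq B1 where "Bq = oddfps (\<lambda>k. 2 * q ^ k)" and "B1 = oddfps (\<lambda>k. 2 * 1 ^ k)"
  have B: "oddfps (\<lambda>k. 2 * (q ^ k - 1)) = Bq - B1"
    by (rule fps_ext) (simp add: oddfps_def Bq_def B1_def algebra_simps)
  have gq: "(1 - c ^ 2 * X ^ 2) * Bq = 2 * c * X" and g1: "(1 - X ^ 2) * B1 = 2 * X"
    using odd_geometric[of q] odd_geometric[of 1]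
    by (simp_all add: Bq_def B1_def c_def X_def fps_const_power flip: fps_const_mult) (simp_all add: numeral_fps_const mult.assoc)
  have DF: "D * spin_fps = N" using spin_fps_rational by (simp add: D_def N_def c_def X_def)
  have dX: "fps_deriv X = 1" "fps_deriv c = 0" by (simp_all add: X_def c_def)
  have dD: "fps_deriv D = - c * (1 + X) + (1 - c * X)" by (simp add: D_def dX algebra_simps)
  have dN: "fps_deriv N = c * (1 - X) - (1 + c * X)" by (simp add: N_def dX algebra_simps)
  have "fps_deriv (D * spin_fps) = fps_deriv N" by (simp add: DF)
  then have eq: "D * fps_deriv spin_fps + fps_deriv D * spin_fps = fps_deriv N" by simp
  have "N * D * (Bq - B1) = X * (fps_deriv N * D - fps_deriv D * N)"
  proof -
    have "N * D * (Bq - B1) = (1 - X ^ 2) * ((1 - c ^ 2 * X ^ 2) * Bq) - (1 - c ^ 2 * X ^ 2) * ((1 - X ^ 2) * B1)"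
      by (simp add: N_def D_def power2_eq_square algebra_simps)
    then show ?thesis unfolding gq g1 dN dD by (simp add: N_def D_def power2_eq_square algebra_simps)
  qed
  moreover have "D * N * (X * fps_deriv spin_fps - (Bq - B1) * spin_fps) = N * X * (D * fps_deriv spin_fps) - N * D * (Bq - B1) * spin_fps"
    by (simp add: algebra_simps)
  \<comment> \<open>Written as a combination of the equations \<open>eq\<close> and
    \<open>DF\<close>, both of which make the right-hand side vanish.\<close>
  moreover have "N * X * (D * fps_deriv spin_fps) - X * (fps_deriv N * D - fps_deriv D * N) * spin_fps
      = N * X * (D * fps_deriv spin_fps + fps_deriv D * spin_fps - fps_deriv N) + X * fps_deriv N * (N - D * spin_fps)"
    by (simp add: algebra_simps)
  ultimately have "D * N * (X * fps_deriv spin_fps - (Bq - B1) * spin_fps) = N * X * (D * fps_deriv spin_fps + fps_deriv D * spin_fps - fps_deriv N) + X * fps_deriv N * (N - D * spin_fps)"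
    by simp
  then have "D * N * (X * fps_deriv spin_fps - (Bq - B1) * spin_fps) = 0" by (simp add: eq DF)
  moreover have "fps_nth D 0 = 1" "fps_nth N 0 = 1" by (simp_all add: D_def N_def c_def X_def)
  then have "D \<noteq> 0" "N \<noteq> 0" by auto
  ultimately have "X * fps_deriv spin_fps = (Bq - B1) * spin_fps" by simp
  then show ?thesis unfolding B X_def .
qed

text \<open>Both sides satisfy the recursion with kernel \<open>2 (q^k - 1) q^k\<close> over odd
  \<open>k\<close>: on the left the logarithmic derivatives of the two series add up to it, on the
  right \<open>q^n\<close> is distributed over the recursion. In characteristic 0 the constant term
  determines the solution.\<close>

lemma spin_coeff_al: "(\<Sum>j\<le>m. spin_coeff j * alpha_q (m - j)) = q ^ m * spin_coeff m"
proof -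
  define FA where "FA = Abs_fps alpha_q"
  define W where "W = Abs_fps (\<lambda>n. q ^ n * spin_coeff n)"
  define C where "C = oddfps (\<lambda>k. 2 * (q ^ k - 1) * q ^ k)"
  have FA: "fps_X * fps_deriv FA = oddfps (\<lambda>k. 2 * (q ^ k - 1)\<^sup>2) * FA"
    by (rule fps_ext) (simp only: X_deriv_nth nth_oddfps_mult, simp add: FA_def alpha_q_rec)
  have C: "oddfps (\<lambda>k. 2 * (q ^ k - 1)) + oddfps (\<lambda>k. 2 * (q ^ k - 1)\<^sup>2) = C"
    by (rule fps_ext) (simp add: oddfps_def C_def power2_eq_square algebra_simps)
  have "fps_X * fps_deriv (spin_fps * FA) = (fps_X * fps_deriv spin_fps) * FA + spin_fps * (fps_X * fps_deriv FA)"
    by (simp add: algebra_simps)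
  also have "\<dots> = C * (spin_fps * FA)" unfolding spin_fps_ode FA C[symmetric] by (simp add: algebra_simps)
  finally have U: "of_nat n * fps_nth (spin_fps * FA) n = (\<Sum>k | k \<in> {1..n} \<and> odd k. 2 * (q ^ k - 1) * q ^ k * fps_nth (spin_fps * FA) (n - k))" for n
    using X_deriv_nth[of "spin_fps * FA" n] by (simp add: C_def nth_oddfps_mult)
  have V: "of_nat n * (q ^ n * spin_coeff n) = (\<Sum>k | k \<in> {1..n} \<and> odd k. 2 * (q ^ k - 1) * q ^ k * (q ^ (n - k) * spin_coeff (n - k)))" for n
  proof -
    have "of_nat n * spin_coeff n = (\<Sum>k | k \<in> {1..n} \<and> odd k. 2 * (q ^ k - 1) * spin_coeff (n - k))"
      using arg_cong[OF spin_fps_ode, of "\<lambda>f. fps_nth f n"] X_deriv_nth[of spin_fps n] by (simp add: nth_oddfps_mult spin_fps_def)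
    then have "of_nat n * (q ^ n * spin_coeff n) = q ^ n * (\<Sum>k | k \<in> {1..n} \<and> odd k. 2 * (q ^ k - 1) * spin_coeff (n - k))" by simp
    also have "\<dots> = (\<Sum>k | k \<in> {1..n} \<and> odd k. 2 * (q ^ k - 1) * q ^ k * (q ^ (n - k) * spin_coeff (n - k)))"
      unfolding sum_distrib_left
    proof (rule sum.cong[OF refl])
      fix k assume "k \<in> {k. k \<in> {1..n} \<and> odd k}"
      then have "q ^ n = q ^ k * q ^ (n - k)" by (simp flip: power_add)
      then show "q ^ n * (2 * (q ^ k - 1) * spin_coeff (n - k)) = 2 * (q ^ k - 1) * q ^ k * (q ^ (n - k) * spin_coeff (n - k))" by simp
    qed
    finally show ?thesis .
  qed
  have "fps_nth (spin_fps * FA) n = q ^ n * spin_coeff n" for n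
  proof (induction n rule: less_induct)
    case (less n)
    show ?case
    proof (cases "n = 0")
      case True
      then show ?thesis by (simp add: spin_fps_def FA_def spin_coeff_def alpha_q_def alpha_def)
    next
      case False
      have "of_nat n * fps_nth (spin_fps * FA) n = of_nat n * (q ^ n * spin_coeff n)"
        unfolding U V by (rule sum.cong[OF refl]) (use less in auto)
      then show ?thesis using False by simp
    qed
  qed
  then show ?thesis by (simp add: fps_mult_nth spin_fps_def FA_def atLeast0AtMost)
qed

section \<open>The bitrace formula\<close>

definition word_sw :: "nat list \<Rightarrow> slist linop" where
  "word_sw w = prod_list (map right_T_sw w)"

lemma word_sw_simps [simp]: "word_sw [] = 1" "word_sw (j # w) = right_T_sw j * word_sw w" "word_sw (u @ w) = word_sw u * word_sw w"
  by (simp_all add: word_sw_def)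

lemma corresponds_rword: "set w \<subseteq> {1..<n} \<Longrightarrow> corresponds n (app (right_word w)) (app (word_sw w))"
proof (induction w)
  case (Cons j w)
  then show ?case unfolding right_word_simps word_sw_simps by (intro corresponds_mult corresponds_rT) auto
qed (simp add: corresponds_def)

lemma corresponds_EE: "a \<le> n \<Longrightarrow> corresponds n (app (sym_factor right_T a)) (app (sym_factor right_T_sw a))"
proof (induction a)
  case (Suc a)
  then show ?case
    by (cases "a = 0") (auto simp del: app_plus app_one app_times intro!: corresponds_add corresponds_one corresponds_mult corresponds_rT)
qed (simp add: corresponds_def)

lemma corresponds_symz: "a \<le> n \<Longrightarrow> corresponds n (app (symmetrizer right_T a)) (app (symmetrizer right_T_sw a))"
proof (induction a)
  case (Suc a)
  then show ?case unfolding symmetrizer.simps using corresponds_EE[of "Suc a" n] by (intro corresponds_mult) auto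
qed (simp add: corresponds_one)

lemma slicing_symmetrizer: "J \<inter> K = {} \<Longrightarrow> {1..a} \<subseteq> J \<Longrightarrow> slicing J K (symmetrizer right_T_sw a)"
  by (rule sym_factor_induct(2)) (auto intro!: slicing_zero slicing_one slicing_add slicing_mult slicing_right_T_sw)

lemma slicing_word_sw: "J \<inter> K = {} \<Longrightarrow> \<forall>j\<in>set w. j \<in> J \<and> Suc j \<in> J \<Longrightarrow> slicing J K (word_sw w)"
  by (induction w) (auto intro!: slicing_one slicing_mult slicing_right_T_sw)

section \<open>Translation of labels\<close>

definition shift :: "nat \<Rightarrow> slist \<Rightarrow> slist" where
  "shift d = map (\<lambda>e. (d + fst e, snd e))"

lemma before_shift: "before (shift d w) (d + x) (d + y) \<longleftrightarrow> before w x y"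
  by (induction w) (auto simp: shift_def)

lemma right_T_sw_shift: "app (right_T_sw (d + j)) F (shift d w) = app (right_T_sw j) (\<lambda>v. F (shift d v)) w"
proof -
  have m: "(d + k, b) \<in> set (shift d w) \<longleftrightarrow> (k, b) \<in> set w" for k b
    by (force simp: shift_def)
  have s: "sub2 (d + j) s a b (shift d w) = shift d (sub2 j s a b w)" for s a b
    by (auto simp: shift_def sub2_def)
  show ?thesis
    using before_shift[of d w j "Suc j"] m[of "Suc j"] by (simp add: right_T_sw.rep_eq m s)
qed

lemma word_sw_shift: "app (word_sw (map ((+) d) js)) F (shift d w) = app (word_sw js) (\<lambda>v. F (shift d v)) w"
  by (induction js arbitrary: F) (simp_all add: right_T_sw_shift)

lemma left_coxeter_shift: "left_coxeter \<mu> F (shift d w) = left_coxeter \<mu> (\<lambda>v. F (shift d v)) w"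
proof (induction \<mu> "\<lambda>v. F (shift d v)" w arbitrary: F rule: left_coxeter.induct)
  case (3 \<mu> x w)
  then show ?case by (simp add: shift_def)
next
  case (4 m \<mu> x y w)
  show ?case
  proof (cases "fst x < fst y")
    case True
    then show ?thesis using 4(1)[OF True, of "\<lambda>v. F ((d + fst y, snd y) # v)"] by (simp add: shift_def)
  next
    case False
    then show ?thesis using 4(2)[OF False, of "\<lambda>v. F ((d + fst y, snd y) # v)"]
      4(3)[OF False, of "\<lambda>v. F ((d + fst x, snd x) # v)"] by (simp add: shift_def)
  qed
qed (simp_all add: shift_def)

text \<open>Only the relative order of the labels enters, so adding \<open>d\<close> to all of them
  carries one trace to the other.\<close>

lemma trace_sw_shift: "trace_sw {Suc d..d + m} \<mu> (word_sw (map ((+) d) js)) = trace_sw {1..m} \<mu> (word_sw js)"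
proof -
  have im: "(+) d ` {1..m} = {Suc d..d + m}" by (simp add: image_add_atLeastAtMost)
  have inj: "inj (shift d)" unfolding shift_def by (intro inj_mapI injI) (auto simp: prod_eq_iff)
  have signed_words: "shift d ` signed_words {1..m} = signed_words {Suc d..d + m}"
  proof
    show "shift d ` signed_words {1..m} \<subseteq> signed_words {Suc d..d + m}"
    proof clarify
      fix w assume w: "w \<in> signed_words {1..m}"
      have "map fst (shift d w) = map ((+) d) (map fst w)" by (simp add: shift_def)
      moreover have "distinct (map ((+) d) (map fst w))"
        using w unfolding distinct_map[of "(+) d"] by (simp add: signed_words_def)
      moreover have "fst ` set (shift d w) = (+) d ` (fst ` set w)" by (auto simp: shift_def image_image)
      ultimately show "shift d w \<in> signed_words {Suc d..d + m}" using w im unfolding signed_words_def mem_Collect_eq by simp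
    qed
    show "signed_words {Suc d..d + m} \<subseteq> shift d ` signed_words {1..m}"
    proof
      fix w assume w: "w \<in> signed_words {Suc d..d + m}"
      let ?v = "map (\<lambda>e. (fst e - d, snd e)) w"
      have ge: "d < fst e \<and> fst e \<le> d + m" if "e \<in> set w" for e
      proof -
        have "fst e \<in> {Suc d..d + m}" using w that by (auto simp: signed_words_def)
        then show ?thesis by auto
      qed
      have "shift d ?v = w" unfolding shift_def map_map
      proof (rule map_idI)
        fix e assume "e \<in> set w"
        from ge[OF this] show "((\<lambda>e. (d + fst e, snd e)) \<circ> (\<lambda>e. (fst e - d, snd e))) e = e"
          by (simp add: prod_eq_iff)
      qed
      moreover have "?v \<in> signed_words {1..m}"
      proof -
        have w': "distinct (map fst w)" "fst ` set w = {Suc d..d + m}" using w by (simp_all add: signed_words_def)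
        have "inj_on (\<lambda>x. x - d) (set (map fst w))" using ge by (fastforce simp: inj_on_def)
        with w'(1) have "distinct (map (\<lambda>x. x - d) (map fst w))" by (simp only: distinct_map[of "\<lambda>x. x - d"])
        moreover have "map (\<lambda>x. x - d) (map fst w) = map fst ?v" by simp
        moreover have "fst ` set ?v = (\<lambda>x. x - d) ` (fst ` set w)" by (auto simp: image_image)
        moreover have "(\<lambda>x. x - d) ` {Suc d..d + m} = {1..m}" unfolding im[symmetric] image_image by simp
        ultimately show ?thesis unfolding signed_words_def mem_Collect_eq w'(2) by (simp add: comp_def)
      qed
      ultimately show "w \<in> shift d ` signed_words {1..m}" by (intro image_eqI[where x = ?v]) (simp_all only:)
    qed
  qed
  have "delta (shift d w) (shift d v) = delta w v" for v w using inj by (auto simp: delta_def inj_def)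
  then have e: "left_coxeter \<mu> (app (word_sw (map ((+) d) js)) (delta (shift d w))) (shift d w) = left_coxeter \<mu> (app (word_sw js) (delta w)) w" for w
    by (simp add: left_coxeter_shift word_sw_shift)
  have "(\<Sum>w\<in>signed_words {Suc d..d + m}. left_coxeter \<mu> (app (word_sw (map ((+) d) js)) (delta w)) w) = (\<Sum>w\<in>signed_words {1..m}. left_coxeter \<mu> (app (word_sw js) (delta w)) w)"
    unfolding signed_words[symmetric] by (subst sum.reindex) (auto simp: e intro: inj_on_subset[OF inj])
  then show ?thesis by (simp add: trace_sw_def)
qed

section \<open>The trace with a full Coxeter element on the right\<close>

definition spin_prod :: "nat list \<Rightarrow> hc_field" where
  "spin_prod \<kappa> = (\<Prod>m\<leftarrow>\<kappa>. spin_coeff m)"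

text \<open>For size 0 the general formula would give \<open>q - 1\<close>. The value 1 supplies the
  splitting with trivial second part in \<open>spin_prod_rec\<close> and so turns the factor
  \<open>q^n - 1\<close> of Newton's identity into \<open>q^n\<close>.\<close>

definition coxeter_trace :: "nat list \<Rightarrow> hc_field" where
  "coxeter_trace \<kappa> = (if sum_list \<kappa> = 0 then 1 else (q - 1) * trace_norm {1..sum_list \<kappa>} \<kappa> (word_sw [1..<sum_list \<kappa>]))"

lemma norm_factor_vv: "norm_factor \<kappa> * (\<Prod>m\<leftarrow>\<kappa>. spin_trace m) = spin_prod \<kappa>"
proof (induction \<kappa>)
  case (Cons m \<kappa>)
  have "(if m = 0 then 1 else q - 1) * spin_trace m = spin_coeff m" by (simp add: spin_coeff_def spin_trace_def)
  moreover have "norm_factor (m # \<kappa>) * (\<Prod>m\<leftarrow>m # \<kappa>. spin_trace m) = ((if m = 0 then 1 else q - 1) * spin_trace m) * (norm_factor \<kappa> * (\<Prod>m\<leftarrow>\<kappa>. spin_trace m))"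
    by (simp add: norm_factor_def mult_ac)
  ultimately show ?case unfolding Cons by (simp add: spin_prod_def)
qed (simp add: norm_factor_def spin_prod_def)

lemma trace_norm_symz:
  "trace_norm {1..a} \<kappa> (symmetrizer right_T_sw a) = (if sum_list \<kappa> = a then q_fact a * spin_prod \<kappa> else 0)"
proof (cases "sum_list \<kappa> = a")
  case True
  have "trace_norm {1..a} \<kappa> (symmetrizer right_T_sw a) = norm_factor \<kappa> * op_bitrace a \<kappa> (symmetrizer right_T a)"
    using op_bitrace_Z[OF corresponds_symz[OF order_refl] True] by (simp add: trace_norm_def)
  then show ?thesis using True op_bitrace_symz_vv[OF True] norm_factor_vv[of \<kappa>] by (simp add: mult_ac)
qed (simp add: trace_norm_def trace_sw_def)

lemma trace_norm_word:
  assumes "0 < m"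
  shows "(q - 1) * trace_norm {Suc d..d + m} \<kappa> (word_sw [Suc d..<d + m]) = (if sum_list \<kappa> = m then coxeter_trace \<kappa> else 0)"
proof (cases "sum_list \<kappa> = m")
  case True
  have "[Suc d..<d + m] = map ((+) d) [1..<m]" by (rule nth_equalityI) auto
  then show ?thesis using True assms trace_sw_shift[of d m \<kappa> "[1..<m]"] by (simp add: trace_norm_def coxeter_trace_def)
qed (simp add: trace_norm_def trace_sw_def)

lemma split_sum_cong:
  assumes "\<And>\<kappa> \<kappa>'. length \<kappa> = length \<mu> \<Longrightarrow> length \<kappa>' = length \<mu> \<Longrightarrow> sum_list \<kappa> + sum_list \<kappa>' = sum_list \<mu> \<Longrightarrow> G \<kappa> \<kappa>' = H \<kappa> \<kappa>'"
  shows "split_sum \<mu> G = split_sum \<mu> H"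
  using assms
proof (induction \<mu> arbitrary: G H)
  case (Cons m \<mu>)
  show ?case unfolding split_sum.simps
  proof (rule sum.cong[OF refl])
    fix i assume "i \<in> {..m}"
    then show "split_sum \<mu> (\<lambda>\<kappa> \<kappa>'. G (i # \<kappa>) ((m - i) # \<kappa>')) = split_sum \<mu> (\<lambda>\<kappa> \<kappa>'. H (i # \<kappa>) ((m - i) # \<kappa>'))"
      by (intro Cons.IH Cons.prems) auto
  qed
qed simp

lemma split_sum_sum: "split_sum \<mu> (\<lambda>\<kappa> \<kappa>'. \<Sum>a\<in>S. G a \<kappa> \<kappa>') = (\<Sum>a\<in>S. split_sum \<mu> (G a))"
proof (induction \<mu> arbitrary: G)
  case (Cons m \<mu>)
  show ?case unfolding split_sum.simps Cons by (rule sum.swap)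
qed simp

lemma split_sum_add: "split_sum \<mu> (\<lambda>\<kappa> \<kappa>'. G \<kappa> \<kappa>' + H \<kappa> \<kappa>') = split_sum \<mu> G + split_sum \<mu> H"
  by (induction \<mu> arbitrary: G H) (simp_all add: sum.distrib)

lemma split_sum_zero: "split_sum \<mu> (\<lambda>\<kappa> \<kappa>'. 0) = 0"
  by (induction \<mu>) simp_all

lemma split_sum_left: "split_sum \<mu> (\<lambda>\<kappa> \<kappa>'. if sum_list \<kappa> = 0 then h \<kappa>' else 0) = h \<mu>"
proof (induction \<mu> arbitrary: h)
  case (Cons m \<mu>)
  have "split_sum (m # \<mu>) (\<lambda>\<kappa> \<kappa>'. if sum_list \<kappa> = 0 then h \<kappa>' else 0) = (\<Sum>i\<le>m. if i = 0 then h (m # \<mu>) else 0)"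
    unfolding split_sum.simps
  proof (rule sum.cong[OF refl])
    fix i
    show "split_sum \<mu> (\<lambda>\<kappa> \<kappa>'. if sum_list (i # \<kappa>) = 0 then h ((m - i) # \<kappa>') else 0) = (if i = 0 then h (m # \<mu>) else 0)"
      using Cons[of "\<lambda>\<kappa>'. h (m # \<kappa>')"] by (cases "i = 0") (simp_all add: split_sum_zero del: sum_list_eq_0_iff cong: if_cong)
  qed
  then show ?case by simp
qed simp

lemma split_sum_right: "split_sum \<mu> (\<lambda>\<kappa> \<kappa>'. if sum_list \<kappa>' = 0 then h \<kappa> else 0) = h \<mu>"
proof (induction \<mu> arbitrary: h)
  case (Cons m \<mu>)
  have "split_sum (m # \<mu>) (\<lambda>\<kappa> \<kappa>'. if sum_list \<kappa>' = 0 then h \<kappa> else 0) = (\<Sum>i\<le>m. if i = m then h (m # \<mu>) else 0)"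
    unfolding split_sum.simps
  proof (rule sum.cong[OF refl])
    fix i assume "i \<in> {..m}"
    then show "split_sum \<mu> (\<lambda>\<kappa> \<kappa>'. if sum_list ((m - i) # \<kappa>') = 0 then h (i # \<kappa>) else 0) = (if i = m then h (m # \<mu>) else 0)"
      using Cons[of "\<lambda>\<kappa>. h (m # \<kappa>)"] by (cases "i = m") (simp_all add: split_sum_zero del: sum_list_eq_0_iff cong: if_cong)
  qed
  then show ?case by simp
qed simp

lemma split_sum_prod:
  fixes f g :: "nat \<Rightarrow> hc_field"
  shows "split_sum \<mu> (\<lambda>\<kappa> \<kappa>'. (\<Prod>m\<leftarrow>\<kappa>. f m) * (\<Prod>m\<leftarrow>\<kappa>'. g m)) = (\<Prod>m\<leftarrow>\<mu>. \<Sum>j\<le>m. f j * g (m - j))"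
proof (induction \<mu>)
  case (Cons m \<mu>)
  have "split_sum (m # \<mu>) (\<lambda>\<kappa> \<kappa>'. (\<Prod>m\<leftarrow>\<kappa>. f m) * (\<Prod>m\<leftarrow>\<kappa>'. g m))
    = (\<Sum>j\<le>m. split_sum \<mu> (\<lambda>\<kappa> \<kappa>'. (f j * g (m - j)) * ((\<Prod>m\<leftarrow>\<kappa>. f m) * (\<Prod>m\<leftarrow>\<kappa>'. g m))))"
    by (simp add: mult_ac)
  then show ?case unfolding split_sum_mult Cons by (simp add: sum_distrib_right)
qed simp

text \<open>Newton's identity with each of its traces split along \<open>{1..a}\<close> and
  \<open>{a + 1..n}\<close>. Summing over \<open>a\<close> removes the condition on the size of the
  first part.\<close>

lemma spin_prod_rec: "q ^ sum_list \<kappa> * spin_prod \<kappa> = split_sum \<kappa> (\<lambda>\<kappa>' \<kappa>''. spin_prod \<kappa>' * coxeter_trace \<kappa>'')"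
proof (cases "sum_list \<kappa> = 0")
  case True
  have "split_sum \<kappa> (\<lambda>\<kappa>' \<kappa>''. spin_prod \<kappa>' * coxeter_trace \<kappa>'') = split_sum \<kappa> (\<lambda>\<kappa>' \<kappa>''. if sum_list \<kappa>'' = 0 then spin_prod \<kappa>' else 0)"
    by (rule split_sum_cong) (use True in \<open>simp add: coxeter_trace_def del: sum_list_eq_0_iff\<close>)
  then show ?thesis using True by (simp add: split_sum_right del: sum_list_eq_0_iff)
next
  case False
  define n where "n = sum_list \<kappa>"
  have n: "0 < n" "sum_list \<kappa> = n" using False by (simp_all add: n_def del: sum_list_eq_0_iff)
  have X: "(q - 1) * norm_factor \<kappa> * op_bitrace n \<kappa> (symmetrizer right_T a * right_word [Suc a..<n]) / q_fact a =
      split_sum \<kappa> (\<lambda>\<kappa>' \<kappa>''. if sum_list \<kappa>' = a then spin_prod \<kappa>' * coxeter_trace \<kappa>'' else 0)" if a: "a < n" for a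
  proof -
    have c: "corresponds n (app (symmetrizer right_T a * right_word [Suc a..<n])) (app (symmetrizer right_T_sw a * word_sw [Suc a..<n]))"
      using a by (intro corresponds_mult corresponds_symz corresponds_rword) auto
    have J: "{1..n} = {1..a} \<union> {Suc a..n}" using a by auto
    have "norm_factor \<kappa> * op_bitrace n \<kappa> (symmetrizer right_T a * right_word [Suc a..<n]) = trace_norm ({1..a} \<union> {Suc a..n}) \<kappa> (symmetrizer right_T_sw a * word_sw [Suc a..<n])"
      using op_bitrace_Z[OF c n(2)] unfolding J[symmetric] by (simp add: trace_norm_def)
    also have "\<dots> = split_sum \<kappa> (\<lambda>\<kappa>' \<kappa>''. trace_norm {1..a} \<kappa>' (symmetrizer right_T_sw a) * trace_norm {Suc a..n} \<kappa>'' (word_sw [Suc a..<n]))"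
      using a n(2) by (intro trace_norm_mackey slicing_symmetrizer slicing_word_sw) auto
    finally have "(q - 1) * norm_factor \<kappa> * op_bitrace n \<kappa> (symmetrizer right_T a * right_word [Suc a..<n]) / q_fact a
      = split_sum \<kappa> (\<lambda>\<kappa>' \<kappa>''. ((q - 1) / q_fact a) * (trace_norm {1..a} \<kappa>' (symmetrizer right_T_sw a) * trace_norm {Suc a..n} \<kappa>'' (word_sw [Suc a..<n])))"
      unfolding split_sum_mult by (simp add: mult.assoc)
    also have "\<dots> = split_sum \<kappa> (\<lambda>\<kappa>' \<kappa>''. if sum_list \<kappa>' = a then spin_prod \<kappa>' * coxeter_trace \<kappa>'' else 0)"
    proof (rule split_sum_cong)
      fix \<kappa>' \<kappa>'' assume s: "sum_list \<kappa>' + sum_list \<kappa>'' = sum_list \<kappa>"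
      have "a + (n - a) = n" using a by simp
      then have w: "(q - 1) * trace_norm {Suc a..n} \<kappa>'' (word_sw [Suc a..<n]) = (if sum_list \<kappa>'' = n - a then coxeter_trace \<kappa>'' else 0)"
        using trace_norm_word[of "n - a" a \<kappa>''] a by simp
      have "(q - 1) / q_fact a * (trace_norm {1..a} \<kappa>' (symmetrizer right_T_sw a) * trace_norm {Suc a..n} \<kappa>'' (word_sw [Suc a..<n]))
        = trace_norm {1..a} \<kappa>' (symmetrizer right_T_sw a) / q_fact a * ((q - 1) * trace_norm {Suc a..n} \<kappa>'' (word_sw [Suc a..<n]))" by simp
      also have "\<dots> = (if sum_list \<kappa>' = a then spin_prod \<kappa>' * coxeter_trace \<kappa>'' else 0)"
        unfolding w trace_norm_symz using s n a by (auto simp: q_fact_ne_0)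
      finally show "(q - 1) / q_fact a * (trace_norm {1..a} \<kappa>' (symmetrizer right_T_sw a) * trace_norm {Suc a..n} \<kappa>'' (word_sw [Suc a..<n]))
        = (if sum_list \<kappa>' = a then spin_prod \<kappa>' * coxeter_trace \<kappa>'' else 0)" .
    qed
    finally show ?thesis .
  qed
  have "(q ^ n - 1) * spin_prod \<kappa> = (q - 1) * norm_factor \<kappa> * (q_int n * op_bitrace n \<kappa> (symmetrizer right_T n) / q_fact n)"
    using q_int_eq[of n] norm_factor_vv[of \<kappa>] op_bitrace_symz_vv[OF n(2)] q_fact_ne_0[of n] by (simp add: mult_ac flip: q_int_eq)
  also have "\<dots> = (\<Sum>a<n. split_sum \<kappa> (\<lambda>\<kappa>' \<kappa>''. if sum_list \<kappa>' = a then spin_prod \<kappa>' * coxeter_trace \<kappa>'' else 0))"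
    unfolding newton[OF n(2,1)] sum_distrib_left by (rule sum.cong) (simp_all add: X[symmetric])
  also have "\<dots> = split_sum \<kappa> (\<lambda>\<kappa>' \<kappa>''. \<Sum>a<n. if sum_list \<kappa>' = a then spin_prod \<kappa>' * coxeter_trace \<kappa>'' else 0)"
    by (rule split_sum_sum[symmetric])
  finally have "q ^ n * spin_prod \<kappa> = split_sum \<kappa> (\<lambda>\<kappa>' \<kappa>''. \<Sum>a<n. if sum_list \<kappa>' = a then spin_prod \<kappa>' * coxeter_trace \<kappa>'' else 0)
      + split_sum \<kappa> (\<lambda>\<kappa>' \<kappa>''. if sum_list \<kappa>'' = 0 then spin_prod \<kappa>' else 0)"
    by (simp add: split_sum_right algebra_simps del: sum_list_eq_0_iff)
  also have "\<dots> = split_sum \<kappa> (\<lambda>\<kappa>' \<kappa>''. spin_prod \<kappa>' * coxeter_trace \<kappa>'')"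
    unfolding split_sum_add[symmetric]
    by (rule split_sum_cong) (use n in \<open>auto simp: coxeter_trace_def simp del: sum_list_eq_0_iff\<close>)
  finally show ?thesis by (simp add: n_def)
qed

text \<open>By \<open>spin_coeff_al\<close> and \<open>split_sum_prod\<close> the products of
  \<open>alpha_q\<close> satisfy the recursion of \<open>spin_prod_rec\<close>. By induction the two
  sums agree except at the splitting with \<open>\<kappa>' = 0\<close>, whose coefficient is
  1.\<close>

lemma coxeter_trace_al: "coxeter_trace \<kappa> = (\<Prod>m\<leftarrow>\<kappa>. alpha_q m)"
proof (induction "sum_list \<kappa>" arbitrary: \<kappa> rule: less_induct)
  case less
  let ?P = "\<lambda>\<kappa>. \<Prod>m\<leftarrow>\<kappa>. alpha_q m"
  have P0: "?P \<kappa> = 1" "spin_prod \<kappa> = 1" if "sum_list \<kappa> = 0" for \<kappa>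
    using that by (induction \<kappa>) (auto simp: alpha_q_def alpha_def spin_prod_def spin_coeff_def)
  have "split_sum \<kappa> (\<lambda>\<kappa>' \<kappa>''. spin_prod \<kappa>' * ?P \<kappa>'') = (\<Prod>m\<leftarrow>\<kappa>. q ^ m * spin_coeff m)"
    unfolding spin_prod_def split_sum_prod spin_coeff_al ..
  also have "\<dots> = q ^ sum_list \<kappa> * spin_prod \<kappa>"
    unfolding spin_prod_def by (induction \<kappa>) (simp_all add: power_add mult_ac)
  finally have "split_sum \<kappa> (\<lambda>\<kappa>' \<kappa>''. spin_prod \<kappa>' * coxeter_trace \<kappa>'') = split_sum \<kappa> (\<lambda>\<kappa>' \<kappa>''. spin_prod \<kappa>' * ?P \<kappa>'')"
    by (simp add: spin_prod_rec)
  moreover have "split_sum \<kappa> (\<lambda>\<kappa>' \<kappa>''. spin_prod \<kappa>' * coxeter_trace \<kappa>'') = split_sum \<kappa> (\<lambda>\<kappa>' \<kappa>''. spin_prod \<kappa>' * ?P \<kappa>'' + (if sum_list \<kappa>' = 0 then coxeter_trace \<kappa>'' - ?P \<kappa>'' else 0))"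
  proof (rule split_sum_cong)
    fix \<kappa>' \<kappa>'' assume s: "sum_list \<kappa>' + sum_list \<kappa>'' = sum_list \<kappa>"
    show "spin_prod \<kappa>' * coxeter_trace \<kappa>'' = spin_prod \<kappa>' * ?P \<kappa>'' + (if sum_list \<kappa>' = 0 then coxeter_trace \<kappa>'' - ?P \<kappa>'' else 0)"
    proof (cases "sum_list \<kappa>' = 0")
      case True
      then show ?thesis using P0 by (simp del: sum_list_eq_0_iff)
    next
      case False
      then have "coxeter_trace \<kappa>'' = ?P \<kappa>''" using s by (intro less) linarith
      then show ?thesis using False by (simp del: sum_list_eq_0_iff)
    qed
  qed
  ultimately show ?case unfolding split_sum_add split_sum_left by simp
qed

section \<open>Matrices with given margins, column by column\<close>

definition matrix_sum :: "nat list \<Rightarrow> nat list \<Rightarrow> hc_field" where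
  "matrix_sum \<mu> \<nu> = (\<Sum>A\<in>margin_matrices \<mu> \<nu>. \<Prod>i<length \<mu>. \<Prod>j<length \<nu>. alpha_q (A i j))"

definition sub_comps :: "nat list \<Rightarrow> nat list set" where
  "sub_comps \<mu> = {\<kappa>. list_all2 (\<le>) \<kappa> \<mu>}"

lemma sub_comps_Cons: "sub_comps (m # \<mu>) = (\<lambda>(i, \<kappa>). i # \<kappa>) ` ({..m} \<times> sub_comps \<mu>)"
  by (auto simp: sub_comps_def list_all2_Cons2)

lemma finite_sub_comps: "finite (sub_comps \<mu>)"
  by (induction \<mu>) (simp_all add: sub_comps_Cons, simp add: sub_comps_def)

lemma split_sum_Ks: "split_sum \<mu> G = (\<Sum>\<kappa>\<in>sub_comps \<mu>. G \<kappa> (map2 (-) \<mu> \<kappa>))"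
proof (induction \<mu> arbitrary: G)
  case (Cons m \<mu>)
  have "inj_on (\<lambda>(i, \<kappa>). i # \<kappa>) ({..m} \<times> sub_comps \<mu>)" by (auto simp: inj_on_def)
  then show ?case
    by (simp add: sub_comps_Cons sum.reindex Cons sum.cartesian_product case_prod_unfold)
qed (simp add: sub_comps_def)

definition matrix_cons :: "nat \<Rightarrow> nat list \<Rightarrow> (nat \<Rightarrow> nat \<Rightarrow> nat) \<Rightarrow> nat \<Rightarrow> nat \<Rightarrow> nat" where
  "matrix_cons l \<kappa> A i j = (if i < l then (case j of 0 \<Rightarrow> \<kappa> ! i | Suc j' \<Rightarrow> A i j') else 0)"

lemma mm_decompose:
  assumes A: "A \<in> margin_matrices \<mu> (n # \<nu>)"
  defines "\<kappa> \<equiv> map (\<lambda>i. A i 0) [0..<length \<mu>]" and "B \<equiv> \<lambda>i j. A i (Suc j)"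
  shows "\<kappa> \<in> sub_comps \<mu>" "sum_list \<kappa> = n" "B \<in> margin_matrices (map2 (-) \<mu> \<kappa>) \<nu>" "matrix_cons (length \<mu>) \<kappa> B = A"
proof -
  have z: "\<And>i j. \<not> (i < length \<mu> \<and> j < Suc (length \<nu>)) \<Longrightarrow> A i j = 0"
    and r: "\<And>i. i < length \<mu> \<Longrightarrow> A i 0 + (\<Sum>j<length \<nu>. B i j) = \<mu> ! i"
    and c: "\<And>j. j < Suc (length \<nu>) \<Longrightarrow> (\<Sum>i<length \<mu>. A i j) = (n # \<nu>) ! j"
    using A by (auto simp: margin_matrices_def B_def sum.lessThan_Suc_shift simp del: sum.lessThan_Suc)
  show "\<kappa> \<in> sub_comps \<mu>" using r by (auto simp: sub_comps_def list_all2_conv_all_nth \<kappa>_def) (metis le_add1)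
  show "sum_list \<kappa> = n" using c[of 0] by (simp add: \<kappa>_def interv_sum_list_conv_sum_set_nat atLeast0LessThan)
  show "B \<in> margin_matrices (map2 (-) \<mu> \<kappa>) \<nu>"
    unfolding margin_matrices_def
  proof (intro CollectI conjI allI impI)
    fix i j assume "\<not> (i < length (map2 (-) \<mu> \<kappa>) \<and> j < length \<nu>)"
    then show "B i j = 0" using z[of i "Suc j"] by (auto simp: B_def \<kappa>_def)
  next
    fix i assume "i < length (map2 (-) \<mu> \<kappa>)"
    then show "(\<Sum>j<length \<nu>. B i j) = map2 (-) \<mu> \<kappa> ! i" using r[of i] by (simp add: \<kappa>_def)
  next
    fix j assume "j < length \<nu>"
    then show "(\<Sum>i<length (map2 (-) \<mu> \<kappa>). B i j) = \<nu> ! j" using c[of "Suc j"] by (simp add: B_def \<kappa>_def)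
  qed
  show "matrix_cons (length \<mu>) \<kappa> B = A"
    using z by (auto simp: matrix_cons_def fun_eq_iff \<kappa>_def B_def split: nat.splits)
qed

lemma mm_compose:
  assumes k: "\<kappa> \<in> sub_comps \<mu>" "sum_list \<kappa> = n" and B: "B \<in> margin_matrices (map2 (-) \<mu> \<kappa>) \<nu>"
  shows "matrix_cons (length \<mu>) \<kappa> B \<in> margin_matrices \<mu> (n # \<nu>)"
    "map (\<lambda>i. matrix_cons (length \<mu>) \<kappa> B i 0) [0..<length \<mu>] = \<kappa>" "(\<lambda>i j. matrix_cons (length \<mu>) \<kappa> B i (Suc j)) = B"
proof -
  have l: "length \<kappa> = length \<mu>" and le: "\<And>i. i < length \<mu> \<Longrightarrow> \<kappa> ! i \<le> \<mu> ! i"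
    using k(1) by (auto simp: sub_comps_def list_all2_conv_all_nth)
  have z: "\<And>i j. \<not> (i < length \<mu> \<and> j < length \<nu>) \<Longrightarrow> B i j = 0"
    and r: "\<And>i. i < length \<mu> \<Longrightarrow> (\<Sum>j<length \<nu>. B i j) = \<mu> ! i - \<kappa> ! i"
    and c: "\<And>j. j < length \<nu> \<Longrightarrow> (\<Sum>i<length \<mu>. B i j) = \<nu> ! j"
    using B l by (auto simp: margin_matrices_def)
  have s: "(\<Sum>i<length \<mu>. \<kappa> ! i) = n" using k(2) l by (simp add: sum_list_sum_nth atLeast0LessThan)
  show "matrix_cons (length \<mu>) \<kappa> B \<in> margin_matrices \<mu> (n # \<nu>)"
    unfolding margin_matrices_def
  proof (intro CollectI conjI allI impI)
    fix i j assume "\<not> (i < length \<mu> \<and> j < length (n # \<nu>))"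
    then show "matrix_cons (length \<mu>) \<kappa> B i j = 0" using z by (auto simp: matrix_cons_def split: nat.splits)
  next
    fix i assume "i < length \<mu>"
    then show "(\<Sum>j<length (n # \<nu>). matrix_cons (length \<mu>) \<kappa> B i j) = \<mu> ! i"
      using r[of i] le[of i] by (simp add: matrix_cons_def sum.lessThan_Suc_shift del: sum.lessThan_Suc)
  next
    fix j assume "j < length (n # \<nu>)"
    then show "(\<Sum>i<length \<mu>. matrix_cons (length \<mu>) \<kappa> B i j) = (n # \<nu>) ! j"
      using s c by (cases j) (simp_all add: matrix_cons_def)
  qed
  show "map (\<lambda>i. matrix_cons (length \<mu>) \<kappa> B i 0) [0..<length \<mu>] = \<kappa>"
    using l by (auto simp: matrix_cons_def intro!: nth_equalityI)
  show "(\<lambda>i j. matrix_cons (length \<mu>) \<kappa> B i (Suc j)) = B"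
    using z by (auto simp: matrix_cons_def fun_eq_iff)
qed

lemma finite_margin_matrices: "finite (margin_matrices \<mu> \<nu>)"
proof (induction \<nu> arbitrary: \<mu>)
  case Nil
  have "margin_matrices \<mu> [] \<subseteq> {\<lambda>i j. 0}" by (auto simp: margin_matrices_def fun_eq_iff)
  then show ?case by (rule finite_subset) simp
next
  case (Cons n \<nu>)
  have "margin_matrices \<mu> (n # \<nu>) \<subseteq> (\<lambda>(\<kappa>, B). matrix_cons (length \<mu>) \<kappa> B) ` (SIGMA \<kappa>:sub_comps \<mu>. margin_matrices (map2 (-) \<mu> \<kappa>) \<nu>)"
  proof
    fix A assume "A \<in> margin_matrices \<mu> (n # \<nu>)"
    note d = mm_decompose[OF this]
    show "A \<in> (\<lambda>(\<kappa>, B). matrix_cons (length \<mu>) \<kappa> B) ` (SIGMA \<kappa>:sub_comps \<mu>. margin_matrices (map2 (-) \<mu> \<kappa>) \<nu>)"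
      by (rule image_eqI[where x = "(map (\<lambda>i. A i 0) [0..<length \<mu>], \<lambda>i j. A i (Suc j))"]) (use d in simp_all)
  qed
  then show ?case by (rule finite_subset) (intro finite_imageI finite_SigmaI finite_sub_comps Cons)
qed

text \<open>The first column is \<open>\<kappa>\<close>; the other columns form a matrix whose row
  sums are reduced accordingly, possibly to 0.\<close>

lemma matrix_sum_Cons: "matrix_sum \<mu> (n # \<nu>) = split_sum \<mu> (\<lambda>\<kappa> \<kappa>'. if sum_list \<kappa> = n then (\<Prod>m\<leftarrow>\<kappa>. alpha_q m) * matrix_sum \<kappa>' \<nu> else 0)"
proof -
  let ?K = "{\<kappa> \<in> sub_comps \<mu>. sum_list \<kappa> = n}"
  let ?l = "length \<mu>"
  have len: "length \<kappa> = ?l" if "\<kappa> \<in> sub_comps \<mu>" for \<kappa> using that by (simp add: sub_comps_def list_all2_lengthD)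
  have "matrix_sum \<mu> (n # \<nu>) = (\<Sum>(\<kappa>, B)\<in>(SIGMA \<kappa>:?K. margin_matrices (map2 (-) \<mu> \<kappa>) \<nu>).
      (\<Prod>m\<leftarrow>\<kappa>. alpha_q m) * (\<Prod>i<?l. \<Prod>j<length \<nu>. alpha_q (B i j)))"
    unfolding matrix_sum_def
  proof (rule sum.reindex_bij_witness[where i = "\<lambda>(\<kappa>, B). matrix_cons ?l \<kappa> B" and j = "\<lambda>A. (map (\<lambda>i. A i 0) [0..<?l], \<lambda>i j. A i (Suc j))"])
    fix A assume A: "A \<in> margin_matrices \<mu> (n # \<nu>)"
    note d = mm_decompose[OF A]
    show "(case (map (\<lambda>i. A i 0) [0..<?l], \<lambda>i j. A i (Suc j)) of (\<kappa>, B) \<Rightarrow> matrix_cons ?l \<kappa> B) = A" using d(4) by simp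
    show "(map (\<lambda>i. A i 0) [0..<?l], \<lambda>i j. A i (Suc j)) \<in> (SIGMA \<kappa>:?K. margin_matrices (map2 (-) \<mu> \<kappa>) \<nu>)"
      using d(1,2,3) by simp
    have "(\<Prod>m\<leftarrow>map (\<lambda>i. A i 0) [0..<?l]. alpha_q m) = (\<Prod>i<?l. alpha_q (A i 0))"
      by (simp add: comp_def prod.list_conv_set_nth atLeast0LessThan)
    then show "(case (map (\<lambda>i. A i 0) [0..<?l], \<lambda>i j. A i (Suc j)) of (\<kappa>, B) \<Rightarrow>
        (\<Prod>m\<leftarrow>\<kappa>. alpha_q m) * (\<Prod>i<?l. \<Prod>j<length \<nu>. alpha_q (B i j))) = (\<Prod>i<?l. \<Prod>j<length (n # \<nu>). alpha_q (A i j))"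
      by (simp add: prod.lessThan_Suc_shift prod.distrib del: prod.lessThan_Suc map_map)
  next
    fix b assume "b \<in> (SIGMA \<kappa>:?K. margin_matrices (map2 (-) \<mu> \<kappa>) \<nu>)"
    then obtain \<kappa> B where b: "b = (\<kappa>, B)" "\<kappa> \<in> sub_comps \<mu>" "sum_list \<kappa> = n" "B \<in> margin_matrices (map2 (-) \<mu> \<kappa>) \<nu>" by auto
    note c = mm_compose[OF b(2,3,4)]
    show "(map (\<lambda>i. (case b of (\<kappa>, B) \<Rightarrow> matrix_cons ?l \<kappa> B) i 0) [0..<?l], \<lambda>i j. (case b of (\<kappa>, B) \<Rightarrow> matrix_cons ?l \<kappa> B) i (Suc j)) = b"
      unfolding b(1) prod.case c(2,3) ..
    show "(case b of (\<kappa>, B) \<Rightarrow> matrix_cons ?l \<kappa> B) \<in> margin_matrices \<mu> (n # \<nu>)" unfolding b(1) prod.case by (rule c(1))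
  qed
  also have "\<dots> = (\<Sum>\<kappa>\<in>?K. \<Sum>B\<in>margin_matrices (map2 (-) \<mu> \<kappa>) \<nu>. (\<Prod>m\<leftarrow>\<kappa>. alpha_q m) * (\<Prod>i<?l. \<Prod>j<length \<nu>. alpha_q (B i j)))"
    by (rule sum.Sigma[symmetric]) (simp_all add: finite_sub_comps finite_margin_matrices)
  also have "\<dots> = (\<Sum>\<kappa>\<in>?K. (\<Prod>m\<leftarrow>\<kappa>. alpha_q m) * matrix_sum (map2 (-) \<mu> \<kappa>) \<nu>)"
    by (rule sum.cong) (simp_all add: matrix_sum_def sum_distrib_left len)
  also have "\<dots> = (\<Sum>\<kappa>\<in>sub_comps \<mu>. if sum_list \<kappa> = n then (\<Prod>m\<leftarrow>\<kappa>. alpha_q m) * matrix_sum (map2 (-) \<mu> \<kappa>) \<nu> else 0)"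
    by (rule sum.inter_filter) (rule finite_sub_comps)
  finally show ?thesis by (simp add: split_sum_Ks)
qed

lemma trace_norm_RS:
  assumes "\<forall>m\<in>set \<nu>. 0 < m" "sum_list \<mu> = sum_list \<nu>"
  shows "(q - 1) ^ length \<nu> * trace_norm {Suc d..d + sum_list \<nu>} \<mu> (word_sw (coxeter_word d \<nu>)) = matrix_sum \<mu> \<nu>"
  using assms
proof (induction \<nu> arbitrary: \<mu> d)
  case Nil
  have z: "\<forall>m\<in>set \<mu>. m = 0" using Nil by simp
  have "left_coxeter \<mu> F [] = F []" "norm_factor \<mu> = 1" for F :: "slist \<Rightarrow> hc_field"
    using z by (induction \<mu>) (auto simp: norm_factor_def)
  moreover have "signed_words {} = {[]}" by (auto simp: signed_words_def)
  moreover have "margin_matrices \<mu> [] = {\<lambda>i j. 0}"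
    using z by (auto simp: margin_matrices_def fun_eq_iff)
  ultimately show ?case using Nil by (simp add: trace_norm_def trace_sw_def matrix_sum_def delta_def)
next
  case (Cons n \<nu>)
  let ?J = "{Suc d..d + n}" and ?K = "{Suc (d + n)..d + n + sum_list \<nu>}"
  have n: "0 < n" using Cons.prems by simp
  have JK: "{Suc d..d + sum_list (n # \<nu>)} = ?J \<union> ?K" by auto
  have "trace_norm (?J \<union> ?K) \<mu> (word_sw [d + 1..<d + n] * word_sw (coxeter_word (d + n) \<nu>))
    = split_sum \<mu> (\<lambda>\<kappa> \<kappa>'. trace_norm ?J \<kappa> (word_sw [d + 1..<d + n]) * trace_norm ?K \<kappa>' (word_sw (coxeter_word (d + n) \<nu>)))"
    using Cons.prems set_coxeter_word[of "d + n" \<nu>] by (intro trace_norm_mackey slicing_word_sw) fastforce+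
  then have "(q - 1) ^ length (n # \<nu>) * trace_norm {Suc d..d + sum_list (n # \<nu>)} \<mu> (word_sw (coxeter_word d (n # \<nu>)))
    = split_sum \<mu> (\<lambda>\<kappa> \<kappa>'. ((q - 1) * trace_norm ?J \<kappa> (word_sw [d + 1..<d + n])) * ((q - 1) ^ length \<nu> * trace_norm ?K \<kappa>' (word_sw (coxeter_word (d + n) \<nu>))))"
    unfolding JK by (simp add: split_sum_mult[symmetric] mult_ac)
  also have "\<dots> = split_sum \<mu> (\<lambda>\<kappa> \<kappa>'. if sum_list \<kappa> = n then (\<Prod>m\<leftarrow>\<kappa>. alpha_q m) * matrix_sum \<kappa>' \<nu> else 0)"
  proof (rule split_sum_cong)
    fix \<kappa> \<kappa>' assume s: "sum_list \<kappa> + sum_list \<kappa>' = sum_list \<mu>"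
    have w: "(q - 1) * trace_norm ?J \<kappa> (word_sw [d + 1..<d + n]) = (if sum_list \<kappa> = n then coxeter_trace \<kappa> else 0)"
      using trace_norm_word[OF n, of d \<kappa>] unfolding Suc_eq_plus1[symmetric] .
    show "((q - 1) * trace_norm ?J \<kappa> (word_sw [d + 1..<d + n])) * ((q - 1) ^ length \<nu> * trace_norm ?K \<kappa>' (word_sw (coxeter_word (d + n) \<nu>)))
      = (if sum_list \<kappa> = n then (\<Prod>m\<leftarrow>\<kappa>. alpha_q m) * matrix_sum \<kappa>' \<nu> else 0)"
    proof (cases "sum_list \<kappa> = n")
      case True
      then have "sum_list \<kappa>' = sum_list \<nu>" using s Cons.prems by simp
      then show ?thesis using True Cons.IH[of \<kappa>' "d + n"] Cons.prems by (simp only: w coxeter_trace_al) simp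
    next
      case False
      then show ?thesis by (simp only: w) simp
    qed
  qed
  finally show ?case unfolding matrix_sum_Cons .
qed

theorem theorem4p5:
  fixes n :: nat and \<mu> \<nu> :: "nat list"
  assumes "composition_of \<mu> n" and "composition_of \<nu> n"
  shows "sbtr_comp n \<mu> \<nu> =
    (q - 1) powi (- int (length \<mu>) - int (length \<nu>)) *
    (\<Sum>A \<in> margin_matrices \<mu> \<nu>.
       \<Prod>i < length \<mu>. \<Prod>j < length \<nu>. poly (alpha (A i j)) q)"
proof -
  have \<mu>: "\<forall>m\<in>set \<mu>. 0 < m" "sum_list \<mu> = n" and \<nu>: "\<forall>m\<in>set \<nu>. 0 < m" "sum_list \<nu> = n"
    using assms by (simp_all add: composition_of_def)
  have w: "set (coxeter_word 0 \<nu>) \<subseteq> {1..<n}" using set_coxeter_word[of 0 \<nu>] \<nu> by simp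
  have "sbtr_comp n \<mu> \<nu> = op_bitrace n \<mu> (right_word (coxeter_word 0 \<nu>))"
    using sbtr_comp_trace[OF \<mu>(2) \<nu>(2)] by (simp add: op_bitrace_def)
  also have "\<dots> = trace_sw {1..n} \<mu> (word_sw (coxeter_word 0 \<nu>))"
    by (rule op_bitrace_Z[OF corresponds_rword[OF w] \<mu>(2)])
  finally have "norm_factor \<mu> * sbtr_comp n \<mu> \<nu> = trace_norm {1..n} \<mu> (word_sw (coxeter_word 0 \<nu>))" by (simp add: trace_norm_def)
  moreover have "(q - 1) ^ length \<nu> * trace_norm {1..n} \<mu> (word_sw (coxeter_word 0 \<nu>)) = matrix_sum \<mu> \<nu>"
    using trace_norm_RS[OF \<nu>(1), of \<mu> 0] \<mu> \<nu> by (simp add: One_nat_def)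
  \<comment> \<open>All parts of \<open>\<mu>\<close> are positive here, so counting nonzero parts
    is counting parts.\<close>
  moreover have "norm_factor \<mu> = (q - 1) ^ length \<mu>"
    using \<mu>(1) by (induction \<mu>) (auto simp: norm_factor_def)
  moreover have "(q - 1) ^ (length \<mu> + length \<nu>) * sbtr_comp n \<mu> \<nu> = (q - 1) ^ length \<nu> * ((q - 1) ^ length \<mu> * sbtr_comp n \<mu> \<nu>)"
    by (simp add: power_add mult_ac)
  ultimately have "(q - 1) ^ (length \<mu> + length \<nu>) * sbtr_comp n \<mu> \<nu> = matrix_sum \<mu> \<nu>"
    by metis
  moreover have "(q - 1) powi (- int (length \<mu>) - int (length \<nu>)) = inverse ((q - 1) ^ (length \<mu> + length \<nu>))"
  proof -
    have "- int (length \<mu>) - int (length \<nu>) = - int (length \<mu> + length \<nu>)" by simp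
    then show ?thesis by (simp only: power_int_minus power_int_of_nat)
  qed
  moreover have "sbtr_comp n \<mu> \<nu> = inverse ((q - 1) ^ (length \<mu> + length \<nu>)) * ((q - 1) ^ (length \<mu> + length \<nu>) * sbtr_comp n \<mu> \<nu>)"
    by simp
  ultimately show ?thesis by (simp only: matrix_sum_def alpha_q_def)
qed

end
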